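(* Let $\mathsf H$ be the game and $\mathsf H_e$ the associated expanded virtual game defined in the context, and let $V_t^u$, $V_t^l$ be the value functions of the min-max and max-min dynamic programs. With $\Pi_1(x_1)=\mathbb P(X_1=x_1\mid C_1)$, the value of the game $\mathsf H$ is given by $$S(\mathsf H)=\mathbb E[V_1^u(\Pi_1)]=\mathbb E[V_1^l(\Pi_1)].$$ Further, the strategies $\tilde\chi^{1*}$ and $\tilde\chi^{2*}$ defined in the context are, respectively, a min-max strategy (it attains the infimum in $\inf_{\tilde\chi^1}\sup_{\tilde\chi^2}\mathcal J(\tilde\chi^1,\tilde\chi^2)$) and a max-min strategy (it attains the supremum in $\sup_{\tilde\chi^2}\inf_{\tilde\chi^1}\mathcal J(\tilde\chi^1,\tilde\chi^2)$) in the expanded virtual game $\mathsf H_e$.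
   Context: $\Delta\mathcal A$ is the probability simplex over a finite set $\mathcal A$; $X_{a:b}=(X_a,\dots,X_b)$, $X^{1:2}=(X^1,X^2)$. **Game $\mathsf H$.** Fix a horizon $T$ and finite sets $\mathcal X_t,\mathcal U_t^1,\mathcal U_t^2,\mathcal Y_t^2$. The state evolves as $X_{t+1}=f_t(X_t,U_t^1,U_t^2,W_t^s)$, and player 2 gets the observation $Y_t^2=h_t^2(X_t,U_{t-1}^1,U_{t-1}^2,W_t^2)$ (no action arguments at $t=1$). The random variables $X_1,W_t^s,W_t^2$ take finitely many values and are mutually independent. Objects indexed by $T+1$ are defined by the same equations. The common information is $C_t=\{Y_{1:t}^2,U_{1:t-1}^2\}$ (realization set $\mathcal C_t$), with increments $Z_{t+1}=(Y_{t+1}^2,U_t^2)$. At time $t$ player 1 knows $C_t$ and its private information $X_t$; player 2 knows only $C_t$. Behavioral strategies are $g^1=(g_t^1)_{t\le T}$, $g_t^1:\mathcal X_t\times\mathcal C_t\to\Delta\mathcal U_t^1$, and $g^2=(g_t^2)_{t\le T}$, $g_t^2:\mathcal C_t\to\Delta\mathcal U_t^2$; actions are drawn from $g_t^1(X_t,C_t)$ and $g_t^2(C_t)$ using randomizations independent across players and time and independent of $X_1,W_t^s,W_t^2$. The cost is $J(g^1,g^2)=\mathbb E^{(g^1,g^2)}[\sum_{t=1}^Tc_t(X_t,U_t^1,U_t^2)]$ with $c_t:\mathcal X_t\times\mathcal U_t^1\times\mathcal U_t^2\to\mathbb R$; player 1 minimizes, player 2 maximizes. The value $S(\mathsf H)$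 is the common number $\inf_{g^1}\sup_{g^2}J(g^1,g^2)=\sup_{g^2}\inf_{g^1}J(g^1,g^2)$. **Expanded virtual game $\mathsf H_e$.** Same system and cost functions, but at time $t$ the virtual players select prescriptions $\Gamma_t^1\in\mathcal B_t^1=\{\text{maps }\mathcal X_t\to\Delta\mathcal U_t^1\}$ and $\Gamma_t^2\in\mathcal B_t^2=\Delta\mathcal U_t^2$ as $\Gamma_t^i=\tilde\chi_t^i(C_t,\Gamma_{1:t-1}^{1:2})$; then $U_t^1$ is drawn from $\Gamma_t^1(X_t)$ and $U_t^2$ from $\Gamma_t^2$ (using randomizations independent across players and time and independent of $X_1,W_t^s,W_t^2$). The cost is $\mathcal J(\tilde\chi^1,\tilde\chi^2)=\mathbb E^{(\tilde\chi^1,\tilde\chi^2)}[\sum_{t=1}^Tc_t(X_t,U_t^1,U_t^2)]$, where $\tilde\chi^i=(\tilde\chi_1^i,\dots,\tilde\chi_T^i)$ ranges over all strategies of virtual player $i$. **Belief update.** Let $\mathcal S_t=\Delta\mathcal X_t$, and write $\gamma^1(x;u)$ for the probability of $u$ under $\gamma^1(x)$. For $z=(y^2,u^2)$ put $$Q_t(\pi,\gamma^1,z;x')=\sum_{x,u^1}\pi(x)\gamma^1(x;u^1)\,\mathbb P[X_{t+1}=x',Y_{t+1}^2=y^2\mid X_t=x,U_t^1=u^1,U_t^2=u^2],\quad R_t(\pi,\gamma^1,z)=\sum_{x'}Q_t(\pi,\gamma^1,z;x').$$ $F_t(\pi,\gamma^1,z)=Q_t(\pi,\gamma^1,z;\cdot)/R_t(\pi,\gamma^1,z)$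 if $R_t(\pi,\gamma^1,z)>0$, and $F_t(\pi,\gamma^1,z)$ is the uniform distribution on $\mathcal X_{t+1}$ otherwise. **Dynamic programs.** Let $\tilde c_t(\pi,\gamma^1,\gamma^2)=\sum_{x,u^1,u^2}c_t(x,u^1,u^2)\pi(x)\gamma^1(x;u^1)\gamma^2(u^2)$. Min-max: $V_{T+1}^u\equiv0$ and for $t\le T$, $\pi_t\in\mathcal S_t$, $$w_t^u(\pi_t,\gamma_t^1,\gamma_t^2)=\tilde c_t(\pi_t,\gamma_t^1,\gamma_t^2)+\mathbb E[V_{t+1}^u(F_t(\pi_t,\gamma_t^1,Z_{t+1}))\mid\pi_t,\gamma_t^{1:2}],\quad V_t^u(\pi_t)=\inf_{\gamma_t^1\in\mathcal B_t^1}\sup_{\gamma_t^2\in\mathcal B_t^2}w_t^u(\pi_t,\gamma_t^1,\gamma_t^2),$$ where given $(\pi_t,\gamma_t^{1:2})$ the variable $Z_{t+1}$ equals $z=(y^2,u^2)$ with probability $\gamma_t^2(u^2)R_t(\pi_t,\gamma_t^1,z)$. Max-min: $V_{T+1}^l\equiv0$, $w_t^l$ is defined by the same formula with $V_{t+1}^l$, and $V_t^l(\pi_t)=\sup_{\gamma_t^2}\inf_{\gamma_t^1}w_t^l(\pi_t,\gamma_t^1,\gamma_t^2)$. Let $\Xi_t^i:\mathcal S_t\to\mathcal B_t^i$ be measurable with $V_t^u(\pi_t)=\max_{\gamma_t^2}w_t^u(\pi_t,\Xi_t^1(\pi_t),\gamma_t^2)$ and $V_t^l(\pi_t)=\min_{\gamma_t^1}w_t^l(\pi_t,\gamma_t^1,\Xi_t^2(\pi_t))$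 for all $\pi_t$ (such maps exist). **Strategies $\tilde\chi^{1*},\tilde\chi^{2*}$.** For each $c_t$ and $\gamma_{1:t-1}^{1:2}$: $\tilde\chi_t^{1*}(c_t,\gamma_{1:t-1}^{1:2})=\Xi_t^1(\pi_t)$ and $\tilde\chi_t^{2*}(c_t,\gamma_{1:t-1}^{1:2})=\Xi_t^2(\pi_t)$, where $\pi_1(x_1)=\mathbb P[X_1=x_1\mid C_1=c_1]$ and $\pi_{\tau+1}=F_\tau(\pi_\tau,\gamma_\tau^1,z_{\tau+1})$ for $1\le\tau<t$. *)

theory Defs
  imports "HOL-Probability.Probability"
begin

section \<open>Probability simplices\<close>

definition prob_simplex :: "'a set \<Rightarrow> 'a pmf set" where
  "prob_simplex A = {p. set_pmf p \<subseteq> A}"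

text \<open>For finite \<open>A\<close> this is the Borel \<open>\<sigma>\<close>-algebra of the simplex as a subset of \<open>\<real>\<^sup>A\<close>.\<close>

definition simplex_borel :: "'a set \<Rightarrow> 'a pmf measure" where
  "simplex_borel A =
     vimage_algebra (prob_simplex A) (\<lambda>p. restrict (pmf p) A) (\<Pi>\<^sub>M a\<in>A. borel)"

section \<open>The game\<close>

text \<open>
  All time-dependent objects are families over \<open>nat\<close>, and time starts at 1.  Actions and noises
  range over \<open>1..T\<close>; states, observations and observation noises over \<open>1..T+1\<close>.
  Entries at other indices are never used.  The type parameters are, in this order: states,
  actions of player 1, actions of player 2, observations of player 2, values of the system noise
  and values of the observation noise.
\<close>

record ('x, 'a, 'b, 'y, 's, 'o) game =
  horizon :: nat
  states :: "nat \<Rightarrow> 'x set"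
  acts1 :: "nat \<Rightarrow> 'a set"
  acts2 :: "nat \<Rightarrow> 'b set"
  obss :: "nat \<Rightarrow> 'y set"
  dyn :: "nat \<Rightarrow> 'x \<Rightarrow> 'a \<Rightarrow> 'b \<Rightarrow> 's \<Rightarrow> 'x"
  obs_init :: "'x \<Rightarrow> 'o \<Rightarrow> 'y"
  obs_fun :: "nat \<Rightarrow> 'x \<Rightarrow> 'a \<Rightarrow> 'b \<Rightarrow> 'o \<Rightarrow> 'y"
  init_law :: "'x pmf"
  sys_noise :: "nat \<Rightarrow> 's pmf"
  obs_noise :: "nat \<Rightarrow> 'o pmf"
  cost :: "nat \<Rightarrow> 'x \<Rightarrow> 'a \<Rightarrow> 'b \<Rightarrow> real"

definition valid_game :: "('x, 'a, 'b, 'y, 's, 'o) game \<Rightarrow> bool" where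
  "valid_game G \<longleftrightarrow>
     1 \<le> horizon G \<and>
     (\<forall>t\<in>{1..horizon G + 1}. finite (states G t) \<and> states G t \<noteq> {} \<and>
                            finite (obss G t) \<and> obss G t \<noteq> {}) \<and>
     (\<forall>t\<in>{1..horizon G}. finite (acts1 G t) \<and> acts1 G t \<noteq> {} \<and>
                        finite (acts2 G t) \<and> acts2 G t \<noteq> {}) \<and>
     init_law G \<in> prob_simplex (states G 1) \<and>
     (\<forall>t\<in>{1..horizon G}. finite (set_pmf (sys_noise G t))) \<and>
     (\<forall>t\<in>{1..horizon G + 1}. finite (set_pmf (obs_noise G t))) \<and>
     (\<forall>t\<in>{1..horizon G}. \<forall>x\<in>states G t. \<forall>a\<in>acts1 G t. \<forall>b\<in>acts2 G t.
        \<forall>w\<in>set_pmf (sys_noise G t). dyn G t x a b w \<in> states G (t + 1)) \<and>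
     (\<forall>x\<in>states G 1. \<forall>v\<in>set_pmf (obs_noise G 1). obs_init G x v \<in> obss G 1) \<and>
     (\<forall>t\<in>{1..horizon G}. \<forall>x\<in>states G (t + 1). \<forall>a\<in>acts1 G t. \<forall>b\<in>acts2 G t.
        \<forall>v\<in>set_pmf (obs_noise G (t + 1)). obs_fun G (t + 1) x a b v \<in> obss G (t + 1))"

text \<open>The law of \<open>(X\<^sub>t\<^sub>+\<^sub>1, Y\<^sub>t\<^sub>+\<^sub>1)\<close> given \<open>X\<^sub>t = x\<close>, \<open>U\<^sub>t = (a, b)\<close>.\<close>

definition kernel :: "('x, 'a, 'b, 'y, 's, 'o) game \<Rightarrow> nat \<Rightarrow> 'x \<Rightarrow> 'a \<Rightarrow> 'b \<Rightarrow> ('x \<times> 'y) pmf" where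
  "kernel G t x a b = do {
     w \<leftarrow> sys_noise G t;
     v \<leftarrow> obs_noise G (t + 1);
     let x' = dyn G t x a b w;
     return_pmf (x', obs_fun G (t + 1) x' a b v)
   }"

section \<open>Controlled processes\<close>

text \<open>A trajectory stores the processes \<open>X\<close>, \<open>Y\<close>, \<open>U\<^sup>1\<close>, \<open>U\<^sup>2\<close>, each \<open>undefined\<close> where not yet drawn.\<close>

record ('x, 'a, 'b, 'y) traj =
  st :: "nat \<Rightarrow> 'x"
  ob :: "nat \<Rightarrow> 'y"
  ac1 :: "nat \<Rightarrow> 'a"
  ac2 :: "nat \<Rightarrow> 'b"

type_synonym ('b, 'y) cinfo = "(nat \<Rightarrow> 'y) \<times> (nat \<Rightarrow> 'b)"

text \<open>A realization of \<open>C\<^sub>t\<close> is a pair of extensional functions on \<open>{1..t}\<close> and \<open>{1..<t}\<close>.\<close>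

definition trunc :: "nat \<Rightarrow> ('b, 'y) cinfo \<Rightarrow> ('b, 'y) cinfo" where
  "trunc t c = (restrict (fst c) {1..t}, restrict (snd c) {1..<t})"

definition common :: "nat \<Rightarrow> ('x, 'a, 'b, 'y) traj \<Rightarrow> ('b, 'y) cinfo" where
  "common t \<omega> = trunc t (ob \<omega>, ac2 \<omega>)"

definition cinfos :: "('x, 'a, 'b, 'y, 's, 'o) game \<Rightarrow> nat \<Rightarrow> ('b, 'y) cinfo set" where
  "cinfos G t = (\<Pi>\<^sub>E \<tau>\<in>{1..t}. obss G \<tau>) \<times> (\<Pi>\<^sub>E \<tau>\<in>{1..<t}. acts2 G \<tau>)"

definition start :: "('x, 'a, 'b, 'y, 's, 'o) game \<Rightarrow> ('x, 'a, 'b, 'y) traj pmf" where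
  "start G = do {
     x \<leftarrow> init_law G;
     v \<leftarrow> obs_noise G 1;
     return_pmf \<lparr>st = (\<lambda>_. undefined)(1 := x), ob = (\<lambda>_. undefined)(1 := obs_init G x v),
                 ac1 = (\<lambda>_. undefined), ac2 = (\<lambda>_. undefined)\<rparr>
   }"

text \<open>
  \<open>law G \<alpha>\<^sub>1 \<alpha>\<^sub>2 n\<close> is the joint law of \<open>X\<close>, \<open>Y\<close> up to time \<open>n + 1\<close> and of the actions up to time \<open>n\<close>
  when the actions at time \<open>t\<close> are drawn from \<open>\<alpha>\<^sub>1 t \<omega>\<close> and \<open>\<alpha>\<^sub>2 t \<omega>\<close>.  Every draw is a fresh one, which
  is the mutual independence of \<open>X\<^sub>1\<close>, the noises and the players' randomizations.
\<close>

primrec law ::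
  "('x, 'a, 'b, 'y, 's, 'o) game
   \<Rightarrow> (nat \<Rightarrow> ('x, 'a, 'b, 'y) traj \<Rightarrow> 'a pmf) \<Rightarrow> (nat \<Rightarrow> ('x, 'a, 'b, 'y) traj \<Rightarrow> 'b pmf)
   \<Rightarrow> nat \<Rightarrow> ('x, 'a, 'b, 'y) traj pmf" where
  "law G \<alpha>1 \<alpha>2 0 = start G"
| "law G \<alpha>1 \<alpha>2 (Suc n) = do {
     \<omega> \<leftarrow> law G \<alpha>1 \<alpha>2 n;
     a \<leftarrow> \<alpha>1 (Suc n) \<omega>;
     b \<leftarrow> \<alpha>2 (Suc n) \<omega>;
     (x', y') \<leftarrow> kernel G (Suc n) (st \<omega> (Suc n)) a b;
     return_pmf \<lparr>st = (st \<omega>)(Suc (Suc n) := x'), ob = (ob \<omega>)(Suc (Suc n) := y'),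
                 ac1 = (ac1 \<omega>)(Suc n := a), ac2 = (ac2 \<omega>)(Suc n := b)\<rparr>
   }"

definition total_cost :: "('x, 'a, 'b, 'y, 's, 'o) game \<Rightarrow> ('x, 'a, 'b, 'y) traj \<Rightarrow> real" where
  "total_cost G \<omega> = (\<Sum>t=1..horizon G. cost G t (st \<omega> t) (ac1 \<omega> t) (ac2 \<omega> t))"

section \<open>Behavioral strategies and the value\<close>

definition strat1 ::
  "('x, 'a, 'b, 'y, 's, 'o) game \<Rightarrow> (nat \<Rightarrow> 'x \<Rightarrow> ('b, 'y) cinfo \<Rightarrow> 'a pmf) set" where
  "strat1 G = {g. \<forall>t\<in>{1..horizon G}. \<forall>x\<in>states G t. \<forall>c\<in>cinfos G t.
                    g t x c \<in> prob_simplex (acts1 G t)}"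

definition strat2 ::
  "('x, 'a, 'b, 'y, 's, 'o) game \<Rightarrow> (nat \<Rightarrow> ('b, 'y) cinfo \<Rightarrow> 'b pmf) set" where
  "strat2 G = {g. \<forall>t\<in>{1..horizon G}. \<forall>c\<in>cinfos G t. g t c \<in> prob_simplex (acts2 G t)}"

definition game_cost ::
  "('x, 'a, 'b, 'y, 's, 'o) game \<Rightarrow> (nat \<Rightarrow> 'x \<Rightarrow> ('b, 'y) cinfo \<Rightarrow> 'a pmf)
   \<Rightarrow> (nat \<Rightarrow> ('b, 'y) cinfo \<Rightarrow> 'b pmf) \<Rightarrow> real" where
  "game_cost G g1 g2 =
     measure_pmf.expectation
       (law G (\<lambda>t \<omega>. g1 t (st \<omega> t) (common t \<omega>)) (\<lambda>t \<omega>. g2 t (common t \<omega>)) (horizon G))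
       (total_cost G)"

definition is_value :: "('x, 'a, 'b, 'y, 's, 'o) game \<Rightarrow> real \<Rightarrow> bool" where
  "is_value G v \<longleftrightarrow>
     (INF g1\<in>strat1 G. SUP g2\<in>strat2 G. game_cost G g1 g2) = v \<and>
     (SUP g2\<in>strat2 G. INF g1\<in>strat1 G. game_cost G g1 g2) = v"

section \<open>The expanded virtual game\<close>

definition presc1 :: "('x, 'a, 'b, 'y, 's, 'o) game \<Rightarrow> nat \<Rightarrow> ('x \<Rightarrow> 'a pmf) set" where
  "presc1 G t = (\<Pi>\<^sub>E x\<in>states G t. prob_simplex (acts1 G t))"

definition presc2 :: "('x, 'a, 'b, 'y, 's, 'o) game \<Rightarrow> nat \<Rightarrow> 'b pmf set" where
  "presc2 G t = prob_simplex (acts2 G t)"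

type_synonym ('x, 'a, 'b) presc_hist = "nat \<Rightarrow> ('x \<Rightarrow> 'a pmf) \<times> 'b pmf"

text \<open>The realizations of \<open>\<Gamma>\<^sub>1\<^sub>:\<^sub>t\<^sub>-\<^sub>1\<close>.\<close>

definition presc_hists ::
  "('x, 'a, 'b, 'y, 's, 'o) game \<Rightarrow> nat \<Rightarrow> ('x, 'a, 'b) presc_hist set" where
  "presc_hists G t = (\<Pi>\<^sub>E \<tau>\<in>{1..<t}. presc1 G \<tau> \<times> presc2 G \<tau>)"

type_synonym ('x, 'a, 'b, 'y) vstrategy1 =
  "nat \<Rightarrow> ('b, 'y) cinfo \<Rightarrow> ('x, 'a, 'b) presc_hist \<Rightarrow> 'x \<Rightarrow> 'a pmf"

type_synonym ('x, 'a, 'b, 'y) vstrategy2 =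
  "nat \<Rightarrow> ('b, 'y) cinfo \<Rightarrow> ('x, 'a, 'b) presc_hist \<Rightarrow> 'b pmf"

definition vstrat1 ::
  "('x, 'a, 'b, 'y, 's, 'o) game \<Rightarrow> ('x, 'a, 'b, 'y) vstrategy1 set" where
  "vstrat1 G = {\<psi>. \<forall>t\<in>{1..horizon G}. \<forall>c\<in>cinfos G t. \<forall>\<gamma>\<in>presc_hists G t.
                    \<psi> t c \<gamma> \<in> presc1 G t}"

definition vstrat2 ::
  "('x, 'a, 'b, 'y, 's, 'o) game \<Rightarrow> ('x, 'a, 'b, 'y) vstrategy2 set" where
  "vstrat2 G = {\<psi>. \<forall>t\<in>{1..horizon G}. \<forall>c\<in>cinfos G t. \<forall>\<gamma>\<in>presc_hists G t.
                    \<psi> t c \<gamma> \<in> presc2 G t}"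

text \<open>The prescriptions \<open>\<Gamma>\<^sub>1\<^sub>:\<^sub>n\<close> selected along a trajectory, an extensional function on \<open>{1..n}\<close>.\<close>

primrec played ::
  "('x, 'a, 'b, 'y) vstrategy1 \<Rightarrow> ('x, 'a, 'b, 'y) vstrategy2
   \<Rightarrow> ('x, 'a, 'b, 'y) traj \<Rightarrow> nat \<Rightarrow> ('x, 'a, 'b) presc_hist" where
  "played \<psi>1 \<psi>2 \<omega> 0 = (\<lambda>_. undefined)"
| "played \<psi>1 \<psi>2 \<omega> (Suc n) =
     (let \<gamma> = played \<psi>1 \<psi>2 \<omega> n; c = common (Suc n) \<omega>
      in \<gamma>(Suc n := (\<psi>1 (Suc n) c \<gamma>, \<psi>2 (Suc n) c \<gamma>)))"

definition vgame_cost ::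
  "('x, 'a, 'b, 'y, 's, 'o) game \<Rightarrow> ('x, 'a, 'b, 'y) vstrategy1
   \<Rightarrow> ('x, 'a, 'b, 'y) vstrategy2 \<Rightarrow> real" where
  "vgame_cost G \<psi>1 \<psi>2 =
     measure_pmf.expectation
       (law G (\<lambda>t \<omega>. fst (played \<psi>1 \<psi>2 \<omega> t t) (st \<omega> t)) (\<lambda>t \<omega>. snd (played \<psi>1 \<psi>2 \<omega> t t)) (horizon G))
       (total_cost G)"

definition is_minmax_strategy ::
  "('x, 'a, 'b, 'y, 's, 'o) game \<Rightarrow> ('x, 'a, 'b, 'y) vstrategy1 \<Rightarrow> bool" where
  "is_minmax_strategy G \<psi> \<longleftrightarrow> \<psi> \<in> vstrat1 G \<and>
     (SUP \<psi>2\<in>vstrat2 G. vgame_cost G \<psi> \<psi>2) =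
     (INF \<psi>1\<in>vstrat1 G. SUP \<psi>2\<in>vstrat2 G. vgame_cost G \<psi>1 \<psi>2)"

definition is_maxmin_strategy ::
  "('x, 'a, 'b, 'y, 's, 'o) game \<Rightarrow> ('x, 'a, 'b, 'y) vstrategy2 \<Rightarrow> bool" where
  "is_maxmin_strategy G \<psi> \<longleftrightarrow> \<psi> \<in> vstrat2 G \<and>
     (INF \<psi>1\<in>vstrat1 G. vgame_cost G \<psi>1 \<psi>) =
     (SUP \<psi>2\<in>vstrat2 G. INF \<psi>1\<in>vstrat1 G. vgame_cost G \<psi>1 \<psi>2)"

section \<open>Beliefs\<close>

definition Q ::
  "('x, 'a, 'b, 'y, 's, 'o) game \<Rightarrow> nat \<Rightarrow> 'x pmf \<Rightarrow> ('x \<Rightarrow> 'a pmf) \<Rightarrow> 'y \<times> 'b \<Rightarrow> 'x \<Rightarrow> real" where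
  "Q G t \<pi> \<gamma>1 z x' =
     (\<Sum>x\<in>states G t. \<Sum>a\<in>acts1 G t.
        pmf \<pi> x * pmf (\<gamma>1 x) a * pmf (kernel G t x a (snd z)) (x', fst z))"

definition R ::
  "('x, 'a, 'b, 'y, 's, 'o) game \<Rightarrow> nat \<Rightarrow> 'x pmf \<Rightarrow> ('x \<Rightarrow> 'a pmf) \<Rightarrow> 'y \<times> 'b \<Rightarrow> real" where
  "R G t \<pi> \<gamma>1 z = (\<Sum>x'\<in>states G (t + 1). Q G t \<pi> \<gamma>1 z x')"

definition F ::
  "('x, 'a, 'b, 'y, 's, 'o) game \<Rightarrow> nat \<Rightarrow> 'x pmf \<Rightarrow> ('x \<Rightarrow> 'a pmf) \<Rightarrow> 'y \<times> 'b \<Rightarrow> 'x pmf" where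
  "F G t \<pi> \<gamma>1 z =
     (if R G t \<pi> \<gamma>1 z > 0 then embed_pmf (\<lambda>x'. Q G t \<pi> \<gamma>1 z x' / R G t \<pi> \<gamma>1 z)
      else pmf_of_set (states G (t + 1)))"

lemma set_kernel:
  assumes "valid_game G" "t \<in> {1..horizon G}" "x \<in> states G t" "a \<in> acts1 G t" "b \<in> acts2 G t"
  shows "set_pmf (kernel G t x a b) \<subseteq> states G (t + 1) \<times> obss G (t + 1)"
  using assms unfolding valid_game_def kernel_def
  by (fastforce simp: Let_def)

lemma pmf_F:
  assumes G: "valid_game G" and t: "t \<in> {1..horizon G}" and b: "b \<in> acts2 G t"
    and pos: "R G t \<pi> \<gamma>1 (y, b) > 0"
  shows "pmf (F G t \<pi> \<gamma>1 (y, b)) x' = Q G t \<pi> \<gamma>1 (y, b) x' / R G t \<pi> \<gamma>1 (y, b)"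
proof -
  let ?q = "\<lambda>x'. Q G t \<pi> \<gamma>1 (y, b) x' / R G t \<pi> \<gamma>1 (y, b)"
  let ?A = "states G (t + 1)"
  have fin: "finite ?A"
    using G t by (auto simp: valid_game_def)
  have nonneg: "0 \<le> ?q x" for x
    using pos by (auto simp: Q_def intro!: divide_nonneg_pos sum_nonneg)
  have "pmf (kernel G t x a b) (x', y) = 0" if "x' \<notin> ?A" "x \<in> states G t" "a \<in> acts1 G t" for x a x'
    using set_kernel[OF G t that(2,3) b] that(1) by (auto simp: pmf_eq_0_set_pmf)
  then have zero: "Q G t \<pi> \<gamma>1 (y, b) x' = 0" if "x' \<notin> ?A" for x'
    using that by (simp add: Q_def)
  have "(\<integral>\<^sup>+ x. ennreal (?q x) \<partial>count_space UNIV) = (\<Sum>x\<in>?A. ennreal (?q x))"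
    by (rule nn_integral_count_space') (use fin zero in simp_all)
  also have "\<dots> = ennreal (\<Sum>x\<in>?A. ?q x)"
    using nonneg by (simp add: sum_ennreal)
  also have "(\<Sum>x\<in>?A. ?q x) = 1"
    using pos by (simp add: R_def flip: sum_divide_distrib)
  finally show ?thesis
    using pos nonneg by (simp add: F_def pmf_embed_pmf)
qed

text \<open>
  \<open>b\<close> is a version of \<open>c \<mapsto> P(X\<^sub>1 = \<cdot> | C\<^sub>1 = c)\<close>: its values at null realizations \<open>c\<close> are arbitrary
  elements of the simplex.
\<close>

definition is_init_belief ::
  "('x, 'a, 'b, 'y, 's, 'o) game \<Rightarrow> (('b, 'y) cinfo \<Rightarrow> 'x pmf) \<Rightarrow> bool" where
  "is_init_belief G b \<longleftrightarrow>
     (\<forall>c\<in>cinfos G 1. b c \<in> prob_simplex (states G 1)) \<and>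
     (\<forall>c\<in>common 1 ` set_pmf (start G).
        b c = map_pmf (\<lambda>\<omega>. st \<omega> 1) (cond_pmf (start G) {\<omega>. common 1 \<omega> = c}))"

text \<open>The belief \<open>\<pi>\<^sub>t\<close> computed from \<open>(c, \<gamma>)\<close>; index 0 is a dummy.\<close>

primrec belief ::
  "('x, 'a, 'b, 'y, 's, 'o) game \<Rightarrow> (('b, 'y) cinfo \<Rightarrow> 'x pmf) \<Rightarrow> ('b, 'y) cinfo
   \<Rightarrow> ('x, 'a, 'b) presc_hist \<Rightarrow> nat \<Rightarrow> 'x pmf" where
  "belief G b c \<gamma> 0 = b (trunc 1 c)"
| "belief G b c \<gamma> (Suc t) =
     (if t = 0 then b (trunc 1 c)
      else F G t (belief G b c \<gamma> t) (fst (\<gamma> t)) (fst c (t + 1), snd c t))"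

section \<open>Dynamic programs\<close>

definition ctilde ::
  "('x, 'a, 'b, 'y, 's, 'o) game \<Rightarrow> nat \<Rightarrow> 'x pmf \<Rightarrow> ('x \<Rightarrow> 'a pmf) \<Rightarrow> 'b pmf \<Rightarrow> real" where
  "ctilde G t \<pi> \<gamma>1 \<gamma>2 =
     (\<Sum>x\<in>states G t. \<Sum>a\<in>acts1 G t. \<Sum>b\<in>acts2 G t.
        cost G t x a b * pmf \<pi> x * pmf (\<gamma>1 x) a * pmf \<gamma>2 b)"

text \<open>The stage function with continuation \<open>V\<close>, which is \<open>V\<^sub>t\<^sub>+\<^sub>1\<close> of either program.\<close>

definition stage ::
  "('x, 'a, 'b, 'y, 's, 'o) game \<Rightarrow> nat \<Rightarrow> ('x pmf \<Rightarrow> real)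
   \<Rightarrow> 'x pmf \<Rightarrow> ('x \<Rightarrow> 'a pmf) \<Rightarrow> 'b pmf \<Rightarrow> real" where
  "stage G t V \<pi> \<gamma>1 \<gamma>2 =
     ctilde G t \<pi> \<gamma>1 \<gamma>2 +
     (\<Sum>y\<in>obss G (t + 1). \<Sum>b\<in>acts2 G t.
        pmf \<gamma>2 b * R G t \<pi> \<gamma>1 (y, b) * V (F G t \<pi> \<gamma>1 (y, b)))"

function Vu :: "('x, 'a, 'b, 'y, 's, 'o) game \<Rightarrow> nat \<Rightarrow> 'x pmf \<Rightarrow> real" where
  "Vu G t = (if horizon G < t then (\<lambda>_. 0)
     else (\<lambda>\<pi>. INF \<gamma>1\<in>presc1 G t. SUP \<gamma>2\<in>presc2 G t. stage G t (Vu G (t + 1)) \<pi> \<gamma>1 \<gamma>2))"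
  by pat_completeness auto
termination by (relation "Wellfounded.measure (\<lambda>(G, t). Suc (horizon G) - t)") auto

function Vl :: "('x, 'a, 'b, 'y, 's, 'o) game \<Rightarrow> nat \<Rightarrow> 'x pmf \<Rightarrow> real" where
  "Vl G t = (if horizon G < t then (\<lambda>_. 0)
     else (\<lambda>\<pi>. SUP \<gamma>2\<in>presc2 G t. INF \<gamma>1\<in>presc1 G t. stage G t (Vl G (t + 1)) \<pi> \<gamma>1 \<gamma>2))"
  by pat_completeness auto
termination by (relation "Wellfounded.measure (\<lambda>(G, t). Suc (horizon G) - t)") auto

declare Vu.simps [simp del] Vl.simps [simp del]

definition wu ::
  "('x, 'a, 'b, 'y, 's, 'o) game \<Rightarrow> nat \<Rightarrow> 'x pmf \<Rightarrow> ('x \<Rightarrow> 'a pmf) \<Rightarrow> 'b pmf \<Rightarrow> real" where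
  "wu G t = stage G t (Vu G (t + 1))"

definition wl ::
  "('x, 'a, 'b, 'y, 's, 'o) game \<Rightarrow> nat \<Rightarrow> 'x pmf \<Rightarrow> ('x \<Rightarrow> 'a pmf) \<Rightarrow> 'b pmf \<Rightarrow> real" where
  "wl G t = stage G t (Vl G (t + 1))"

text \<open>Measurability includes that the selectors map into \<open>presc1 G t\<close> and \<open>presc2 G t\<close>.\<close>

definition is_selector1 ::
  "('x, 'a, 'b, 'y, 's, 'o) game \<Rightarrow> (nat \<Rightarrow> 'x pmf \<Rightarrow> 'x \<Rightarrow> 'a pmf) \<Rightarrow> bool" where
  "is_selector1 G \<Xi> \<longleftrightarrow> (\<forall>t\<in>{1..horizon G}.
     \<Xi> t \<in> simplex_borel (states G t) \<rightarrow>\<^sub>M (\<Pi>\<^sub>M x\<in>states G t. simplex_borel (acts1 G t)) \<and>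
     (\<forall>\<pi>\<in>prob_simplex (states G t).
        (\<exists>\<gamma>2\<in>presc2 G t. wu G t \<pi> (\<Xi> t \<pi>) \<gamma>2 = Vu G t \<pi>) \<and>
        (\<forall>\<gamma>2\<in>presc2 G t. wu G t \<pi> (\<Xi> t \<pi>) \<gamma>2 \<le> Vu G t \<pi>)))"

definition is_selector2 ::
  "('x, 'a, 'b, 'y, 's, 'o) game \<Rightarrow> (nat \<Rightarrow> 'x pmf \<Rightarrow> 'b pmf) \<Rightarrow> bool" where
  "is_selector2 G \<Xi> \<longleftrightarrow> (\<forall>t\<in>{1..horizon G}.
     \<Xi> t \<in> simplex_borel (states G t) \<rightarrow>\<^sub>M simplex_borel (acts2 G t) \<and>
     (\<forall>\<pi>\<in>prob_simplex (states G t).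
        (\<exists>\<gamma>1\<in>presc1 G t. wl G t \<pi> \<gamma>1 (\<Xi> t \<pi>) = Vl G t \<pi>) \<and>
        (\<forall>\<gamma>1\<in>presc1 G t. Vl G t \<pi> \<le> wl G t \<pi> \<gamma>1 (\<Xi> t \<pi>))))"

definition chi1 ::
  "('x, 'a, 'b, 'y, 's, 'o) game \<Rightarrow> (('b, 'y) cinfo \<Rightarrow> 'x pmf)
   \<Rightarrow> (nat \<Rightarrow> 'x pmf \<Rightarrow> 'x \<Rightarrow> 'a pmf) \<Rightarrow> ('x, 'a, 'b, 'y) vstrategy1" where
  "chi1 G b \<Xi> t c \<gamma> = \<Xi> t (belief G b c \<gamma> t)"

definition chi2 ::
  "('x, 'a, 'b, 'y, 's, 'o) game \<Rightarrow> (('b, 'y) cinfo \<Rightarrow> 'x pmf)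
   \<Rightarrow> (nat \<Rightarrow> 'x pmf \<Rightarrow> 'b pmf) \<Rightarrow> ('x, 'a, 'b, 'y) vstrategy2" where
  "chi2 G b \<Xi> t c \<gamma> = \<Xi> t (belief G b c \<gamma> t)"

end

theory Submission
  imports Defs
begin

text \<open>
  Upper bound: a player 1 who follows (nearly) optimal prescriptions of the min-max program knows the
  resulting belief, since it depends only on the common information, and loses at most
  \<open>E V\<^sub>1\<^sup>u\<close> plus a small error.

  Lower bound: in the original game player 2 does not see the prescriptions of player 1 and cannot
  compute the belief.  Instead, player 2 aims at vectors in \<open>\<real>\<^sup>X\<close>: a vector \<open>\<alpha>\<close> is guaranteed at
  time \<open>t\<close> if player 2 can force a cost-to-go of at least \<open>\<alpha> x\<close> from every state \<open>x\<close> at once,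
  using the common information only.  The guaranteed vectors form a convex set, and a finite minimax
  theorem in each stage shows that their supremum \<open>sup\<^sub>\<alpha> \<langle>\<pi>, \<alpha>\<rangle>\<close> dominates \<open>V\<^sub>t\<^sup>u \<pi>\<close>; it is trivially
  at most \<open>V\<^sub>t\<^sup>l \<pi>\<close>.  Hence \<open>V\<^sup>u = V\<^sup>l\<close>, and a guaranteed vector yields a strategy of player 2 that
  is nearly optimal against all strategies of player 1 in either game.
\<close>

text \<open>The obstacle is that \<open>stage\<close> is in general not linear in the prescription
  of player 1: the normalization in \<open>F\<close> makes the next belief depend on it, so no
  minimax theorem applies to the dynamic program directly. Fixing continuation vectors \<beta> and
  using their average over the next belief removes the obstacle, because the factor \<open>R\<close>
  cancels the normalization and the payoff becomes linear in \<gamma>1. The price is that player 2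
  must choose \<beta> together with \<gamma>2; \<open>backup_mix\<close> shows that such joint
  choices are still closed under mixing. On the other side there are only finitely many maps from
  states to actions, so a minimax theorem with one finite side suffices. Neither compactness, nor
  continuity of the value functions, nor attainment of a supremum is invoked, which is why near
  optimality up to an arbitrary error carries the argument. Exact selectors enter only for the
  min-max and max-min strategies of the virtual game.\<close>

section \<open>A minimax theorem\<close>

text \<open>Separation in the plane: the points \<open>(f s, g s)\<close> form a convex set that
  misses the open positive quadrant. A point with \<open>f s > 0\<close> bounds \<open>k\<close>
  from above by \<open>h s\<close>, a point with \<open>g s > 0\<close> and
  \<open>f s \<le> 0\<close> bounds it from below by \<open>g s / (g s - f s)\<close>. The infimum
  of the upper bounds works once no lower bound exceeds an upper one.\<close>

lemma convex_combination_of_two_functionals: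
  fixes f g :: "'s \<Rightarrow> real"
  assumes convex: "\<And>s s' k. s \<in> S \<Longrightarrow> s' \<in> S \<Longrightarrow> 0 \<le> k \<Longrightarrow> k \<le> 1 \<Longrightarrow>
      \<exists>r\<in>S. f r = k * f s + (1 - k) * f s' \<and> g r = k * g s + (1 - k) * g s'"
    and min: "\<And>s. s \<in> S \<Longrightarrow> f s \<le> 0 \<or> g s \<le> 0"
  shows "\<exists>k. 0 \<le> k \<and> k \<le> 1 \<and> (\<forall>s\<in>S. k * f s + (1 - k) * g s \<le> 0)"
proof (cases "\<exists>s\<in>S. f s > 0")
  case False
  then show ?thesis by (intro exI[of _ 1]) (auto simp: not_less)
next
  case True
  define P where "P = {s\<in>S. f s > 0}"
  define h where "h s = - g s / (f s - g s)" for s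
  have P: "P \<noteq> {}" using True by (auto simp: P_def)
  have g_P: "g s \<le> 0" if "s \<in> P" for s
    using that min[of s] by (auto simp: P_def)
  have h_bounds: "0 \<le> h s" "h s \<le> 1" if "s \<in> P" for s
    using that g_P[OF that] by (auto simp: h_def P_def divide_simps)
  have bdd: "bdd_below (h ` P)"
    using h_bounds by (intro bdd_belowI[of _ 0]) auto
  define k where "k = Inf (h ` P)"
  have k: "0 \<le> k" "k \<le> 1"
  proof -
    show "0 \<le> k" unfolding k_def using P h_bounds by (intro cINF_greatest) auto
    obtain s where "s \<in> P" using P by auto
    then show "k \<le> 1" unfolding k_def using h_bounds cINF_lower[OF bdd] by force
  qed
  have "k * f s + (1 - k) * g s \<le> 0" if s: "s \<in> S" for s
  proof -
    consider "f s > 0" | "g s > 0" "f s \<le> 0" | "f s \<le> 0" "g s \<le> 0"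
      using min[OF s] by linarith
    then show ?thesis
    proof cases
      case 1
      then have sP: "s \<in> P" using s by (simp add: P_def)
      have "k \<le> h s" unfolding k_def by (rule cINF_lower[OF bdd sP])
      moreover have "f s - g s > 0" using 1 g_P[OF sP] by linarith
      moreover from this have "h s * (f s - g s) = - g s" by (simp add: h_def)
      ultimately have "k * (f s - g s) \<le> - g s" by (metis mult_right_mono less_imp_le)
      then show ?thesis by (simp add: algebra_simps)
    next
      case 2
      have "g s / (g s - f s) \<le> h r" if r: "r \<in> P" for r
      proof (rule ccontr)
        assume less: "\<not> ?thesis"
        have fr: "f r > 0" "g r \<le> 0" "r \<in> S" using r g_P[OF r] by (auto simp: P_def)
        \<comment> \<open>Weights for which the point between \<open>r\<close> and \<open>s\<close>
          lies on the diagonal: both coordinates equal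
          \<open>(f r * g s - f s * g r) / (p + q)\<close>, which is positive if the two bounds on
          \<open>k\<close> are in the wrong order.\<close>
        define p q where "p = g s - f s" and "q = f r - g r"
        have pq: "p > 0" "q > 0" using 2 fr by (auto simp: p_def q_def)
        have "- g r / q < g s / p" using less by (simp add: h_def p_def q_def)
        then have "- g r * p < g s * q" using pq by (simp add: divide_simps mult.commute)
        then have cross: "f r * g s > f s * g r" by (simp add: p_def q_def algebra_simps)
        obtain m where m: "m \<in> S"
          "f m = p / (p + q) * f r + (1 - p / (p + q)) * f s"
          "g m = p / (p + q) * g r + (1 - p / (p + q)) * g s"
          using convex[OF fr(3) s, of "p / (p + q)"] pq by auto
        have q': "1 - p / (p + q) = q / (p + q)" using pq by (simp add: field_simps)
        have "f m = (p * f r + q * f s) / (p + q)" "g m = (p * g r + q * g s) / (p + q)"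
          unfolding m q' using pq by (simp_all add: add_divide_distrib)
        moreover have "p * f r + q * f s > 0" "p * g r + q * g s > 0"
          using cross by (simp_all add: p_def q_def algebra_simps)
        ultimately have "f m > 0" "g m > 0" using pq by simp_all
        with min[OF m(1)] show False by linarith
      qed
      then have "g s / (g s - f s) \<le> k"
        unfolding k_def using P by (intro cINF_greatest) auto
      then have "g s \<le> k * (g s - f s)" using 2 by (simp add: pos_divide_le_eq)
      then show ?thesis by (simp add: algebra_simps)
    next
      case 3
      then show ?thesis
        using k by (simp add: add_nonpos_nonpos mult_nonneg_nonpos)
    qed
  qed
  with k show ?thesis by blast
qed

text \<open>Induction on \<open>D\<close>. For the vectors with \<open>u e > 0\<close> another
  coordinate must be nonpositive, so the induction hypothesis yields weights \<open>p\<close> on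
  \<open>D\<close> for them. Coordinate \<open>e\<close> and the \<open>p\<close>-average are then
  never both positive on \<open>S\<close>, and the two-functional lemma merges them. Convexity is
  asked only up to agreement on \<open>D\<close>, since the vectors are functions on a whole
  type.\<close>

lemma finite_minimax_weights:
  fixes S :: "('d \<Rightarrow> real) set"
  assumes "finite D" "D \<noteq> {}"
    and "\<And>u u' k. u \<in> S \<Longrightarrow> u' \<in> S \<Longrightarrow> 0 \<le> k \<Longrightarrow> k \<le> 1 \<Longrightarrow>
      \<exists>r\<in>S. \<forall>d\<in>D. r d = k * u d + (1 - k) * u' d"
    and "\<And>u. u \<in> S \<Longrightarrow> \<exists>d\<in>D. u d \<le> 0"
  shows "\<exists>p. (\<forall>d\<in>D. 0 \<le> p d) \<and> sum p D = 1 \<and> (\<forall>u\<in>S. (\<Sum>d\<in>D. p d * u d) \<le> 0)"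
  using assms
proof (induction D arbitrary: S rule: finite_ne_induct)
  case (singleton e)
  then show ?case by (intro exI[of _ "\<lambda>_. 1"]) auto
next
  case (insert e D)
  define S' where "S' = {u\<in>S. u e > 0}"
  have "\<exists>p. (\<forall>d\<in>D. 0 \<le> p d) \<and> sum p D = 1 \<and> (\<forall>u\<in>S'. (\<Sum>d\<in>D. p d * u d) \<le> 0)"
  proof (rule insert.IH)
    fix u u' and k :: real
    assume u: "u \<in> S'" "u' \<in> S'" and k: "0 \<le> k" "k \<le> 1"
    then obtain r where r: "r \<in> S" "\<forall>d\<in>insert e D. r d = k * u d + (1 - k) * u' d"
      using insert.prems(1)[of u u' k] by (auto simp: S'_def)
    have "r e = k * u e + (1 - k) * u' e" using r by simp
    moreover have "k * u e + (1 - k) * u' e > 0"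
    proof (cases "k = 0")
      case False
      then show ?thesis using u k
        by (intro add_pos_nonneg mult_pos_pos mult_nonneg_nonneg) (auto simp: S'_def)
    qed (use u in \<open>auto simp: S'_def\<close>)
    ultimately show "\<exists>r\<in>S'. \<forall>d\<in>D. r d = k * u d + (1 - k) * u' d"
      using r by (intro bexI[of _ r]) (auto simp: S'_def)
  next
    fix u assume "u \<in> S'"
    then show "\<exists>d\<in>D. u d \<le> 0" using insert.prems(2)[of u] by (auto simp: S'_def)
  qed
  then obtain p where p: "\<And>d. d \<in> D \<Longrightarrow> 0 \<le> p d" "sum p D = 1"
    "\<And>u. u \<in> S' \<Longrightarrow> (\<Sum>d\<in>D. p d * u d) \<le> 0" by blast
  define m where "m u = (\<Sum>d\<in>D. p d * u d)" for u
  have "\<exists>k. 0 \<le> k \<and> k \<le> 1 \<and> (\<forall>u\<in>S. k * u e + (1 - k) * m u \<le> 0)"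
  proof (rule convex_combination_of_two_functionals)
    fix u u' and k :: real
    assume u: "u \<in> S" "u' \<in> S" and k: "0 \<le> k" "k \<le> 1"
    then obtain r where r: "r \<in> S" "\<forall>d\<in>insert e D. r d = k * u d + (1 - k) * u' d"
      using insert.prems(1)[of u u' k] by auto
    have "m r = (\<Sum>d\<in>D. p d * (k * u d + (1 - k) * u' d))"
      using r(2) by (simp add: m_def)
    also have "\<dots> = k * m u + (1 - k) * m u'"
      unfolding m_def sum_distrib_left sum.distrib[symmetric]
      by (intro sum.cong refl) (simp add: algebra_simps)
    finally have "m r = k * m u + (1 - k) * m u'" .
    with r show "\<exists>r\<in>S. r e = k * u e + (1 - k) * u' e \<and> m r = k * m u + (1 - k) * m u'"
      by auto
  next
    fix u assume "u \<in> S"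
    then show "u e \<le> 0 \<or> m u \<le> 0" using p(3)[of u] by (force simp: S'_def m_def)
  qed
  then obtain k where k: "0 \<le> k" "k \<le> 1" "\<And>u. u \<in> S \<Longrightarrow> k * u e + (1 - k) * m u \<le> 0"
    by blast
  define p' where "p' d = (if d = e then k else (1 - k) * p d)" for d
  have split: "(\<Sum>d\<in>insert e D. p' d * u d) = k * u e + (1 - k) * (\<Sum>d\<in>D. p d * u d)" for u
  proof -
    have "(\<Sum>d\<in>D. p' d * u d) = (\<Sum>d\<in>D. (1 - k) * (p d * u d))"
      using \<open>e \<notin> D\<close> by (intro sum.cong refl) (auto simp: p'_def)
    then show ?thesis using \<open>finite D\<close> \<open>e \<notin> D\<close> by (simp add: p'_def sum_distrib_left)
  qed
  have "sum p' (insert e D) = 1" using split[of "\<lambda>_. 1"] p(2) by simp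
  moreover have "\<forall>u\<in>S. (\<Sum>d\<in>insert e D. p' d * u d) \<le> 0"
    using k(3) by (simp add: split m_def)
  moreover have "\<forall>d\<in>insert e D. 0 \<le> p' d" using p(1) k by (auto simp: p'_def)
  ultimately show ?case by blast
qed

lemma expectation_finite:
  fixes f :: "'q \<Rightarrow> real"
  assumes "finite A" "set_pmf p \<subseteq> A"
  shows "measure_pmf.expectation p f = (\<Sum>x\<in>A. pmf p x * f x)"
  using assms by (subst integral_measure_pmf_real[of A]) (auto simp: mult.commute)

lemma weights_pmf:
  fixes p :: "'d \<Rightarrow> real"
  assumes "finite D" "\<And>d. d \<in> D \<Longrightarrow> 0 \<le> p d" "sum p D = 1"
  obtains P where "set_pmf P \<subseteq> D" "\<And>d. d \<in> D \<Longrightarrow> pmf P d = p d"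
proof -
  let ?p = "\<lambda>d. if d \<in> D then p d else 0"
  have "(\<integral>\<^sup>+ x. ennreal (?p x) \<partial>count_space UNIV) = (\<Sum>x\<in>D. ennreal (?p x))"
    by (rule nn_integral_count_space') (use assms in auto)
  also have "\<dots> = ennreal (\<Sum>x\<in>D. ?p x)"
    using assms by (intro sum_ennreal) auto
  also have "(\<Sum>x\<in>D. ?p x) = 1" using assms by simp
  finally have *: "pmf (embed_pmf ?p) d = ?p d" for d
    using assms by (subst pmf_embed_pmf) auto
  show thesis
    by (rule that[of "embed_pmf ?p"]) (auto simp: * set_pmf_eq split: if_splits)
qed

text \<open>Subtracting \<open>v\<close> from every vector reduces to threshold 0. Only the
  minimizing side is finite; the maximizing side \<open>S\<close> is an arbitrary convex family,
  without any closedness.\<close>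

lemma finite_minimax:
  fixes S :: "('d \<Rightarrow> real) set"
  assumes D: "finite D" "D \<noteq> {}"
    and convex: "\<And>u u' k. u \<in> S \<Longrightarrow> u' \<in> S \<Longrightarrow> 0 \<le> k \<Longrightarrow> k \<le> 1 \<Longrightarrow>
      \<exists>r\<in>S. \<forall>d\<in>D. r d = k * u d + (1 - k) * u' d"
    and min: "\<And>u. u \<in> S \<Longrightarrow> \<exists>d\<in>D. u d \<le> v"
  obtains P where "set_pmf P \<subseteq> D" "\<And>u. u \<in> S \<Longrightarrow> measure_pmf.expectation P u \<le> v"
proof -
  define S' where "S' = (\<lambda>u d. u d - v) ` S"
  have "\<exists>p. (\<forall>d\<in>D. 0 \<le> p d) \<and> sum p D = 1 \<and> (\<forall>u\<in>S'. (\<Sum>d\<in>D. p d * u d) \<le> 0)"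
  proof (rule finite_minimax_weights[OF D])
    fix u u' and k :: real
    assume "u \<in> S'" "u' \<in> S'" and k: "0 \<le> k" "k \<le> 1"
    then obtain w w' where w: "w \<in> S" "w' \<in> S" "u = (\<lambda>d. w d - v)" "u' = (\<lambda>d. w' d - v)"
      by (auto simp: S'_def)
    obtain r where r: "r \<in> S" "\<forall>d\<in>D. r d = k * w d + (1 - k) * w' d"
      using convex[OF w(1,2) k] by blast
    show "\<exists>r\<in>S'. \<forall>d\<in>D. r d = k * u d + (1 - k) * u' d"
      using r by (intro bexI[of _ "\<lambda>d. r d - v"]) (auto simp: S'_def w algebra_simps)
  next
    fix u assume "u \<in> S'"
    then show "\<exists>d\<in>D. u d \<le> 0" using min by (force simp: S'_def)
  qed
  then obtain p where p: "\<And>d. d \<in> D \<Longrightarrow> 0 \<le> p d" "sum p D = 1"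
    "\<And>u. u \<in> S' \<Longrightarrow> (\<Sum>d\<in>D. p d * u d) \<le> 0" by blast
  obtain P where P: "set_pmf P \<subseteq> D" "\<And>d. d \<in> D \<Longrightarrow> pmf P d = p d"
    using weights_pmf[OF D(1) p(1,2)] by blast
  have "measure_pmf.expectation P u \<le> v" if "u \<in> S" for u
  proof -
    have "measure_pmf.expectation P u = (\<Sum>d\<in>D. p d * u d)"
      using expectation_finite[OF D(1) P(1)] P(2) by simp
    also have "\<dots> = (\<Sum>d\<in>D. p d * (u d - v)) + v * sum p D"
      by (simp add: right_diff_distrib sum_subtractf sum_distrib_left mult.commute)
    also have "\<dots> \<le> v" using p(2) p(3)[of "\<lambda>d. u d - v"] that by (simp add: S'_def)
    finally show ?thesis .
  qed
  with P(1) show thesis by (rule that)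
qed

text \<open>\<open>INF\<close> and \<open>SUP\<close> of reals are meaningful only for nonempty
  bounded families: \<open>M\<close> provides the bounds, and the strategies for error 1 provide
  nonemptiness.\<close>

lemma value_if_eps_optimal:
  fixes J :: "'p \<Rightarrow> 'q \<Rightarrow> real"
  assumes bound: "\<And>p q. p \<in> S1 \<Longrightarrow> q \<in> S2 \<Longrightarrow> \<bar>J p q\<bar> \<le> M"
    and upper: "\<And>e. e > 0 \<Longrightarrow> \<exists>p\<in>S1. \<forall>q\<in>S2. J p q \<le> v + e"
    and lower: "\<And>e. e > 0 \<Longrightarrow> \<exists>q\<in>S2. \<forall>p\<in>S1. v - e \<le> J p q"
  shows "(INF p\<in>S1. SUP q\<in>S2. J p q) = v" "(SUP q\<in>S2. INF p\<in>S1. J p q) = v"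
proof -
  have ne: "S1 \<noteq> {}" "S2 \<noteq> {}" using upper[of 1] lower[of 1] by auto
  have bdd: "bdd_above (J p ` S2)" if "p \<in> S1" for p
    using bound[OF that] by (intro bdd_aboveI[of _ M]) (auto simp: abs_le_iff)
  have bdd': "bdd_below ((\<lambda>p. J p q) ` S1)" if "q \<in> S2" for q
    using bound[OF _ that] by (intro bdd_belowI[of _ "- M"]) (force simp: abs_le_iff)
  obtain p0 q0 where p0: "p0 \<in> S1" and q0: "q0 \<in> S2" using ne by auto
  have sup_ge: "v \<le> (SUP q\<in>S2. J p q)" if p: "p \<in> S1" for p
  proof (rule field_le_epsilon)
    fix e :: real assume "e > 0"
    then obtain q where "q \<in> S2" "v - e \<le> J p q" using lower p by blast
    then show "v \<le> (SUP q\<in>S2. J p q) + e" using cSUP_upper[OF _ bdd[OF p], of q] by simp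
  qed
  have inf_le: "(INF p\<in>S1. J p q) \<le> v" if q: "q \<in> S2" for q
  proof (rule field_le_epsilon)
    fix e :: real assume "e > 0"
    then obtain p where "p \<in> S1" "J p q \<le> v + e" using upper q by blast
    then show "(INF p\<in>S1. J p q) \<le> v + e" using cINF_lower[OF bdd'[OF q], of p] by simp
  qed
  show "(INF p\<in>S1. SUP q\<in>S2. J p q) = v"
  proof (rule antisym)
    show "(INF p\<in>S1. SUP q\<in>S2. J p q) \<le> v"
    proof (rule field_le_epsilon)
      fix e :: real assume "e > 0"
      then obtain p where p: "p \<in> S1" "\<forall>q\<in>S2. J p q \<le> v + e" using upper by blast
      have "(INF p\<in>S1. SUP q\<in>S2. J p q) \<le> (SUP q\<in>S2. J p q)"
        using sup_ge p by (intro cINF_lower bdd_belowI[of _ v]) auto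
      also have "\<dots> \<le> v + e" using p ne by (intro cSUP_least) auto
      finally show "(INF p\<in>S1. SUP q\<in>S2. J p q) \<le> v + e" .
    qed
    show "v \<le> (INF p\<in>S1. SUP q\<in>S2. J p q)" using sup_ge ne by (intro cINF_greatest) auto
  qed
  show "(SUP q\<in>S2. INF p\<in>S1. J p q) = v"
  proof (rule antisym)
    show "v \<le> (SUP q\<in>S2. INF p\<in>S1. J p q)"
    proof (rule field_le_epsilon)
      fix e :: real assume "e > 0"
      then obtain q where q: "q \<in> S2" "\<forall>p\<in>S1. v - e \<le> J p q" using lower by blast
      have "v - e \<le> (INF p\<in>S1. J p q)" using q ne by (intro cINF_greatest) auto
      also have "\<dots> \<le> (SUP q\<in>S2. INF p\<in>S1. J p q)"
        using inf_le q by (intro cSUP_upper bdd_aboveI[of _ v]) auto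
      finally show "v \<le> (SUP q\<in>S2. INF p\<in>S1. J p q) + e" by simp
    qed
    show "(SUP q\<in>S2. INF p\<in>S1. J p q) \<le> v" using inf_le ne by (intro cSUP_least) auto
  qed
qed

section \<open>Payoff vectors that player 2 can guarantee\<close>

text \<open>The backup of \<alpha>-vectors known from partially observed control:
  \<open>\<beta> y b\<close> is the payoff vector with which player 2 continues after playing
  \<open>b\<close> and observing \<open>y\<close>. Neither a belief nor a prescription of player 1
  occurs in it.\<close>

definition backup ::
  "('x, 'a, 'b, 'y, 's, 'o) game \<Rightarrow> nat \<Rightarrow> 'b pmf \<Rightarrow> ('y \<Rightarrow> 'b \<Rightarrow> 'x \<Rightarrow> real) \<Rightarrow> 'x \<Rightarrow> 'a \<Rightarrow> real" where
  "backup G t \<gamma>2 \<beta> x a = (\<Sum>b\<in>acts2 G t. pmf \<gamma>2 b * (cost G t x a b +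
     (\<Sum>x'\<in>states G (t + 1). \<Sum>y\<in>obss G (t + 1). pmf (kernel G t x a b) (x', y) * \<beta> y b x')))"

text \<open>
  The vectors \<open>\<alpha>\<close> such that player 2, without observing the prescriptions of player 1, can force
  a cost-to-go of at least \<open>\<alpha> x\<close> from every state \<open>x\<close> at time \<open>t\<close> simultaneously.
\<close>

function guaranteed :: "('x, 'a, 'b, 'y, 's, 'o) game \<Rightarrow> nat \<Rightarrow> ('x \<Rightarrow> real) set" where
  "guaranteed G t = (if horizon G < t then {\<alpha>. \<forall>x\<in>states G t. \<alpha> x \<le> 0}
     else {\<alpha>. \<exists>\<gamma>2\<in>presc2 G t. \<exists>\<beta>.
       (\<forall>y\<in>obss G (t + 1). \<forall>b\<in>acts2 G t. \<beta> y b \<in> guaranteed G (t + 1)) \<and>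
       (\<forall>x\<in>states G t. \<forall>a\<in>acts1 G t. \<alpha> x \<le> backup G t \<gamma>2 \<beta> x a)})"
  by pat_completeness auto
termination by (relation "Wellfounded.measure (\<lambda>(G, t). Suc (horizon G) - t)") auto

declare guaranteed.simps [simp del]

lemma prob_simplex_mix:
  assumes "p \<in> prob_simplex A" "q \<in> prob_simplex A" "0 \<le> k" "k \<le> 1"
  obtains r where "r \<in> prob_simplex A" "\<And>x. pmf r x = k * pmf p x + (1 - k) * pmf q x"
proof
  let ?r = "bind_pmf (bernoulli_pmf k) (\<lambda>i. if i then p else q)"
  show "?r \<in> prob_simplex A" using assms by (auto simp: prob_simplex_def split: if_splits)
  show "pmf ?r x = k * pmf p x + (1 - k) * pmf q x" for x
    using assms by (simp add: pmf_bind mult.commute)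
qed

text \<open>Player 2 tosses a coin with bias \<open>k\<close> to choose between the plans
  \<open>(\<gamma>, \<beta>)\<close> and \<open>(\<gamma>', \<beta>')\<close>. The action
  \<open>b\<close> then has law \<delta>, and given \<open>b\<close> the first plan has posterior
  weight \<open>m b\<close>. Continuing with the two vectors mixed by \<open>m b\<close> gives the
  averaged payoff.\<close>

lemma backup_mix:
  assumes convex: "\<forall>\<alpha>\<in>A. \<forall>\<alpha>'\<in>A. \<forall>k\<in>{0..1::real}. (\<lambda>x. k * \<alpha> x + (1 - k) * \<alpha>' x) \<in> A"
    and \<gamma>: "\<gamma> \<in> presc2 G t" "\<gamma>' \<in> presc2 G t"
    and \<beta>: "\<forall>y\<in>obss G (t + 1). \<forall>b\<in>acts2 G t. \<beta> y b \<in> A"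
      "\<forall>y\<in>obss G (t + 1). \<forall>b\<in>acts2 G t. \<beta>' y b \<in> A"
    and k: "0 \<le> k" "k \<le> 1"
  obtains \<delta> \<eta> where "\<delta> \<in> presc2 G t" "\<forall>y\<in>obss G (t + 1). \<forall>b\<in>acts2 G t. \<eta> y b \<in> A"
    "\<And>x a. backup G t \<delta> \<eta> x a = k * backup G t \<gamma> \<beta> x a + (1 - k) * backup G t \<gamma>' \<beta>' x a"
proof -
  obtain \<delta> where \<delta>: "\<delta> \<in> presc2 G t" "\<And>b. pmf \<delta> b = k * pmf \<gamma> b + (1 - k) * pmf \<gamma>' b"
    using prob_simplex_mix \<gamma> k unfolding presc2_def by metis
  \<comment> \<open>If \<open>pmf \<delta> b = 0\<close>, division gives \<open>m b = 0\<close>;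
    this is harmless because then both weighted probabilities of \<open>b\<close> vanish.\<close>
  define m where "m b = k * pmf \<gamma> b / pmf \<delta> b" for b
  define \<eta> where "\<eta> y b x = m b * \<beta> y b x + (1 - m b) * \<beta>' y b x" for y b x
  have nn: "0 \<le> k * pmf \<gamma> b" "0 \<le> (1 - k) * pmf \<gamma>' b" for b using k by auto
  have m: "0 \<le> m b" "m b \<le> 1" "pmf \<delta> b * m b = k * pmf \<gamma> b" for b
  proof -
    show "0 \<le> m b" "m b \<le> 1"
      using nn[of b] \<delta>(2)[of b] by (auto simp: m_def divide_simps)
    show "pmf \<delta> b * m b = k * pmf \<gamma> b"
    proof (cases "pmf \<delta> b = 0")
      case True
      then have "k * pmf \<gamma> b = 0" using nn[of b] \<delta>(2)[of b] by linarith
      then show ?thesis using True by simp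
    qed (simp add: m_def)
  qed
  have m': "pmf \<delta> b * (1 - m b) = (1 - k) * pmf \<gamma>' b" for b
    using m(3)[of b] \<delta>(2)[of b] by (simp add: right_diff_distrib)
  show thesis
  proof (rule that[OF \<delta>(1)])
    show "\<forall>y\<in>obss G (t + 1). \<forall>b\<in>acts2 G t. \<eta> y b \<in> A"
    proof (intro ballI)
      fix y b assume "y \<in> obss G (t + 1)" "b \<in> acts2 G t"
      then have "\<beta> y b \<in> A" "\<beta>' y b \<in> A" "m b \<in> {0..1}" using \<beta> m by auto
      then show "\<eta> y b \<in> A" unfolding \<eta>_def using convex by blast
    qed
    fix x a
    let ?K = "\<lambda>b \<beta>. \<Sum>x'\<in>states G (t + 1). \<Sum>y\<in>obss G (t + 1). pmf (kernel G t x a b) (x', y) * \<beta> y b x'"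
    have "pmf \<delta> b * (cost G t x a b + ?K b \<eta>) =
        k * (pmf \<gamma> b * (cost G t x a b + ?K b \<beta>)) + (1 - k) * (pmf \<gamma>' b * (cost G t x a b + ?K b \<beta>'))"
      for b
    proof -
      have "?K b \<eta> = m b * ?K b \<beta> + (1 - m b) * ?K b \<beta>'"
        unfolding \<eta>_def sum_distrib_left sum.distrib[symmetric]
        by (intro sum.cong refl) (simp add: algebra_simps)
      moreover have "d * (c + (l * p + (1 - l) * q)) = (d * l) * (c + p) + (d * (1 - l)) * (c + q)"
        for d c l p q :: real
        by (simp add: algebra_simps)
      ultimately have "pmf \<delta> b * (cost G t x a b + ?K b \<eta>) =
        (pmf \<delta> b * m b) * (cost G t x a b + ?K b \<beta>) + (pmf \<delta> b * (1 - m b)) * (cost G t x a b + ?K b \<beta>')"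
        by metis
      then show ?thesis unfolding m m' by (simp add: mult.assoc)
    qed
    then show "backup G t \<delta> \<eta> x a = k * backup G t \<gamma> \<beta> x a + (1 - k) * backup G t \<gamma>' \<beta>' x a"
      unfolding backup_def by (simp add: sum.distrib sum_distrib_left)
  qed
qed

text \<open>Backward induction on the remaining stages: mixing two plans at time \<open>t\<close>
  mixes their continuation vectors, which convexity at \<open>t + 1\<close> permits.\<close>

lemma convex_guaranteed:
  assumes "\<alpha> \<in> guaranteed G t" "\<alpha>' \<in> guaranteed G t" "0 \<le> k" "k \<le> 1"
  shows "(\<lambda>x. k * \<alpha> x + (1 - k) * \<alpha>' x) \<in> guaranteed G t"
  using assms
proof (induction "Suc (horizon G) - t" arbitrary: t \<alpha> \<alpha>' k rule: less_induct)
  case less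
  show ?case
  proof (cases "horizon G < t")
    case True
    then show ?thesis using less.prems
      by (auto simp: guaranteed.simps[of G t] intro!: add_nonpos_nonpos mult_nonneg_nonpos)
  next
    case False
    obtain \<gamma> \<beta> where \<gamma>: "\<gamma> \<in> presc2 G t" "\<forall>y\<in>obss G (t + 1). \<forall>b\<in>acts2 G t. \<beta> y b \<in> guaranteed G (t + 1)"
      "\<forall>x\<in>states G t. \<forall>a\<in>acts1 G t. \<alpha> x \<le> backup G t \<gamma> \<beta> x a"
      using less.prems(1) False by (auto simp: guaranteed.simps[of G t])
    obtain \<gamma>' \<beta>' where \<gamma>': "\<gamma>' \<in> presc2 G t" "\<forall>y\<in>obss G (t + 1). \<forall>b\<in>acts2 G t. \<beta>' y b \<in> guaranteed G (t + 1)"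
      "\<forall>x\<in>states G t. \<forall>a\<in>acts1 G t. \<alpha>' x \<le> backup G t \<gamma>' \<beta>' x a"
      using less.prems(2) False by (auto simp: guaranteed.simps[of G t])
    have convex: "\<forall>\<alpha>\<in>guaranteed G (t + 1). \<forall>\<alpha>'\<in>guaranteed G (t + 1). \<forall>k\<in>{0..1::real}.
        (\<lambda>x. k * \<alpha> x + (1 - k) * \<alpha>' x) \<in> guaranteed G (t + 1)"
      using less.hyps[of "t + 1"] False by auto
    obtain \<delta> \<eta> where \<delta>: "\<delta> \<in> presc2 G t" "\<forall>y\<in>obss G (t + 1). \<forall>b\<in>acts2 G t. \<eta> y b \<in> guaranteed G (t + 1)"
      "\<And>x a. backup G t \<delta> \<eta> x a = k * backup G t \<gamma> \<beta> x a + (1 - k) * backup G t \<gamma>' \<beta>' x a"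
      using backup_mix[OF convex \<gamma>(1) \<gamma>'(1) \<gamma>(2) \<gamma>'(2) less.prems(3,4)] by blast
    have "k * \<alpha> x + (1 - k) * \<alpha>' x \<le> backup G t \<delta> \<eta> x a" if "x \<in> states G t" "a \<in> acts1 G t" for x a
      unfolding \<delta>(3) using \<gamma>(3) \<gamma>'(3) that less.prems(3,4) by (intro add_mono mult_left_mono) auto
    with \<delta>(1,2) show ?thesis using False by (subst guaranteed.simps) (simp, blast)
  qed
qed

section \<open>Linear identities for the belief update\<close>

lemma sum_pmf_simplex: "finite A \<Longrightarrow> p \<in> prob_simplex A \<Longrightarrow> (\<Sum>x\<in>A. pmf p x) = 1"
  by (simp add: prob_simplex_def sum_pmf_eq_1)

lemma Q_nonneg: "0 \<le> Q G t \<pi> \<gamma>1 z x'"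
  by (auto simp: Q_def intro!: sum_nonneg)

lemma R_nonneg: "0 \<le> R G t \<pi> \<gamma>1 z"
  by (auto simp: R_def intro!: sum_nonneg Q_nonneg)

lemma sum_Q:
  "(\<Sum>x'\<in>A. Q G t \<pi> \<gamma>1 z x' * h x') =
   (\<Sum>x\<in>states G t. \<Sum>a\<in>acts1 G t. pmf \<pi> x * pmf (\<gamma>1 x) a *
      (\<Sum>x'\<in>A. pmf (kernel G t x a (snd z)) (x', fst z) * h x'))"
proof -
  have "(\<Sum>x'\<in>A. Q G t \<pi> \<gamma>1 z x' * h x') = (\<Sum>x'\<in>A. \<Sum>x\<in>states G t. \<Sum>a\<in>acts1 G t.
      pmf \<pi> x * pmf (\<gamma>1 x) a * (pmf (kernel G t x a (snd z)) (x', fst z) * h x'))"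
    by (simp add: Q_def sum_distrib_right mult.assoc)
  also have "\<dots> = (\<Sum>x\<in>states G t. \<Sum>x'\<in>A. \<Sum>a\<in>acts1 G t.
      pmf \<pi> x * pmf (\<gamma>1 x) a * (pmf (kernel G t x a (snd z)) (x', fst z) * h x'))"
    by (rule sum.swap)
  also have "\<dots> = (\<Sum>x\<in>states G t. \<Sum>a\<in>acts1 G t. pmf \<pi> x * pmf (\<gamma>1 x) a *
      (\<Sum>x'\<in>A. pmf (kernel G t x a (snd z)) (x', fst z) * h x'))"
    by (intro sum.cong refl) (simp add: sum_distrib_left sum.swap[of _ A])
  finally show ?thesis .
qed

text \<open>For distributions on the sets of the game, this computes one expectation of
  \<open>h\<close> in two orders: conditioning on \<open>(y, b)\<close> first, or forward from
  \<open>(x, a)\<close>. \<open>Q\<close> is not normalized, hence linear in \<pi> and in \<gamma>1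
  separately.\<close>

lemma sum_Q_joint:
  "(\<Sum>y\<in>obss G (t + 1). \<Sum>b\<in>acts2 G t. pmf \<gamma>2 b *
      (\<Sum>x'\<in>states G (t + 1). Q G t \<pi> \<gamma>1 (y, b) x' * h y b x')) =
   (\<Sum>x\<in>states G t. \<Sum>a\<in>acts1 G t. pmf \<pi> x * pmf (\<gamma>1 x) a * (\<Sum>b\<in>acts2 G t. pmf \<gamma>2 b *
      (\<Sum>x'\<in>states G (t + 1). \<Sum>y\<in>obss G (t + 1). pmf (kernel G t x a b) (x', y) * h y b x')))"
    (is "?L = ?R")
proof -
  let ?K = "\<lambda>x a b y. \<Sum>x'\<in>states G (t + 1). pmf (kernel G t x a b) (x', y) * h y b x'"
  have "?L = (\<Sum>y\<in>obss G (t + 1). \<Sum>b\<in>acts2 G t. \<Sum>x\<in>states G t. \<Sum>a\<in>acts1 G t.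
      pmf \<pi> x * pmf (\<gamma>1 x) a * (pmf \<gamma>2 b * ?K x a b y))"
    unfolding sum_Q by (simp add: sum_distrib_left mult_ac)
  also have "\<dots> = (\<Sum>x\<in>states G t. \<Sum>a\<in>acts1 G t. \<Sum>b\<in>acts2 G t. \<Sum>y\<in>obss G (t + 1).
      pmf \<pi> x * pmf (\<gamma>1 x) a * (pmf \<gamma>2 b * ?K x a b y))"
    by (simp only: sum.swap[of _ "acts1 G t" "acts2 G t"] sum.swap[of _ "states G t" "acts2 G t"]
      sum.swap[of _ "states G t" "obss G (t + 1)"] sum.swap[of _ "acts1 G t" "obss G (t + 1)"]
      sum.swap[of _ "acts2 G t" "obss G (t + 1)"])
  also have "\<dots> = ?R"
    by (intro sum.cong refl)
      (simp add: sum_distrib_left sum.swap[of _ "obss G (Suc t)" "states G (Suc t)"])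
  finally show ?thesis .
qed

lemma abs_INF_SUP_le:
  fixes f :: "'p \<Rightarrow> 'q \<Rightarrow> real"
  assumes "A \<noteq> {}" "B \<noteq> {}" "\<And>p q. p \<in> A \<Longrightarrow> q \<in> B \<Longrightarrow> \<bar>f p q\<bar> \<le> C"
  shows "\<bar>INF p\<in>A. SUP q\<in>B. f p q\<bar> \<le> C" "\<bar>SUP q\<in>B. INF p\<in>A. f p q\<bar> \<le> C"
  using assms by (auto intro!: cInf_abs_ge cSup_abs_le)

lemma presc1_simplex: "\<gamma>1 \<in> presc1 G t \<Longrightarrow> x \<in> states G t \<Longrightarrow> \<gamma>1 x \<in> prob_simplex (acts1 G t)"
  by (auto simp: presc1_def)

context
  fixes G :: "('x, 'a, 'b, 'y, 's, 'o) game"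
  assumes G: "valid_game G"
begin

lemma finite_sets:
  "t \<in> {1..horizon G + 1} \<Longrightarrow> finite (states G t)" "t \<in> {1..horizon G + 1} \<Longrightarrow> states G t \<noteq> {}"
  "t \<in> {1..horizon G + 1} \<Longrightarrow> finite (obss G t)"
  "t \<in> {1..horizon G} \<Longrightarrow> finite (acts1 G t)" "t \<in> {1..horizon G} \<Longrightarrow> acts1 G t \<noteq> {}"
  "t \<in> {1..horizon G} \<Longrightarrow> finite (acts2 G t)" "t \<in> {1..horizon G} \<Longrightarrow> acts2 G t \<noteq> {}"
  using G by (auto simp: valid_game_def)

lemma presc_nonempty:
  assumes "t \<in> {1..horizon G}"
  shows "presc1 G t \<noteq> {}" "presc2 G t \<noteq> {}"
proof -
  have "pmf_of_set (acts1 G t) \<in> prob_simplex (acts1 G t)" "pmf_of_set (acts2 G t) \<in> prob_simplex (acts2 G t)"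
    using finite_sets(4-7)[OF assms] by (auto simp: prob_simplex_def)
  then show "presc1 G t \<noteq> {}" "presc2 G t \<noteq> {}"
    by (auto simp: presc1_def presc2_def PiE_eq_empty_iff)
qed

lemma kernel_outside:
  assumes "t \<in> {1..horizon G}" "x \<in> states G t" "a \<in> acts1 G t" "b \<in> acts2 G t" "x' \<notin> states G (t + 1)"
  shows "pmf (kernel G t x a b) (x', y) = 0"
  using set_kernel[OF G assms(1-4)] assms(5) by (auto simp: pmf_eq_0_set_pmf)

lemma sum_kernel:
  assumes "t \<in> {1..horizon G}" "x \<in> states G t" "a \<in> acts1 G t" "b \<in> acts2 G t"
  shows "(\<Sum>x'\<in>states G (t + 1). \<Sum>y\<in>obss G (t + 1). pmf (kernel G t x a b) (x', y)) = 1"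
  using assms finite_sets[of "t + 1"] set_kernel[OF G assms]
  by (simp add: sum.cartesian_product sum_pmf_eq_1)

lemma F_simplex:
  assumes t: "t \<in> {1..horizon G}" and b: "b \<in> acts2 G t"
  shows "F G t \<pi> \<gamma>1 (y, b) \<in> prob_simplex (states G (t + 1))"
proof (cases "R G t \<pi> \<gamma>1 (y, b) > 0")
  case True
  have "Q G t \<pi> \<gamma>1 (y, b) x' = 0" if "x' \<notin> states G (t + 1)" for x'
    using that kernel_outside[OF t _ _ b] by (simp add: Q_def)
  then show ?thesis
    by (auto simp: prob_simplex_def set_pmf_eq pmf_F[OF G t b True])
next
  case False
  then show ?thesis
    using finite_sets[of "t + 1"] t by (auto simp: F_def prob_simplex_def)
qed

text \<open>If \<open>R\<close> is positive it cancels the normalization in \<open>F\<close>; if it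
  is 0, all the nonnegative terms \<open>Q\<close> vanish, so the uniform default of
  \<open>F\<close> leaves no trace.\<close>

lemma R_mult_F:
  assumes t: "t \<in> {1..horizon G}" and b: "b \<in> acts2 G t"
  shows "R G t \<pi> \<gamma>1 (y, b) * (\<Sum>x'\<in>states G (t + 1). pmf (F G t \<pi> \<gamma>1 (y, b)) x' * h x') =
    (\<Sum>x'\<in>states G (t + 1). Q G t \<pi> \<gamma>1 (y, b) x' * h x')"
proof (cases "R G t \<pi> \<gamma>1 (y, b) > 0")
  case True
  then show ?thesis
    by (simp add: pmf_F[OF G t b True] sum_distrib_left)
next
  case False
  then have R0: "R G t \<pi> \<gamma>1 (y, b) = 0" using R_nonneg[of G t \<pi> \<gamma>1 "(y, b)"] by linarith
  moreover have "finite (states G (t + 1))" using finite_sets[of "t + 1"] t by auto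
  ultimately have "\<forall>x'\<in>states G (t + 1). Q G t \<pi> \<gamma>1 (y, b) x' = 0"
    unfolding R_def using sum_nonneg_eq_0_iff Q_nonneg by metis
  with R0 show ?thesis by simp
qed

lemma sum_joint_simplex:
  assumes t: "t \<in> {1..horizon G}" and \<gamma>: "\<gamma>1 \<in> presc1 G t"
  shows "(\<Sum>x\<in>states G t. \<Sum>a\<in>acts1 G t. pmf \<pi> x * pmf (\<gamma>1 x) a * h x) =
    (\<Sum>x\<in>states G t. pmf \<pi> x * h x)"
proof (intro sum.cong refl)
  fix x assume "x \<in> states G t"
  then have "sum (pmf (\<gamma>1 x)) (acts1 G t) = 1"
    using finite_sets[of t] t presc1_simplex[OF \<gamma>] by (simp add: sum_pmf_simplex)
  then show "(\<Sum>a\<in>acts1 G t. pmf \<pi> x * pmf (\<gamma>1 x) a * h x) = pmf \<pi> x * h x"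
    by (simp add: mult_ac flip: sum_distrib_left)
qed

lemma sum_R:
  assumes t: "t \<in> {1..horizon G}" and \<pi>: "\<pi> \<in> prob_simplex (states G t)"
    and \<gamma>: "\<gamma>1 \<in> presc1 G t" "\<gamma>2 \<in> presc2 G t"
  shows "(\<Sum>y\<in>obss G (t + 1). \<Sum>b\<in>acts2 G t. pmf \<gamma>2 b * R G t \<pi> \<gamma>1 (y, b)) = 1"
proof -
  have "(\<Sum>y\<in>obss G (t + 1). \<Sum>b\<in>acts2 G t. pmf \<gamma>2 b * R G t \<pi> \<gamma>1 (y, b)) =
    (\<Sum>x\<in>states G t. \<Sum>a\<in>acts1 G t. pmf \<pi> x * pmf (\<gamma>1 x) a * (\<Sum>b\<in>acts2 G t. pmf \<gamma>2 b *
      (\<Sum>x'\<in>states G (t + 1). \<Sum>y\<in>obss G (t + 1). pmf (kernel G t x a b) (x', y) * 1)))"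
    using sum_Q_joint[where h = "\<lambda>_ _ _. 1"] by (simp add: R_def)
  also have "\<dots> = (\<Sum>x\<in>states G t. \<Sum>a\<in>acts1 G t. pmf \<pi> x * pmf (\<gamma>1 x) a * 1)"
    using sum_kernel[OF t] \<gamma>(2) finite_sets[of t] t
    by (intro sum.cong refl arg_cong2[where f = "(*)"]) (simp add: presc2_def sum_pmf_simplex)
  also have "\<dots> = 1"
    using sum_joint_simplex[OF t \<gamma>(1), where h = "\<lambda>_. 1"] \<pi> finite_sets[of t] t
    by (simp add: sum_pmf_simplex)
  finally show ?thesis .
qed

text \<open>The reason for passing to vectors: with a continuation payoff that is linear in the next
  belief, the factor \<open>R\<close> removes the normalization, and the stage payoff is linear in
  \<pi> and in \<gamma>1. With the value function as continuation this fails in general.\<close>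

lemma sum_backup:
  assumes t: "t \<in> {1..horizon G}"
  shows "(\<Sum>x\<in>states G t. \<Sum>a\<in>acts1 G t. pmf \<pi> x * pmf (\<gamma>1 x) a * backup G t \<gamma>2 \<beta> x a) =
    ctilde G t \<pi> \<gamma>1 \<gamma>2 + (\<Sum>y\<in>obss G (t + 1). \<Sum>b\<in>acts2 G t. pmf \<gamma>2 b * R G t \<pi> \<gamma>1 (y, b) *
      (\<Sum>x'\<in>states G (t + 1). pmf (F G t \<pi> \<gamma>1 (y, b)) x' * \<beta> y b x'))"
proof -
  have "(\<Sum>y\<in>obss G (t + 1). \<Sum>b\<in>acts2 G t. pmf \<gamma>2 b * R G t \<pi> \<gamma>1 (y, b) *
      (\<Sum>x'\<in>states G (t + 1). pmf (F G t \<pi> \<gamma>1 (y, b)) x' * \<beta> y b x')) =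
    (\<Sum>y\<in>obss G (t + 1). \<Sum>b\<in>acts2 G t. pmf \<gamma>2 b *
      (\<Sum>x'\<in>states G (t + 1). Q G t \<pi> \<gamma>1 (y, b) x' * \<beta> y b x'))"
    using R_mult_F[OF t] by (simp add: mult.assoc)
  then show ?thesis
    unfolding sum_Q_joint ctilde_def backup_def
    by (simp add: sum_distrib_left sum.distrib distrib_left mult_ac)
qed

section \<open>Bounds for the stage and value functions\<close>

lemma abs_stage_le:
  assumes t: "t \<in> {1..horizon G}" and V: "\<And>\<pi>. \<pi> \<in> prob_simplex (states G (t + 1)) \<Longrightarrow> \<bar>V \<pi>\<bar> \<le> M"
    and \<pi>: "\<pi> \<in> prob_simplex (states G t)" and \<gamma>: "\<gamma>1 \<in> presc1 G t" "\<gamma>2 \<in> presc2 G t"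
  shows "\<bar>stage G t V \<pi> \<gamma>1 \<gamma>2\<bar> \<le>
    (\<Sum>x\<in>states G t. \<Sum>a\<in>acts1 G t. \<Sum>b\<in>acts2 G t. \<bar>cost G t x a b\<bar>) + M"
proof -
  have "\<bar>ctilde G t \<pi> \<gamma>1 \<gamma>2\<bar> \<le>
      (\<Sum>x\<in>states G t. \<Sum>a\<in>acts1 G t. \<Sum>b\<in>acts2 G t. \<bar>cost G t x a b * pmf \<pi> x * pmf (\<gamma>1 x) a * pmf \<gamma>2 b\<bar>)"
    unfolding ctilde_def by (intro order_trans[OF sum_abs] sum_mono order_refl)
  also have "\<dots> \<le> (\<Sum>x\<in>states G t. \<Sum>a\<in>acts1 G t. \<Sum>b\<in>acts2 G t. \<bar>cost G t x a b\<bar>)"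
  proof (intro sum_mono)
    fix x a b
    have "\<bar>cost G t x a b\<bar> * (pmf \<pi> x * pmf (\<gamma>1 x) a * pmf \<gamma>2 b) \<le> \<bar>cost G t x a b\<bar> * 1"
      by (intro mult_left_mono mult_le_one mult_nonneg_nonneg pmf_le_1) auto
    then show "\<bar>cost G t x a b * pmf \<pi> x * pmf (\<gamma>1 x) a * pmf \<gamma>2 b\<bar> \<le> \<bar>cost G t x a b\<bar>"
      by (simp add: abs_mult mult_ac)
  qed
  finally have c: "\<bar>ctilde G t \<pi> \<gamma>1 \<gamma>2\<bar> \<le> \<dots>" .
  let ?W = "\<Sum>y\<in>obss G (t + 1). \<Sum>b\<in>acts2 G t. pmf \<gamma>2 b * R G t \<pi> \<gamma>1 (y, b) * V (F G t \<pi> \<gamma>1 (y, b))"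
  have "\<bar>?W\<bar> \<le> (\<Sum>y\<in>obss G (t + 1). \<Sum>b\<in>acts2 G t. \<bar>pmf \<gamma>2 b * R G t \<pi> \<gamma>1 (y, b) * V (F G t \<pi> \<gamma>1 (y, b))\<bar>)"
    by (intro order_trans[OF sum_abs] sum_mono order_refl)
  also have "\<dots> \<le> (\<Sum>y\<in>obss G (t + 1). \<Sum>b\<in>acts2 G t. pmf \<gamma>2 b * R G t \<pi> \<gamma>1 (y, b) * M)"
    using V[OF F_simplex[OF t]]
    by (intro sum_mono) (auto simp: abs_mult R_nonneg intro!: mult_left_mono)
  also have "\<dots> = M"
    using sum_R[OF t \<pi> \<gamma>] by (simp flip: sum_distrib_right)
  finally show ?thesis using c unfolding stage_def by linarith
qed

lemma stage_mono:
  assumes t: "t \<in> {1..horizon G}"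
    and V: "\<And>\<pi>. \<pi> \<in> prob_simplex (states G (t + 1)) \<Longrightarrow> V \<pi> \<le> V' \<pi>"
  shows "stage G t V \<pi> \<gamma>1 \<gamma>2 \<le> stage G t V' \<pi> \<gamma>1 \<gamma>2"
  unfolding stage_def
  using V[OF F_simplex[OF t]] by (intro add_left_mono sum_mono mult_left_mono) (auto simp: R_nonneg)

text \<open>This gives the real-valued \<open>INF\<close> and \<open>SUP\<close> of the programs
  their usual meaning; the bound grows by the sum of all absolute costs of one stage.\<close>

lemma bounded_values:
  assumes "1 \<le> t" "t \<le> horizon G + 1"
  obtains M where "\<And>\<pi>. \<pi> \<in> prob_simplex (states G t) \<Longrightarrow> \<bar>Vu G t \<pi>\<bar> \<le> M"
    "\<And>\<pi>. \<pi> \<in> prob_simplex (states G t) \<Longrightarrow> \<bar>Vl G t \<pi>\<bar> \<le> M"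
proof -
  have "\<exists>M. \<forall>\<pi>\<in>prob_simplex (states G t). \<bar>Vu G t \<pi>\<bar> \<le> M \<and> \<bar>Vl G t \<pi>\<bar> \<le> M"
    using assms(2,1)
  proof (induction t rule: inc_induct)
    case base
    show ?case by (auto simp: Vu.simps Vl.simps)
  next
    case (step t)
    then have t: "t \<in> {1..horizon G}" by auto
    obtain M where M: "\<bar>Vu G (t + 1) \<pi>\<bar> \<le> M" "\<bar>Vl G (t + 1) \<pi>\<bar> \<le> M"
      if "\<pi> \<in> prob_simplex (states G (t + 1))" for \<pi>
      using step by auto
    let ?C = "(\<Sum>x\<in>states G t. \<Sum>a\<in>acts1 G t. \<Sum>b\<in>acts2 G t. \<bar>cost G t x a b\<bar>) + M"
    have "\<bar>Vu G t \<pi>\<bar> \<le> ?C \<and> \<bar>Vl G t \<pi>\<bar> \<le> ?C" if \<pi>: "\<pi> \<in> prob_simplex (states G t)" for \<pi>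
      using t abs_stage_le[OF t M(1) \<pi>] abs_stage_le[OF t M(2) \<pi>]
      by (simp add: Vu.simps[of G t] Vl.simps[of G t] abs_INF_SUP_le presc_nonempty)
    then show ?case by blast
  qed
  with that show thesis by blast
qed

lemma stage_bounded:
  assumes t: "t \<in> {1..horizon G}" and V: "V = Vu \<or> V = Vl"
    and \<pi>: "\<pi> \<in> prob_simplex (states G t)"
  shows "\<gamma>1 \<in> presc1 G t \<Longrightarrow> bdd_above (stage G t (V G (t + 1)) \<pi> \<gamma>1 ` presc2 G t)"
    "\<gamma>2 \<in> presc2 G t \<Longrightarrow> bdd_below ((\<lambda>\<gamma>1. stage G t (V G (t + 1)) \<pi> \<gamma>1 \<gamma>2) ` presc1 G t)"
    "bdd_below ((\<lambda>\<gamma>1. SUP \<gamma>2\<in>presc2 G t. stage G t (V G (t + 1)) \<pi> \<gamma>1 \<gamma>2) ` presc1 G t)"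
    "bdd_above ((\<lambda>\<gamma>2. INF \<gamma>1\<in>presc1 G t. stage G t (V G (t + 1)) \<pi> \<gamma>1 \<gamma>2) ` presc2 G t)"
proof -
  have t1: "1 \<le> t + 1" "t + 1 \<le> horizon G + 1" using t by auto
  obtain M where M: "\<And>\<pi>. \<pi> \<in> prob_simplex (states G (t + 1)) \<Longrightarrow> \<bar>V G (t + 1) \<pi>\<bar> \<le> M"
    using bounded_values[OF t1] V by metis
  obtain C where C: "\<And>\<gamma>1 \<gamma>2. \<gamma>1 \<in> presc1 G t \<Longrightarrow> \<gamma>2 \<in> presc2 G t \<Longrightarrow> \<bar>stage G t (V G (t + 1)) \<pi> \<gamma>1 \<gamma>2\<bar> \<le> C"
    using abs_stage_le[where V = "V G (t + 1)", OF t M \<pi>] by blast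
  show "bdd_above (stage G t (V G (t + 1)) \<pi> \<gamma>1 ` presc2 G t)" if "\<gamma>1 \<in> presc1 G t"
    using C[OF that] by (intro bdd_aboveI[of _ C]) (auto simp: abs_le_iff)
  show "bdd_below ((\<lambda>\<gamma>1. stage G t (V G (t + 1)) \<pi> \<gamma>1 \<gamma>2) ` presc1 G t)" if "\<gamma>2 \<in> presc2 G t"
    using C[OF _ that] by (intro bdd_belowI[of _ "- C"]) (force simp: abs_le_iff)
  have "\<bar>SUP \<gamma>2\<in>presc2 G t. stage G t (V G (t + 1)) \<pi> \<gamma>1 \<gamma>2\<bar> \<le> C" if "\<gamma>1 \<in> presc1 G t" for \<gamma>1
    using C[OF that] presc_nonempty[OF t] by (intro cSup_abs_le) auto
  then show "bdd_below ((\<lambda>\<gamma>1. SUP \<gamma>2\<in>presc2 G t. stage G t (V G (t + 1)) \<pi> \<gamma>1 \<gamma>2) ` presc1 G t)"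
    by (intro bdd_belowI[of _ "- C"]) (force simp: abs_le_iff)
  have "\<bar>INF \<gamma>1\<in>presc1 G t. stage G t (V G (t + 1)) \<pi> \<gamma>1 \<gamma>2\<bar> \<le> C" if "\<gamma>2 \<in> presc2 G t" for \<gamma>2
    using C[OF _ that] presc_nonempty[OF t] by (intro cInf_abs_ge) auto
  then show "bdd_above ((\<lambda>\<gamma>2. INF \<gamma>1\<in>presc1 G t. stage G t (V G (t + 1)) \<pi> \<gamma>1 \<gamma>2) ` presc2 G t)"
    by (intro bdd_aboveI[of _ C]) (force simp: abs_le_iff)
qed

section \<open>Comparison of the two programs with the guaranteed vectors\<close>

lemma Vl_le_Vu:
  assumes "1 \<le> t" "t \<le> horizon G + 1" "\<pi> \<in> prob_simplex (states G t)"
  shows "Vl G t \<pi> \<le> Vu G t \<pi>"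
  using assms(2,1,3)
proof (induction t arbitrary: \<pi> rule: inc_induct)
  case base
  then show ?case by (simp add: Vu.simps Vl.simps)
next
  case (step t)
  then have t: "t \<in> {1..horizon G}" by auto
  note bdd = stage_bounded[OF t _ step.prems(2)]
  have "(INF \<gamma>1\<in>presc1 G t. stage G t (Vl G (t + 1)) \<pi> \<gamma>1 \<delta>2)
      \<le> (SUP \<gamma>2\<in>presc2 G t. stage G t (Vu G (t + 1)) \<pi> \<delta>1 \<gamma>2)"
    if \<delta>: "\<delta>1 \<in> presc1 G t" "\<delta>2 \<in> presc2 G t" for \<delta>1 \<delta>2
  proof -
    have "(INF \<gamma>1\<in>presc1 G t. stage G t (Vl G (t + 1)) \<pi> \<gamma>1 \<delta>2) \<le> stage G t (Vl G (t + 1)) \<pi> \<delta>1 \<delta>2"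
      using \<delta> by (intro cINF_lower bdd) auto
    also have "\<dots> \<le> stage G t (Vu G (t + 1)) \<pi> \<delta>1 \<delta>2"
      using step.IH by (intro stage_mono[OF t]) auto
    also have "\<dots> \<le> (SUP \<gamma>2\<in>presc2 G t. stage G t (Vu G (t + 1)) \<pi> \<delta>1 \<gamma>2)"
      using \<delta> by (intro cSUP_upper bdd) auto
    finally show ?thesis .
  qed
  then show ?case
    using t presc_nonempty[OF t] unfolding Vu.simps[of G t] Vl.simps[of G t]
    by (auto intro!: cSUP_least cINF_greatest)
qed

text \<open>The \<gamma>2 behind \<alpha> is one candidate in the outer supremum of
  \<open>Vl\<close>. Against any \<gamma>1 the average of \<alpha> is at most the stage payoff with
  continuation \<beta>, and by induction each \<beta> averages to at most \<open>Vl\<close> at the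
  updated belief.\<close>

lemma guaranteed_le_Vl:
  assumes "1 \<le> t" "t \<le> horizon G + 1" "\<pi> \<in> prob_simplex (states G t)" "\<alpha> \<in> guaranteed G t"
  shows "(\<Sum>x\<in>states G t. pmf \<pi> x * \<alpha> x) \<le> Vl G t \<pi>"
  using assms(2,1,3,4)
proof (induction t arbitrary: \<pi> \<alpha> rule: inc_induct)
  case base
  then show ?case
    by (auto simp: Vl.simps guaranteed.simps intro!: sum_nonpos mult_nonneg_nonpos)
next
  case (step t)
  then have t: "t \<in> {1..horizon G}" by auto
  note \<pi> = step.prems(2)
  obtain \<gamma>2 \<beta> where \<gamma>2: "\<gamma>2 \<in> presc2 G t"
    and \<beta>: "\<And>y b. y \<in> obss G (t + 1) \<Longrightarrow> b \<in> acts2 G t \<Longrightarrow> \<beta> y b \<in> guaranteed G (t + 1)"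
    and \<alpha>: "\<And>x a. x \<in> states G t \<Longrightarrow> a \<in> acts1 G t \<Longrightarrow> \<alpha> x \<le> backup G t \<gamma>2 \<beta> x a"
    using step.prems(3) t by (simp add: guaranteed.simps[of G t]) blast
  have "(\<Sum>x\<in>states G t. pmf \<pi> x * \<alpha> x) \<le> stage G t (Vl G (t + 1)) \<pi> \<gamma>1 \<gamma>2"
    if \<gamma>1: "\<gamma>1 \<in> presc1 G t" for \<gamma>1
  proof -
    have "(\<Sum>x\<in>states G t. pmf \<pi> x * \<alpha> x) =
        (\<Sum>x\<in>states G t. \<Sum>a\<in>acts1 G t. pmf \<pi> x * pmf (\<gamma>1 x) a * \<alpha> x)"
      by (rule sum_joint_simplex[OF t \<gamma>1, symmetric])
    also have "\<dots> \<le> (\<Sum>x\<in>states G t. \<Sum>a\<in>acts1 G t. pmf \<pi> x * pmf (\<gamma>1 x) a * backup G t \<gamma>2 \<beta> x a)"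
      using \<alpha> by (intro sum_mono mult_left_mono) auto
    also have "\<dots> \<le> stage G t (Vl G (t + 1)) \<pi> \<gamma>1 \<gamma>2"
      unfolding sum_backup[OF t] stage_def
      using step.IH[OF _ F_simplex[OF t, simplified] \<beta>[simplified]]
      by (intro add_left_mono sum_mono mult_left_mono) (auto simp: R_nonneg)
    finally show ?thesis .
  qed
  then have "(\<Sum>x\<in>states G t. pmf \<pi> x * \<alpha> x) \<le> (INF \<gamma>1\<in>presc1 G t. stage G t (Vl G (t + 1)) \<pi> \<gamma>1 \<gamma>2)"
    using presc_nonempty[OF t] by (intro cINF_greatest) auto
  also have "\<dots> \<le> Vl G t \<pi>"
    using t cSUP_upper[OF \<gamma>2 stage_bounded(4)[where V = Vl, OF t _ \<pi>]] by (simp add: Vl.simps[of G t])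
  finally show ?case .
qed

text \<open>Minimax in one stage. Player 1 chooses a map \<open>d\<close> from states to actions,
  player 2 a pair \<open>(\<gamma>2, \<beta>)\<close> with guaranteed continuations. Every pair is
  answered by a map with payoff at most \<open>v\<close>, so a single mixture \<open>P\<close> of
  maps answers all pairs; turned into a prescription, it bounds the infimum in
  \<open>Vu\<close>.\<close>

lemma Vu_le_guaranteed_step:
  assumes t: "t \<in> {1..horizon G}" and \<pi>: "\<pi> \<in> prob_simplex (states G t)"
    and IH: "\<And>\<pi> e. \<pi> \<in> prob_simplex (states G (t + 1)) \<Longrightarrow> e > 0 \<Longrightarrow>
      \<exists>\<alpha>\<in>guaranteed G (t + 1). Vu G (t + 1) \<pi> \<le> (\<Sum>x\<in>states G (t + 1). pmf \<pi> x * \<alpha> x) + e"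
    and v: "\<And>\<alpha>. \<alpha> \<in> guaranteed G t \<Longrightarrow> (\<Sum>x\<in>states G t. pmf \<pi> x * \<alpha> x) \<le> v"
  shows "Vu G t \<pi> \<le> v"
proof -
  define D where "D = (\<Pi>\<^sub>E x\<in>states G t. acts1 G t)"
  define u where "u \<gamma>2 \<beta> d = (\<Sum>x\<in>states G t. pmf \<pi> x * backup G t \<gamma>2 \<beta> x (d x))" for \<gamma>2 \<beta> d
  define S where "S = {u \<gamma>2 \<beta> | \<gamma>2 \<beta>. \<gamma>2 \<in> presc2 G t \<and>
    (\<forall>y\<in>obss G (t + 1). \<forall>b\<in>acts2 G t. \<beta> y b \<in> guaranteed G (t + 1))}"
  have fin: "finite D" and ne: "D \<noteq> {}"
    using finite_sets[of t] t by (auto simp: D_def PiE_eq_empty_iff intro!: finite_PiE)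
  obtain P where P: "set_pmf P \<subseteq> D" "\<And>w. w \<in> S \<Longrightarrow> measure_pmf.expectation P w \<le> v"
  proof (rule finite_minimax[OF fin ne, of S v])
    fix w w' and k :: real
    assume "w \<in> S" "w' \<in> S" and k: "0 \<le> k" "k \<le> 1"
    then obtain \<gamma> \<beta> \<gamma>' \<beta>' where w: "w = u \<gamma> \<beta>" "w' = u \<gamma>' \<beta>'"
      and \<gamma>: "\<gamma> \<in> presc2 G t" "\<forall>y\<in>obss G (t + 1). \<forall>b\<in>acts2 G t. \<beta> y b \<in> guaranteed G (t + 1)"
      and \<gamma>': "\<gamma>' \<in> presc2 G t" "\<forall>y\<in>obss G (t + 1). \<forall>b\<in>acts2 G t. \<beta>' y b \<in> guaranteed G (t + 1)"
      by (auto simp: S_def)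
    have convex: "\<forall>\<alpha>\<in>guaranteed G (t + 1). \<forall>\<alpha>'\<in>guaranteed G (t + 1). \<forall>k\<in>{0..1::real}.
        (\<lambda>x. k * \<alpha> x + (1 - k) * \<alpha>' x) \<in> guaranteed G (t + 1)"
      using convex_guaranteed by auto
    obtain \<delta> \<eta> where \<delta>: "\<delta> \<in> presc2 G t" "\<forall>y\<in>obss G (t + 1). \<forall>b\<in>acts2 G t. \<eta> y b \<in> guaranteed G (t + 1)"
      "\<And>x a. backup G t \<delta> \<eta> x a = k * backup G t \<gamma> \<beta> x a + (1 - k) * backup G t \<gamma>' \<beta>' x a"
      using backup_mix[OF convex \<gamma>(1) \<gamma>'(1) \<gamma>(2) \<gamma>'(2) k] by blast
    have "u \<delta> \<eta> d = k * w d + (1 - k) * w' d" for d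
      unfolding w u_def \<delta>(3) sum_distrib_left sum.distrib[symmetric]
      by (intro sum.cong refl) (simp add: algebra_simps)
    moreover have "u \<delta> \<eta> \<in> S" using \<delta> by (auto simp: S_def)
    ultimately show "\<exists>r\<in>S. \<forall>d\<in>D. r d = k * w d + (1 - k) * w' d" by blast
  next
    fix w assume "w \<in> S"
    then obtain \<gamma>2 \<beta> where w: "w = u \<gamma>2 \<beta>" and \<gamma>2: "\<gamma>2 \<in> presc2 G t"
      "\<forall>y\<in>obss G (t + 1). \<forall>b\<in>acts2 G t. \<beta> y b \<in> guaranteed G (t + 1)"
      by (auto simp: S_def)
    \<comment> \<open>The payoff is a sum over \<open>x\<close> of terms that see only
      \<open>d x\<close>, so the best reply minimizes in each state separately, and the vector of
      these minima is itself guaranteed.\<close>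
    define d where "d = restrict (\<lambda>x. arg_min_on (backup G t \<gamma>2 \<beta> x) (acts1 G t)) (states G t)"
    have d: "d x \<in> acts1 G t" "\<And>a. a \<in> acts1 G t \<Longrightarrow> backup G t \<gamma>2 \<beta> x (d x) \<le> backup G t \<gamma>2 \<beta> x a"
      if "x \<in> states G t" for x
      using that finite_sets[of t] t by (auto simp: d_def arg_min_if_finite arg_min_least)
    have "(\<lambda>x. backup G t \<gamma>2 \<beta> x (d x)) \<in> guaranteed G t"
      using t \<gamma>2 d by (subst guaranteed.simps) (simp, blast)
    from v[OF this] have "w d \<le> v" by (simp add: w u_def)
    moreover have "d \<in> D" using d(1) by (auto simp: D_def d_def)
    ultimately show "\<exists>d\<in>D. w d \<le> v" by blast
  qed blast
  define \<gamma>1 where "\<gamma>1 = restrict (\<lambda>x. map_pmf (\<lambda>d. d x) P) (states G t)"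
  have \<gamma>1: "\<gamma>1 \<in> presc1 G t"
  proof -
    have "d x \<in> acts1 G t" if "d \<in> set_pmf P" "x \<in> states G t" for d x
      using that P(1) PiE_mem[of d "states G t" "\<lambda>_. acts1 G t" x] by (auto simp: D_def)
    then show ?thesis by (auto simp: \<gamma>1_def presc1_def prob_simplex_def)
  qed
  have "stage G t (Vu G (t + 1)) \<pi> \<gamma>1 \<gamma>2 \<le> v" if \<gamma>2: "\<gamma>2 \<in> presc2 G t" for \<gamma>2
  proof (rule field_le_epsilon)
    fix e :: real assume "e > 0"
    \<comment> \<open>\<gamma>1 is fixed now, hence so are the beliefs it leads to, and \<beta> may
      be fitted to them: the bound by \<open>P\<close> holds for every pair
      \<open>(\<gamma>2, \<beta>)\<close>, including one chosen afterwards.\<close>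
    define good where "good y b \<alpha> \<longleftrightarrow> \<alpha> \<in> guaranteed G (t + 1) \<and> Vu G (t + 1) (F G t \<pi> \<gamma>1 (y, b))
        \<le> (\<Sum>x\<in>states G (t + 1). pmf (F G t \<pi> \<gamma>1 (y, b)) x * \<alpha> x) + e" for y b \<alpha>
    define \<beta> where "\<beta> y b = (SOME \<alpha>. good y b \<alpha>)" for y b
    have "good y b (\<beta> y b)" if "b \<in> acts2 G t" for y b
    proof -
      have "\<exists>\<alpha>. good y b \<alpha>"
        unfolding good_def using IH[OF F_simplex[OF t that] \<open>e > 0\<close>] by blast
      then show ?thesis unfolding \<beta>_def by (rule someI_ex)
    qed
    then have \<beta>: "\<beta> y b \<in> guaranteed G (t + 1)"
      "Vu G (t + 1) (F G t \<pi> \<gamma>1 (y, b))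
        \<le> (\<Sum>x\<in>states G (t + 1). pmf (F G t \<pi> \<gamma>1 (y, b)) x * \<beta> y b x) + e"
      if "b \<in> acts2 G t" for y b
      using that by (auto simp: good_def)
    have "stage G t (Vu G (t + 1)) \<pi> \<gamma>1 \<gamma>2 \<le> ctilde G t \<pi> \<gamma>1 \<gamma>2 +
      (\<Sum>y\<in>obss G (t + 1). \<Sum>b\<in>acts2 G t. pmf \<gamma>2 b * R G t \<pi> \<gamma>1 (y, b) *
        ((\<Sum>x\<in>states G (t + 1). pmf (F G t \<pi> \<gamma>1 (y, b)) x * \<beta> y b x) + e))"
      unfolding stage_def using \<beta>(2) by (intro add_left_mono sum_mono mult_left_mono) (auto simp: R_nonneg)
    also have "\<dots> = (\<Sum>x\<in>states G t. \<Sum>a\<in>acts1 G t. pmf \<pi> x * pmf (\<gamma>1 x) a * backup G t \<gamma>2 \<beta> x a) +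
      (\<Sum>y\<in>obss G (t + 1). \<Sum>b\<in>acts2 G t. pmf \<gamma>2 b * R G t \<pi> \<gamma>1 (y, b)) * e"
      unfolding sum_backup[OF t] distrib_left sum.distrib sum_distrib_right by simp
    also have "\<dots> = (\<Sum>x\<in>states G t. \<Sum>a\<in>acts1 G t. pmf \<pi> x * pmf (\<gamma>1 x) a * backup G t \<gamma>2 \<beta> x a) + e"
      using sum_R[OF t \<pi> \<gamma>1 \<gamma>2] by simp
    also have "(\<Sum>x\<in>states G t. \<Sum>a\<in>acts1 G t. pmf \<pi> x * pmf (\<gamma>1 x) a * backup G t \<gamma>2 \<beta> x a)
      = (\<Sum>x\<in>states G t. pmf \<pi> x * measure_pmf.expectation (\<gamma>1 x) (backup G t \<gamma>2 \<beta> x))"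
    proof (intro sum.cong refl)
      fix x assume "x \<in> states G t"
      then have "set_pmf (\<gamma>1 x) \<subseteq> acts1 G t" using \<gamma>1 by (auto simp: presc1_def prob_simplex_def)
      then show "(\<Sum>a\<in>acts1 G t. pmf \<pi> x * pmf (\<gamma>1 x) a * backup G t \<gamma>2 \<beta> x a)
        = pmf \<pi> x * measure_pmf.expectation (\<gamma>1 x) (backup G t \<gamma>2 \<beta> x)"
        using finite_sets[of t] t by (subst expectation_finite) (auto simp: sum_distrib_left mult.assoc)
    qed
    also have "\<dots> = (\<Sum>x\<in>states G t. measure_pmf.expectation P (\<lambda>d. pmf \<pi> x * backup G t \<gamma>2 \<beta> x (d x)))"
      by (intro sum.cong refl) (simp add: \<gamma>1_def)
    also have "\<dots> = measure_pmf.expectation P (u \<gamma>2 \<beta>)"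
      unfolding u_def using finite_subset[OF P(1) fin]
      by (subst Bochner_Integration.integral_sum) (auto intro!: integrable_measure_pmf_finite)
    also have "\<dots> \<le> v"
    proof (rule P(2))
      show "u \<gamma>2 \<beta> \<in> S" unfolding S_def using \<beta>(1) \<gamma>2 by blast
    qed
    finally show "stage G t (Vu G (t + 1)) \<pi> \<gamma>1 \<gamma>2 \<le> v + e" by simp
  qed
  then have "(SUP \<gamma>2\<in>presc2 G t. stage G t (Vu G (t + 1)) \<pi> \<gamma>1 \<gamma>2) \<le> v"
    using presc_nonempty[OF t] by (intro cSUP_least) auto
  moreover have "Vu G t \<pi> \<le> (SUP \<gamma>2\<in>presc2 G t. stage G t (Vu G (t + 1)) \<pi> \<gamma>1 \<gamma>2)"

    using t cINF_lower[OF stage_bounded(3)[where V = Vu, OF t _ \<pi>] \<gamma>1] by (simp add: Vu.simps[of G t])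
  ultimately show ?thesis by simp
qed

text \<open>If every guaranteed vector missed by more than \<open>e\<close>, the step lemma would
  apply with the upper bound \<open>Vu G t \<pi> - e\<close> and put \<open>Vu G t \<pi>\<close>
  below it.\<close>

lemma Vu_le_guaranteed:
  assumes "1 \<le> t" "t \<le> horizon G + 1" "\<pi> \<in> prob_simplex (states G t)" "e > 0"
  shows "\<exists>\<alpha>\<in>guaranteed G t. Vu G t \<pi> \<le> (\<Sum>x\<in>states G t. pmf \<pi> x * \<alpha> x) + e"
  using assms(2,1,3,4)
proof (induction t arbitrary: \<pi> e rule: inc_induct)
  case base
  then show ?case
    by (intro bexI[of _ "\<lambda>_. 0"]) (auto simp: Vu.simps guaranteed.simps)
next
  case (step t)
  then have t: "t \<in> {1..horizon G}" by auto
  show ?case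
  proof (rule ccontr)
    assume "\<not> ?case"
    then have "(\<Sum>x\<in>states G t. pmf \<pi> x * \<alpha> x) \<le> Vu G t \<pi> - e" if "\<alpha> \<in> guaranteed G t" for \<alpha>
      using that by fastforce
    with step.IH have "Vu G t \<pi> \<le> Vu G t \<pi> - e"
      by (intro Vu_le_guaranteed_step[OF t step.prems(2)]) auto
    with \<open>e > 0\<close> show False by simp
  qed
qed

lemma Vl_eq_Vu:
  assumes "1 \<le> t" "t \<le> horizon G + 1" "\<pi> \<in> prob_simplex (states G t)"
  shows "Vl G t \<pi> = Vu G t \<pi>"
proof (rule antisym[OF Vl_le_Vu[OF assms] field_le_epsilon])
  fix e :: real assume "e > 0"
  then show "Vu G t \<pi> \<le> Vl G t \<pi> + e"
    using Vu_le_guaranteed[OF assms] guaranteed_le_Vl[OF assms] by fastforce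
qed

end

section \<open>Expectations over finitely supported distributions\<close>

lemma expectation_cong_set:
  "(\<And>x. x \<in> set_pmf p \<Longrightarrow> f x = g x) \<Longrightarrow> measure_pmf.expectation p f = (measure_pmf.expectation p g :: real)"
  by (intro integral_cong_AE) (auto simp: AE_measure_pmf_iff)

lemma expectation_mono_finite:
  fixes f g :: "'q \<Rightarrow> real"
  assumes "finite (set_pmf p)" "\<And>x. x \<in> set_pmf p \<Longrightarrow> f x \<le> g x"
  shows "measure_pmf.expectation p f \<le> measure_pmf.expectation p g"
  using assms by (intro integral_mono_AE integrable_measure_pmf_finite) (auto simp: AE_measure_pmf_iff)

lemma expectation_bind_finite:
  fixes h :: "'r \<Rightarrow> real"
  assumes "finite (set_pmf p)" "\<And>x. x \<in> set_pmf p \<Longrightarrow> finite (set_pmf (f x))"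
  shows "measure_pmf.expectation (bind_pmf p f) h =
    measure_pmf.expectation p (\<lambda>x. measure_pmf.expectation (f x) h)"
  using assms by (subst pmf_expectation_bind[of "set_pmf p"])
    (auto simp: expectation_finite[OF _ order_refl])

section \<open>The law of a play of the game\<close>

text \<open>Here and below \<open>n\<close> counts completed stages, so \<open>X\<close> and
  \<open>Y\<close> are known up to \<open>n + 1\<close>; the next stage draws the actions with index
  \<open>n + 1\<close> and the state and observation with index \<open>n + 2\<close>.\<close>

definition extend_traj ::
  "nat \<Rightarrow> ('x, 'a, 'b, 'y) traj \<Rightarrow> 'a \<Rightarrow> 'b \<Rightarrow> 'x \<Rightarrow> 'y \<Rightarrow> ('x, 'a, 'b, 'y) traj" where
  "extend_traj n \<omega> a b x y = \<lparr>st = (st \<omega>)(Suc (Suc n) := x), ob = (ob \<omega>)(Suc (Suc n) := y),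
     ac1 = (ac1 \<omega>)(Suc n := a), ac2 = (ac2 \<omega>)(Suc n := b)\<rparr>"

definition extend_cinfo :: "nat \<Rightarrow> ('b, 'y) cinfo \<Rightarrow> 'b \<Rightarrow> 'y \<Rightarrow> ('b, 'y) cinfo" where
  "extend_cinfo n c b y = ((fst c)(Suc (Suc n) := y), (snd c)(Suc n := b))"

definition play ::
  "('x, 'a, 'b, 'y, 's, 'o) game \<Rightarrow> (nat \<Rightarrow> 'x \<Rightarrow> ('b, 'y) cinfo \<Rightarrow> 'a pmf)
   \<Rightarrow> (nat \<Rightarrow> ('b, 'y) cinfo \<Rightarrow> 'b pmf) \<Rightarrow> nat \<Rightarrow> ('x, 'a, 'b, 'y) traj pmf" where
  "play G g1 g2 = law G (\<lambda>t \<omega>. g1 t (st \<omega> t) (common t \<omega>)) (\<lambda>t \<omega>. g2 t (common t \<omega>))"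

definition feasible :: "('x, 'a, 'b, 'y, 's, 'o) game \<Rightarrow> nat \<Rightarrow> ('x, 'a, 'b, 'y) traj \<Rightarrow> bool" where
  "feasible G n \<omega> \<longleftrightarrow>
     (\<forall>t\<in>{1..Suc n}. st \<omega> t \<in> states G t \<and> ob \<omega> t \<in> obss G t) \<and>
     (\<forall>t\<in>{1..n}. ac1 \<omega> t \<in> acts1 G t \<and> ac2 \<omega> t \<in> acts2 G t)"

definition partial_cost :: "('x, 'a, 'b, 'y, 's, 'o) game \<Rightarrow> nat \<Rightarrow> ('x, 'a, 'b, 'y) traj \<Rightarrow> real" where
  "partial_cost G n \<omega> = (\<Sum>t=1..n. cost G t (st \<omega> t) (ac1 \<omega> t) (ac2 \<omega> t))"

text \<open>
  \<open>bel G \<mu> g1 n c\<close> is the belief on \<open>X\<^sub>n\<^sub>+\<^sub>1\<close> given the common information \<open>c\<close>, when player 1 uses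
  the behavioral strategy \<open>g1\<close>.
\<close>

primrec bel ::
  "('x, 'a, 'b, 'y, 's, 'o) game \<Rightarrow> (('b, 'y) cinfo \<Rightarrow> 'x pmf)
   \<Rightarrow> (nat \<Rightarrow> 'x \<Rightarrow> ('b, 'y) cinfo \<Rightarrow> 'a pmf) \<Rightarrow> nat \<Rightarrow> ('b, 'y) cinfo \<Rightarrow> 'x pmf" where
  "bel G \<mu> g1 0 c = \<mu> (trunc 1 c)"
| "bel G \<mu> g1 (Suc n) c = F G (Suc n) (bel G \<mu> g1 n c) (\<lambda>x. g1 (Suc n) x (trunc (Suc n) c))
     (fst c (Suc (Suc n)), snd c (Suc n))"

lemma trunc_trunc: "m \<le> n \<Longrightarrow> trunc m (trunc n c) = trunc m c"
  by (auto simp: trunc_def restrict_def fun_eq_iff)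

lemma trunc_common: "m \<le> n \<Longrightarrow> trunc m (common n \<omega>) = common m \<omega>"
  by (simp add: common_def trunc_trunc)

lemma trunc_cinfos:
  assumes "c \<in> cinfos G n" "m \<le> n"
  shows "trunc m c \<in> cinfos G m"
proof -
  have "fst c \<in> (\<Pi>\<^sub>E \<tau>\<in>{1..n}. obss G \<tau>)" "snd c \<in> (\<Pi>\<^sub>E \<tau>\<in>{1..<n}. acts2 G \<tau>)"
    using assms(1) by (auto simp: cinfos_def)
  then show ?thesis using assms(2) by (auto simp: trunc_def cinfos_def PiE_iff extensional_def)
qed

lemma trunc_id:
  assumes "c \<in> cinfos G n"
  shows "trunc n c = c"
proof -
  have "fst c \<in> extensional {1..n}" "snd c \<in> extensional {1..<n}"
    using assms by (auto simp: cinfos_def PiE_iff)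
  then show ?thesis by (simp add: trunc_def extensional_restrict)
qed

lemma common_extend: "common (Suc (Suc n)) (extend_traj n \<omega> a b x y) = extend_cinfo n (common (Suc n) \<omega>) b y"
  by (auto simp: common_def trunc_def extend_traj_def extend_cinfo_def restrict_def fun_eq_iff)

lemma trunc_extend_cinfo: "trunc (Suc n) (extend_cinfo n c b y) = trunc (Suc n) c"
  by (auto simp: trunc_def extend_cinfo_def restrict_def fun_eq_iff)

lemma partial_cost_extend:
  "partial_cost G (Suc n) (extend_traj n \<omega> a b x y) = partial_cost G n \<omega> + cost G (Suc n) (st \<omega> (Suc n)) a b"
  by (simp add: partial_cost_def extend_traj_def)

lemma bel_trunc: "bel G \<mu> g1 n (trunc (Suc n) c) = bel G \<mu> g1 n c"
proof (induction n arbitrary: c)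
  case 0
  show ?case by (simp add: trunc_trunc)
next
  case (Suc n)
  have "bel G \<mu> g1 n (trunc (Suc (Suc n)) c) = bel G \<mu> g1 n c"
    by (metis Suc trunc_trunc le_SucI order_refl)
  then show ?case by (simp add: trunc_trunc) (simp add: trunc_def)
qed

lemma bel_extend:
  "bel G \<mu> g1 (Suc n) (extend_cinfo n (common (Suc n) \<omega>) b y) =
    F G (Suc n) (bel G \<mu> g1 n (common (Suc n) \<omega>)) (\<lambda>x. g1 (Suc n) x (common (Suc n) \<omega>)) (y, b)"
proof -
  have "bel G \<mu> g1 n (extend_cinfo n (common (Suc n) \<omega>) b y) = bel G \<mu> g1 n (common (Suc n) \<omega>)"
    by (metis bel_trunc trunc_extend_cinfo)
  then show ?thesis
    by (simp add: trunc_extend_cinfo trunc_common) (simp add: extend_cinfo_def)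
qed

lemma common_cinfos: "feasible G n \<omega> \<Longrightarrow> common (Suc n) \<omega> \<in> cinfos G (Suc n)"
  by (auto simp: feasible_def common_def trunc_def cinfos_def)

context
  fixes G :: "('x, 'a, 'b, 'y, 's, 'o) game"
  assumes G: "valid_game G"
begin

lemma start_finite: "finite (set_pmf (start G))"
  and start_feasible: "\<omega> \<in> set_pmf (start G) \<Longrightarrow> feasible G 0 \<omega>"
proof -
  have "set_pmf (init_law G) \<subseteq> states G 1" "finite (states G 1)" "finite (set_pmf (obs_noise G 1))"
    using G by (auto simp: valid_game_def prob_simplex_def)
  then show "finite (set_pmf (start G))"
    unfolding start_def using finite_subset by (auto intro!: finite_UN_I)
  show "feasible G 0 \<omega>" if "\<omega> \<in> set_pmf (start G)"
    using that G unfolding start_def feasible_def valid_game_def prob_simplex_def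
    by (fastforce simp: subset_iff)
qed

context
  fixes g1 :: "nat \<Rightarrow> 'x \<Rightarrow> ('b, 'y) cinfo \<Rightarrow> 'a pmf" and g2 :: "nat \<Rightarrow> ('b, 'y) cinfo \<Rightarrow> 'b pmf"
  assumes g1: "g1 \<in> strat1 G" and g2: "g2 \<in> strat2 G"
begin

lemma strategies_simplex:
  assumes "n < horizon G" "c \<in> cinfos G (Suc n)"
  shows "x \<in> states G (Suc n) \<Longrightarrow> g1 (Suc n) x c \<in> prob_simplex (acts1 G (Suc n))"
    "g2 (Suc n) c \<in> prob_simplex (acts2 G (Suc n))"
  using assms g1 g2 by (auto simp: strat1_def strat2_def)

lemma play_Suc:
  "play G g1 g2 (Suc n) = bind_pmf (play G g1 g2 n) (\<lambda>\<omega>.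
     bind_pmf (g1 (Suc n) (st \<omega> (Suc n)) (common (Suc n) \<omega>)) (\<lambda>a.
     bind_pmf (g2 (Suc n) (common (Suc n) \<omega>)) (\<lambda>b.
     map_pmf (\<lambda>z. extend_traj n \<omega> a b (fst z) (snd z)) (kernel G (Suc n) (st \<omega> (Suc n)) a b))))"
  by (simp add: play_def extend_traj_def map_pmf_def case_prod_unfold)

text \<open>Strategies are constrained only at states and common information inside the sets of the
  game. Membership of the trajectory and finiteness of the support therefore go through one
  induction.\<close>

lemma play_feasible:
  assumes "n \<le> horizon G"
  shows "finite (set_pmf (play G g1 g2 n)) \<and> (\<forall>\<omega>\<in>set_pmf (play G g1 g2 n). feasible G n \<omega>)"
  using assms
proof (induction n)
  case 0
  then show ?case using start_finite start_feasible by (simp add: play_def)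
next
  case (Suc n)
  then have n: "n < horizon G" "Suc n \<in> {1..horizon G}" by auto
  have step: "feasible G (Suc n) (extend_traj n \<omega> a b x y)"
    if \<omega>: "\<omega> \<in> set_pmf (play G g1 g2 n)" and "a \<in> acts1 G (Suc n)" "b \<in> acts2 G (Suc n)"
      "x \<in> states G (Suc (Suc n))" "y \<in> obss G (Suc (Suc n))" for \<omega> a b x y
    using that Suc by (auto simp: feasible_def extend_traj_def le_Suc_eq)
  have sub: "set_pmf (g1 (Suc n) (st \<omega> (Suc n)) (common (Suc n) \<omega>)) \<subseteq> acts1 G (Suc n)"
      "set_pmf (g2 (Suc n) (common (Suc n) \<omega>)) \<subseteq> acts2 G (Suc n)" "st \<omega> (Suc n) \<in> states G (Suc n)"
    if "\<omega> \<in> set_pmf (play G g1 g2 n)" for \<omega>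
  proof -
    have f: "feasible G n \<omega>" using that Suc by auto
    then show st: "st \<omega> (Suc n) \<in> states G (Suc n)" by (simp add: feasible_def)
    show "set_pmf (g1 (Suc n) (st \<omega> (Suc n)) (common (Suc n) \<omega>)) \<subseteq> acts1 G (Suc n)"
      "set_pmf (g2 (Suc n) (common (Suc n) \<omega>)) \<subseteq> acts2 G (Suc n)"
      using strategies_simplex[OF n(1) common_cinfos[OF f]] st by (auto simp: prob_simplex_def)
  qed
  have ker: "set_pmf (kernel G (Suc n) (st \<omega> (Suc n)) a b) \<subseteq> states G (Suc (Suc n)) \<times> obss G (Suc (Suc n))"
    if "\<omega> \<in> set_pmf (play G g1 g2 n)" "a \<in> acts1 G (Suc n)" "b \<in> acts2 G (Suc n)" for \<omega> a b
    using set_kernel[OF G n(2) sub(3)[OF that(1)] that(2,3)] by simp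
  have fin: "finite (acts1 G (Suc n))" "finite (acts2 G (Suc n))"
    "finite (states G (Suc (Suc n)) \<times> obss G (Suc (Suc n)))"
    using finite_sets[OF G] n by auto
  show ?case
  proof
    show "finite (set_pmf (play G g1 g2 (Suc n)))"
      unfolding play_Suc set_bind_pmf set_map_pmf
    proof (intro finite_UN_I finite_imageI)
      show "finite (set_pmf (play G g1 g2 n))" using Suc by simp
      fix \<omega> assume \<omega>: "\<omega> \<in> set_pmf (play G g1 g2 n)"
      show "finite (set_pmf (g1 (Suc n) (st \<omega> (Suc n)) (common (Suc n) \<omega>)))"
        "finite (set_pmf (g2 (Suc n) (common (Suc n) \<omega>)))"
        using sub(1,2)[OF \<omega>] fin(1,2) by (auto intro: finite_subset)
      fix a b assume "a \<in> set_pmf (g1 (Suc n) (st \<omega> (Suc n)) (common (Suc n) \<omega>))"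
        "b \<in> set_pmf (g2 (Suc n) (common (Suc n) \<omega>))"
      then show "finite (set_pmf (kernel G (Suc n) (st \<omega> (Suc n)) a b))"
        using finite_subset[OF ker[OF \<omega>] fin(3)] sub(1,2)[OF \<omega>] by blast
    qed
    show "\<forall>\<omega>\<in>set_pmf (play G g1 g2 (Suc n)). feasible G (Suc n) \<omega>"
      unfolding play_Suc set_bind_pmf set_map_pmf
      using sub ker by (fastforce intro!: step)
  qed
qed

lemma play_finite: "n \<le> horizon G \<Longrightarrow> finite (set_pmf (play G g1 g2 n))"
  using play_feasible by blast

lemma expectation_play_Suc:
  assumes n: "n < horizon G"
  shows "measure_pmf.expectation (play G g1 g2 (Suc n)) h =
    measure_pmf.expectation (play G g1 g2 n) (\<lambda>\<omega>.
      \<Sum>a\<in>acts1 G (Suc n). pmf (g1 (Suc n) (st \<omega> (Suc n)) (common (Suc n) \<omega>)) a *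
        (\<Sum>b\<in>acts2 G (Suc n). pmf (g2 (Suc n) (common (Suc n) \<omega>)) b *
          (\<Sum>x\<in>states G (Suc n + 1). \<Sum>y\<in>obss G (Suc n + 1).
            pmf (kernel G (Suc n) (st \<omega> (Suc n)) a b) (x, y) * h (extend_traj n \<omega> a b x y))))"
    (is "_ = measure_pmf.expectation _ ?f")
proof -
  have t: "Suc n \<in> {1..horizon G}" using n by simp
  have fin: "finite (acts1 G (Suc n))" "finite (acts2 G (Suc n))"
    "finite (states G (Suc n + 1) \<times> obss G (Suc n + 1))"
    using finite_sets[OF G] n by auto
  define K where "K \<omega> a b = map_pmf (\<lambda>z. extend_traj n \<omega> a b (fst z) (snd z)) (kernel G (Suc n) (st \<omega> (Suc n)) a b)"
    for \<omega> a b
  define B where "B \<omega> a = bind_pmf (g2 (Suc n) (common (Suc n) \<omega>)) (K \<omega> a)" for \<omega> a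
  define A where "A \<omega> = bind_pmf (g1 (Suc n) (st \<omega> (Suc n)) (common (Suc n) \<omega>)) (B \<omega>)" for \<omega>
  have *: "finite (set_pmf (A \<omega>)) \<and> measure_pmf.expectation (A \<omega>) h = ?f \<omega>"
    if \<omega>: "\<omega> \<in> set_pmf (play G g1 g2 n)" for \<omega>
  proof -
    have f: "feasible G n \<omega>" using play_feasible n \<omega> by auto
    then have st: "st \<omega> (Suc n) \<in> states G (Suc n)" by (simp add: feasible_def)
    have sub: "set_pmf (g1 (Suc n) (st \<omega> (Suc n)) (common (Suc n) \<omega>)) \<subseteq> acts1 G (Suc n)"
      "set_pmf (g2 (Suc n) (common (Suc n) \<omega>)) \<subseteq> acts2 G (Suc n)"
      using strategies_simplex[OF n common_cinfos[OF f]] st by (auto simp: prob_simplex_def)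
    have K: "finite (set_pmf (K \<omega> a b))" "measure_pmf.expectation (K \<omega> a b) h =
      (\<Sum>x\<in>states G (Suc n + 1). \<Sum>y\<in>obss G (Suc n + 1).
            pmf (kernel G (Suc n) (st \<omega> (Suc n)) a b) (x, y) * h (extend_traj n \<omega> a b x y))"
      if "a \<in> acts1 G (Suc n)" "b \<in> acts2 G (Suc n)" for a b
    proof -
      note ker = set_kernel[OF G t st that]
      show "finite (set_pmf (K \<omega> a b))"
        unfolding K_def set_map_pmf using finite_subset[OF ker fin(3)] by (rule finite_imageI)
      show "measure_pmf.expectation (K \<omega> a b) h =
        (\<Sum>x\<in>states G (Suc n + 1). \<Sum>y\<in>obss G (Suc n + 1).
            pmf (kernel G (Suc n) (st \<omega> (Suc n)) a b) (x, y) * h (extend_traj n \<omega> a b x y))"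
        by (simp only: K_def integral_map_pmf expectation_finite[OF fin(3) ker] sum.cartesian_product
          case_prod_unfold prod.collapse)
    qed
    have B: "finite (set_pmf (B \<omega> a))" "measure_pmf.expectation (B \<omega> a) h =
      (\<Sum>b\<in>acts2 G (Suc n). pmf (g2 (Suc n) (common (Suc n) \<omega>)) b * measure_pmf.expectation (K \<omega> a b) h)"
      if a: "a \<in> acts1 G (Suc n)" for a
    proof -
      show "finite (set_pmf (B \<omega> a))"
        unfolding B_def set_bind_pmf using finite_subset[OF sub(2) fin(2)] K(1)[OF a] sub(2) by blast
      show "measure_pmf.expectation (B \<omega> a) h =
      (\<Sum>b\<in>acts2 G (Suc n). pmf (g2 (Suc n) (common (Suc n) \<omega>)) b * measure_pmf.expectation (K \<omega> a b) h)"
        unfolding B_def using pmf_expectation_bind[OF fin(2) K(1)[OF a] sub(2), where h = h] by simp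
    qed
    have "finite (set_pmf (A \<omega>))"
      unfolding A_def set_bind_pmf using finite_subset[OF sub(1) fin(1)] B(1) sub(1) by blast
    moreover have "measure_pmf.expectation (A \<omega>) h =
      (\<Sum>a\<in>acts1 G (Suc n). pmf (g1 (Suc n) (st \<omega> (Suc n)) (common (Suc n) \<omega>)) a *
         measure_pmf.expectation (B \<omega> a) h)"
      unfolding A_def using pmf_expectation_bind[OF fin(1) B(1) sub(1), where h = h] by simp
    ultimately show ?thesis by (simp add: B(2) K(2))
  qed
  have "play G g1 g2 (Suc n) = bind_pmf (play G g1 g2 n) A"
    unfolding play_Suc A_def[abs_def] B_def[abs_def] K_def[abs_def] ..
  then have "measure_pmf.expectation (play G g1 g2 (Suc n)) h =
      measure_pmf.expectation (play G g1 g2 n) (\<lambda>\<omega>. measure_pmf.expectation (A \<omega>) h)"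
    using * play_finite[of n] n by (simp add: expectation_bind_finite)
  also have "\<dots> = measure_pmf.expectation (play G g1 g2 n) ?f"
    using * by (intro expectation_cong_set) auto
  finally show ?thesis .
qed

text \<open>The common shape of both bounds: cost so far plus a continuation \<beta> turns into cost
  so far plus a \<open>backup\<close>. It is used with \<beta> constant in the state (a value of the
  next belief) and with \<beta> the vectors tracked by player 2.\<close>

lemma expectation_play_Suc_cost:
  assumes n: "n < horizon G"
    and h: "\<And>\<omega> a b x y. b \<in> acts2 G (Suc n) \<Longrightarrow> y \<in> obss G (Suc n + 1) \<Longrightarrow>
      h (extend_traj n \<omega> a b x y) = s \<omega> + cost G (Suc n) (st \<omega> (Suc n)) a b + \<beta> (common (Suc n) \<omega>) y b x"
  shows "measure_pmf.expectation (play G g1 g2 (Suc n)) h =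
    measure_pmf.expectation (play G g1 g2 n) (\<lambda>\<omega>. s \<omega> +
      (\<Sum>a\<in>acts1 G (Suc n). pmf (g1 (Suc n) (st \<omega> (Suc n)) (common (Suc n) \<omega>)) a *
        backup G (Suc n) (g2 (Suc n) (common (Suc n) \<omega>)) (\<beta> (common (Suc n) \<omega>)) (st \<omega> (Suc n)) a))"
  unfolding expectation_play_Suc[OF n]
proof (rule expectation_cong_set)
  fix \<omega> assume \<omega>: "\<omega> \<in> set_pmf (play G g1 g2 n)"
  define c where "c = common (Suc n) \<omega>"
  define x where "x = st \<omega> (Suc n)"
  have t: "Suc n \<in> {1..horizon G}" using n by simp
  have f: "feasible G n \<omega>" using play_feasible n \<omega> by auto
  then have x: "x \<in> states G (Suc n)" by (simp add: feasible_def x_def)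
  have one: "sum (pmf (g1 (Suc n) x c)) (acts1 G (Suc n)) = 1" "sum (pmf (g2 (Suc n) c)) (acts2 G (Suc n)) = 1"
    using strategies_simplex[OF n common_cinfos[OF f]] x finite_sets[OF G, of "Suc n"] t
    by (auto simp: sum_pmf_simplex c_def)
  let ?K = "\<lambda>a b. \<Sum>x'\<in>states G (Suc n + 1). \<Sum>y\<in>obss G (Suc n + 1).
    pmf (kernel G (Suc n) x a b) (x', y) * \<beta> c y b x'"
  have K: "(\<Sum>x'\<in>states G (Suc n + 1). \<Sum>y\<in>obss G (Suc n + 1).
      pmf (kernel G (Suc n) x a b) (x', y) * h (extend_traj n \<omega> a b x' y)) =
      s \<omega> + (cost G (Suc n) x a b + ?K a b)"
    if "a \<in> acts1 G (Suc n)" "b \<in> acts2 G (Suc n)" for a b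
  proof -
    have "(\<Sum>x'\<in>states G (Suc n + 1). \<Sum>y\<in>obss G (Suc n + 1).
      pmf (kernel G (Suc n) x a b) (x', y) * h (extend_traj n \<omega> a b x' y)) =
      (\<Sum>x'\<in>states G (Suc n + 1). \<Sum>y\<in>obss G (Suc n + 1).
        (s \<omega> + cost G (Suc n) x a b) * pmf (kernel G (Suc n) x a b) (x', y) +
        pmf (kernel G (Suc n) x a b) (x', y) * \<beta> c y b x')"
      using h that(2) by (intro sum.cong refl) (simp add: algebra_simps c_def x_def)
    also have "\<dots> = (s \<omega> + cost G (Suc n) x a b) * (\<Sum>x'\<in>states G (Suc n + 1). \<Sum>y\<in>obss G (Suc n + 1).
        pmf (kernel G (Suc n) x a b) (x', y)) + ?K a b"
      by (simp only: sum.distrib sum_distrib_left)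
    finally show ?thesis using sum_kernel[OF G t x that] by simp
  qed
  have "(\<Sum>b\<in>acts2 G (Suc n). pmf (g2 (Suc n) c) b * (s \<omega> + (cost G (Suc n) x a b + ?K a b))) =
      s \<omega> + backup G (Suc n) (g2 (Suc n) c) (\<beta> c) x a" for a
    unfolding distrib_left[of _ "s \<omega>"] sum.distrib using one(2)
    by (simp add: backup_def flip: sum_distrib_right)
  then have "(\<Sum>a\<in>acts1 G (Suc n). pmf (g1 (Suc n) x c) a * (\<Sum>b\<in>acts2 G (Suc n). pmf (g2 (Suc n) c) b *
      (\<Sum>x'\<in>states G (Suc n + 1). \<Sum>y\<in>obss G (Suc n + 1).
        pmf (kernel G (Suc n) x a b) (x', y) * h (extend_traj n \<omega> a b x' y)))) =
    (\<Sum>a\<in>acts1 G (Suc n). pmf (g1 (Suc n) x c) a * (s \<omega> + backup G (Suc n) (g2 (Suc n) c) (\<beta> c) x a))"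
    by (intro sum.cong refl arg_cong2[where f = "(*)"]) (simp only: K cong: sum.cong)
  also have "\<dots> = s \<omega> + (\<Sum>a\<in>acts1 G (Suc n). pmf (g1 (Suc n) x c) a * backup G (Suc n) (g2 (Suc n) c) (\<beta> c) x a)"
    unfolding distrib_left[of _ "s \<omega>"] sum.distrib using one(1)
    by (simp flip: sum_distrib_right)
  finally show "(\<Sum>a\<in>acts1 G (Suc n). pmf (g1 (Suc n) (st \<omega> (Suc n)) (common (Suc n) \<omega>)) a *
        (\<Sum>b\<in>acts2 G (Suc n). pmf (g2 (Suc n) (common (Suc n) \<omega>)) b *
          (\<Sum>x\<in>states G (Suc n + 1). \<Sum>y\<in>obss G (Suc n + 1).
            pmf (kernel G (Suc n) (st \<omega> (Suc n)) a b) (x, y) * h (extend_traj n \<omega> a b x y)))) =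
     s \<omega> + (\<Sum>a\<in>acts1 G (Suc n). pmf (g1 (Suc n) (st \<omega> (Suc n)) (common (Suc n) \<omega>)) a *
        backup G (Suc n) (g2 (Suc n) (common (Suc n) \<omega>)) (\<beta> (common (Suc n) \<omega>)) (st \<omega> (Suc n)) a)"
    unfolding c_def x_def .
qed

end

end

section \<open>Beliefs along a play\<close>

text \<open>Disintegration of the initial law along \<open>C\<^sub>1\<close>: drawing a trajectory
  and redrawing it conditionally on its common information changes nothing. Only realizations in the
  support occur, and there the belief is the genuine conditional law.\<close>

lemma expectation_start_belief:
  assumes G: "valid_game G" and \<mu>: "is_init_belief G \<mu>"
  shows "measure_pmf.expectation (start G) (\<lambda>\<omega>. \<phi> (st \<omega> 1) (common 1 \<omega>)) =
    measure_pmf.expectation (start G) (\<lambda>\<omega>. \<Sum>x\<in>states G 1. pmf (\<mu> (common 1 \<omega>)) x * \<phi> x (common 1 \<omega>))"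
proof -
  let ?cond = "\<lambda>\<omega>. cond_pmf (start G) {\<omega>'. common 1 \<omega>' = common 1 \<omega>}"
  have ne: "set_pmf (start G) \<inter> {\<omega>'. common 1 \<omega>' = common 1 \<omega>} \<noteq> {}" if "\<omega> \<in> set_pmf (start G)" for \<omega>
    using that by auto
  have start: "start G = bind_pmf (start G) ?cond"
    by (rule bind_cond_pmf_cancel[symmetric]) (auto simp: eq_commute)
  have "measure_pmf.expectation (start G) (\<lambda>\<omega>. \<phi> (st \<omega> 1) (common 1 \<omega>)) =
    measure_pmf.expectation (start G) (\<lambda>\<omega>. measure_pmf.expectation (?cond \<omega>) (\<lambda>\<omega>. \<phi> (st \<omega> 1) (common 1 \<omega>)))"
    by (subst start) (rule expectation_bind_finite, use start_finite[OF G] ne in auto)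
  also have "\<dots> = measure_pmf.expectation (start G)
      (\<lambda>\<omega>. \<Sum>x\<in>states G 1. pmf (\<mu> (common 1 \<omega>)) x * \<phi> x (common 1 \<omega>))"
  proof (rule expectation_cong_set)
    fix \<omega> assume \<omega>: "\<omega> \<in> set_pmf (start G)"
    define c where "c = common 1 \<omega>"
    have "c \<in> cinfos G 1"
      using common_cinfos[OF start_feasible[OF G \<omega>]] by (simp add: c_def)
    then have simplex: "set_pmf (\<mu> c) \<subseteq> states G 1"
      using \<mu> by (auto simp: is_init_belief_def prob_simplex_def)
    have "measure_pmf.expectation (?cond \<omega>) (\<lambda>\<omega>. \<phi> (st \<omega> 1) (common 1 \<omega>)) =
        measure_pmf.expectation (?cond \<omega>) (\<lambda>\<omega>. \<phi> (st \<omega> 1) c)"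
      using ne[OF \<omega>] by (intro expectation_cong_set) (auto simp: c_def)
    also have "\<dots> = measure_pmf.expectation (map_pmf (\<lambda>\<omega>. st \<omega> 1) (?cond \<omega>)) (\<lambda>x. \<phi> x c)"
      by simp
    also have "map_pmf (\<lambda>\<omega>. st \<omega> 1) (?cond \<omega>) = \<mu> c"
      using \<mu> \<omega> by (auto simp: is_init_belief_def c_def)
    also have "measure_pmf.expectation (\<mu> c) (\<lambda>x. \<phi> x c) = (\<Sum>x\<in>states G 1. pmf (\<mu> c) x * \<phi> x c)"
      using finite_sets[OF G, of 1] simplex by (intro expectation_finite) auto
    finally show "measure_pmf.expectation (?cond \<omega>) (\<lambda>\<omega>. \<phi> (st \<omega> 1) (common 1 \<omega>)) =
        (\<Sum>x\<in>states G 1. pmf (\<mu> (common 1 \<omega>)) x * \<phi> x (common 1 \<omega>))"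
      by (simp add: c_def)
  qed
  finally show ?thesis .
qed

text \<open>The history \<gamma> may be arbitrary, since \<open>F\<close> always lies in the
  simplex. Beliefs are thus legitimate arguments of the selectors even at common information of
  probability 0.\<close>

lemma belief_simplex:
  assumes G: "valid_game G" and \<mu>: "is_init_belief G \<mu>"
    and "n \<le> horizon G" "Suc n \<le> m" "c \<in> cinfos G m"
  shows "belief G \<mu> c \<gamma> (Suc n) \<in> prob_simplex (states G (Suc n))"
  using assms(3-5)
proof (induction n)
  case 0
  then show ?case
    using \<mu> trunc_cinfos[of c G m 1] by (auto simp: is_init_belief_def)
next
  case (Suc n)
  have "snd c \<in> (\<Pi>\<^sub>E \<tau>\<in>{1..<m}. acts2 G \<tau>)" using Suc.prems by (auto simp: cinfos_def)
  then have "snd c (Suc n) \<in> acts2 G (Suc n)" using Suc.prems by (auto simp: PiE_iff)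
  then show ?case
    using F_simplex[OF G, of "Suc n" "snd c (Suc n)"] Suc.prems by simp
qed

lemma belief_eq_bel:
  assumes "\<And>t. 1 \<le> t \<Longrightarrow> t \<le> n \<Longrightarrow> fst (\<gamma> t) = (\<lambda>x. g1 t x (trunc t c))"
  shows "belief G \<mu> c \<gamma> (Suc n) = bel G \<mu> g1 n c"
  using assms by (induction n) auto

lemma bel_simplex:
  assumes "valid_game G" "is_init_belief G \<mu>" "n \<le> horizon G" "c \<in> cinfos G (Suc n)"
  shows "bel G \<mu> g1 n c \<in> prob_simplex (states G (Suc n))"
  using belief_simplex[OF assms(1-3) order_refl assms(4), of "\<lambda>t. (\<lambda>x. g1 t x (trunc t c), undefined)"]
  by (subst (asm) belief_eq_bel) auto

context
  fixes G :: "('x, 'a, 'b, 'y, 's, 'o) game" and \<mu> :: "('b, 'y) cinfo \<Rightarrow> 'x pmf"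
    and g1 :: "nat \<Rightarrow> 'x \<Rightarrow> ('b, 'y) cinfo \<Rightarrow> 'a pmf" and g2 :: "nat \<Rightarrow> ('b, 'y) cinfo \<Rightarrow> 'b pmf"
  assumes G: "valid_game G" and \<mu>: "is_init_belief G \<mu>"
    and g1: "g1 \<in> strat1 G" and g2: "g2 \<in> strat2 G"
begin

lemma play_zero: "play G g1 g2 0 = start G"
  by (simp add: play_def)

text \<open>\<open>bel\<close> is a conditional law of the state given the common information,
  expressed by test functions so that null realizations need no care. The strategy of player 2 does
  not enter \<open>bel\<close>, because its actions are drawn from the common information
  alone.\<close>

lemma expectation_play_belief:
  assumes "n \<le> horizon G"
  shows "measure_pmf.expectation (play G g1 g2 n) (\<lambda>\<omega>. \<phi> (st \<omega> (Suc n)) (common (Suc n) \<omega>)) =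
    measure_pmf.expectation (play G g1 g2 n) (\<lambda>\<omega>. \<Sum>x\<in>states G (Suc n).
      pmf (bel G \<mu> g1 n (common (Suc n) \<omega>)) x * \<phi> x (common (Suc n) \<omega>))"
  using assms
proof (induction n arbitrary: \<phi>)
  case 0
  show ?case
    using expectation_start_belief[OF G \<mu>, of \<phi>] by (simp add: play_zero trunc_common)
next
  case (Suc n)
  then have n: "n < horizon G" and t: "Suc n \<in> {1..horizon G}" by auto
  define p where "p = (\<lambda>\<omega> :: ('x, 'a, 'b, 'y) traj. bel G \<mu> g1 n (common (Suc n) \<omega>))"
  define \<gamma>1 where "\<gamma>1 = (\<lambda>(\<omega> :: ('x, 'a, 'b, 'y) traj) x. g1 (Suc n) x (common (Suc n) \<omega>))"
  define f where "f = (\<lambda>\<omega> y b. F G (Suc n) (p \<omega>) (\<gamma>1 \<omega>) (y, b))"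
  \<comment> \<open>One stage forward: \<theta> is the expectation of \<psi> after the stage, given
    state and common information. The induction hypothesis averages it over the current belief, and
    summing in the other order exhibits the updated belief \<open>f\<close>.\<close>
  have predict: "measure_pmf.expectation (play G g1 g2 (Suc n))
      (\<lambda>\<omega>. \<psi> (st \<omega> (Suc (Suc n))) (common (Suc (Suc n)) \<omega>)) =
    measure_pmf.expectation (play G g1 g2 n) (\<lambda>\<omega>.
      \<Sum>y\<in>obss G (Suc n + 1). \<Sum>b\<in>acts2 G (Suc n). pmf (g2 (Suc n) (common (Suc n) \<omega>)) b *
        (R G (Suc n) (p \<omega>) (\<gamma>1 \<omega>) (y, b) *
        (\<Sum>x\<in>states G (Suc n + 1). pmf (f \<omega> y b) x * \<psi> x (extend_cinfo n (common (Suc n) \<omega>) b y))))"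
    for \<psi>
  proof -
    define \<theta> where "\<theta> x c = (\<Sum>a\<in>acts1 G (Suc n). pmf (g1 (Suc n) x c) a *
        (\<Sum>b\<in>acts2 G (Suc n). pmf (g2 (Suc n) c) b *
          (\<Sum>x'\<in>states G (Suc n + 1). \<Sum>y\<in>obss G (Suc n + 1).
            pmf (kernel G (Suc n) x a b) (x', y) * \<psi> x' (extend_cinfo n c b y))))" for x c
    have "measure_pmf.expectation (play G g1 g2 (Suc n))
        (\<lambda>\<omega>. \<psi> (st \<omega> (Suc (Suc n))) (common (Suc (Suc n)) \<omega>)) =
      measure_pmf.expectation (play G g1 g2 n) (\<lambda>\<omega>. \<theta> (st \<omega> (Suc n)) (common (Suc n) \<omega>))"
      unfolding expectation_play_Suc[OF G g1 g2 n] \<theta>_def common_extend by (simp add: extend_traj_def)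
    also have "\<dots> = measure_pmf.expectation (play G g1 g2 n) (\<lambda>\<omega>. \<Sum>x\<in>states G (Suc n).
      pmf (p \<omega>) x * \<theta> x (common (Suc n) \<omega>))"
      unfolding p_def using n by (intro Suc.IH) simp
    also have "\<dots> = measure_pmf.expectation (play G g1 g2 n) (\<lambda>\<omega>.
      \<Sum>y\<in>obss G (Suc n + 1). \<Sum>b\<in>acts2 G (Suc n). pmf (g2 (Suc n) (common (Suc n) \<omega>)) b *
        (R G (Suc n) (p \<omega>) (\<gamma>1 \<omega>) (y, b) *
        (\<Sum>x\<in>states G (Suc n + 1). pmf (f \<omega> y b) x * \<psi> x (extend_cinfo n (common (Suc n) \<omega>) b y))))"
    proof (rule expectation_cong_set)
      fix \<omega> :: "('x, 'a, 'b, 'y) traj"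
      define c where "c = common (Suc n) \<omega>"
      have "(\<Sum>x\<in>states G (Suc n). pmf (p \<omega>) x * \<theta> x c) =
        (\<Sum>x\<in>states G (Suc n). \<Sum>a\<in>acts1 G (Suc n). pmf (p \<omega>) x * pmf (\<gamma>1 \<omega> x) a *
          (\<Sum>b\<in>acts2 G (Suc n). pmf (g2 (Suc n) c) b *
            (\<Sum>x'\<in>states G (Suc n + 1). \<Sum>y\<in>obss G (Suc n + 1).
              pmf (kernel G (Suc n) x a b) (x', y) * \<psi> x' (extend_cinfo n c b y))))"
        by (intro sum.cong refl) (simp add: \<theta>_def \<gamma>1_def c_def sum_distrib_left mult.assoc)
      also have "\<dots> = (\<Sum>y\<in>obss G (Suc n + 1). \<Sum>b\<in>acts2 G (Suc n). pmf (g2 (Suc n) c) b *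
          (\<Sum>x\<in>states G (Suc n + 1). Q G (Suc n) (p \<omega>) (\<gamma>1 \<omega>) (y, b) x * \<psi> x (extend_cinfo n c b y)))"
        by (rule sum_Q_joint[symmetric])
      also have "\<dots> = (\<Sum>y\<in>obss G (Suc n + 1). \<Sum>b\<in>acts2 G (Suc n). pmf (g2 (Suc n) c) b *
          (R G (Suc n) (p \<omega>) (\<gamma>1 \<omega>) (y, b) *
          (\<Sum>x\<in>states G (Suc n + 1). pmf (f \<omega> y b) x * \<psi> x (extend_cinfo n c b y))))"
        by (intro sum.cong refl arg_cong2[where f = "(*)"]) (simp only: f_def R_mult_F[OF G t])
      finally show "(\<Sum>x\<in>states G (Suc n). pmf (p \<omega>) x * \<theta> x (common (Suc n) \<omega>)) =
        (\<Sum>y\<in>obss G (Suc n + 1). \<Sum>b\<in>acts2 G (Suc n). pmf (g2 (Suc n) (common (Suc n) \<omega>)) b *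
          (R G (Suc n) (p \<omega>) (\<gamma>1 \<omega>) (y, b) *
          (\<Sum>x\<in>states G (Suc n + 1). pmf (f \<omega> y b) x * \<psi> x (extend_cinfo n (common (Suc n) \<omega>) b y))))"
        unfolding c_def .
    qed
    finally show ?thesis .
  qed
  have next_bel: "bel G \<mu> g1 (Suc n) (extend_cinfo n (common (Suc n) \<omega>) b y) = f \<omega> y b" for \<omega> b y
    unfolding f_def p_def \<gamma>1_def by (rule bel_extend)
  have f_one: "(\<Sum>x\<in>states G (Suc n + 1). pmf (f \<omega> y b) x * k) = k" if "b \<in> acts2 G (Suc n)" for \<omega> y b k
    using F_simplex[OF G t that] finite_sets[OF G, of "Suc n + 1"] t
    by (simp add: f_def sum_pmf_simplex flip: sum_distrib_right)
  \<comment> \<open>\<open>predict\<close> is used for \<phi> and for the average of \<phi> over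
    \<open>bel\<close>. The latter does not depend on the state, so averaging it over
    \<open>f\<close> once more changes nothing, and both sides agree.\<close>
  have "measure_pmf.expectation (play G g1 g2 (Suc n)) (\<lambda>\<omega>. \<Sum>x\<in>states G (Suc (Suc n)).
      pmf (bel G \<mu> g1 (Suc n) (common (Suc (Suc n)) \<omega>)) x * \<phi> x (common (Suc (Suc n)) \<omega>)) =
    measure_pmf.expectation (play G g1 g2 (Suc n))
      (\<lambda>\<omega>. \<phi> (st \<omega> (Suc (Suc n))) (common (Suc (Suc n)) \<omega>))"
    unfolding predict[of \<phi>]
      predict[of "\<lambda>_ c. \<Sum>x\<in>states G (Suc (Suc n)). pmf (bel G \<mu> g1 (Suc n) c) x * \<phi> x c"] next_bel
    by (intro expectation_cong_set sum.cong refl) (simp add: f_one[simplified])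
  then show ?case by (rule sym)
qed

text \<open>
  With the belief computed from player 1's own prescriptions, the accumulated cost plus the
  continuation value changes in mean by exactly the Bellman residual of each stage.
\<close>

lemma expectation_play_stage:
  assumes n: "n < horizon G"
  shows "measure_pmf.expectation (play G g1 g2 (Suc n))
      (\<lambda>\<omega>. partial_cost G (Suc n) \<omega> + V (bel G \<mu> g1 (Suc n) (common (Suc (Suc n)) \<omega>))) =
    measure_pmf.expectation (play G g1 g2 n) (\<lambda>\<omega>. partial_cost G n \<omega> +
      stage G (Suc n) V (bel G \<mu> g1 n (common (Suc n) \<omega>)) (\<lambda>x. g1 (Suc n) x (common (Suc n) \<omega>))
        (g2 (Suc n) (common (Suc n) \<omega>)))"
proof -
  have t: "Suc n \<in> {1..horizon G}" using n by simp
  note fin = play_finite[OF G g1 g2, of n]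
  \<comment> \<open>As a continuation vector the next value is constant in the state, so averaging
    over \<open>F\<close> gives it back; this turns \<open>sum_backup\<close> into
    \<open>stage\<close>.\<close>
  define \<beta> where "\<beta> c y b = V (F G (Suc n) (bel G \<mu> g1 n c) (\<lambda>x. g1 (Suc n) x c) (y, b))"
    for c :: "('b, 'y) cinfo" and y b
  let ?b = "\<lambda>x c. \<Sum>a\<in>acts1 G (Suc n). pmf (g1 (Suc n) x c) a *
        backup G (Suc n) (g2 (Suc n) c) (\<lambda>y b x. \<beta> c y b) x a"
  have "measure_pmf.expectation (play G g1 g2 (Suc n))
      (\<lambda>\<omega>. partial_cost G (Suc n) \<omega> + V (bel G \<mu> g1 (Suc n) (common (Suc (Suc n)) \<omega>))) =
    measure_pmf.expectation (play G g1 g2 n)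
      (\<lambda>\<omega>. partial_cost G n \<omega> + ?b (st \<omega> (Suc n)) (common (Suc n) \<omega>))"
    by (rule expectation_play_Suc_cost[OF G g1 g2 n])
      (simp only: partial_cost_extend common_extend bel_extend \<beta>_def)
  also have "\<dots> = measure_pmf.expectation (play G g1 g2 n) (partial_cost G n) +
      measure_pmf.expectation (play G g1 g2 n) (\<lambda>\<omega>. ?b (st \<omega> (Suc n)) (common (Suc n) \<omega>))"
    using n by (intro Bochner_Integration.integral_add integrable_measure_pmf_finite fin) auto
  also have "measure_pmf.expectation (play G g1 g2 n) (\<lambda>\<omega>. ?b (st \<omega> (Suc n)) (common (Suc n) \<omega>)) =
    measure_pmf.expectation (play G g1 g2 n) (\<lambda>\<omega>. \<Sum>x\<in>states G (Suc n).
      pmf (bel G \<mu> g1 n (common (Suc n) \<omega>)) x * ?b x (common (Suc n) \<omega>))"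
    using n by (intro expectation_play_belief) simp
  also have "\<dots> = measure_pmf.expectation (play G g1 g2 n) (\<lambda>\<omega>.
      stage G (Suc n) V (bel G \<mu> g1 n (common (Suc n) \<omega>)) (\<lambda>x. g1 (Suc n) x (common (Suc n) \<omega>))
        (g2 (Suc n) (common (Suc n) \<omega>)))"
  proof (rule expectation_cong_set)
    fix \<omega> :: "('x, 'a, 'b, 'y) traj"
    define c where "c = common (Suc n) \<omega>"
    have one: "(\<Sum>x\<in>states G (Suc n + 1). pmf (F G (Suc n) p q (y, b)) x * k) = k"
      if "b \<in> acts2 G (Suc n)" for p q b y k
      using F_simplex[OF G t that] finite_sets[OF G, of "Suc n + 1"] t
      by (simp add: sum_pmf_simplex flip: sum_distrib_right)
    have "(\<Sum>x\<in>states G (Suc n). pmf (bel G \<mu> g1 n c) x * ?b x c) =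
      (\<Sum>x\<in>states G (Suc n). \<Sum>a\<in>acts1 G (Suc n). pmf (bel G \<mu> g1 n c) x * pmf (g1 (Suc n) x c) a *
        backup G (Suc n) (g2 (Suc n) c) (\<lambda>y b x. \<beta> c y b) x a)"
      by (simp add: sum_distrib_left mult.assoc)
    also have "\<dots> = stage G (Suc n) V (bel G \<mu> g1 n c) (\<lambda>x. g1 (Suc n) x c) (g2 (Suc n) c)"
      unfolding sum_backup[OF G t] stage_def \<beta>_def by (simp add: one[simplified] cong: sum.cong)
    finally show "(\<Sum>x\<in>states G (Suc n). pmf (bel G \<mu> g1 n (common (Suc n) \<omega>)) x * ?b x (common (Suc n) \<omega>)) =
      stage G (Suc n) V (bel G \<mu> g1 n (common (Suc n) \<omega>)) (\<lambda>x. g1 (Suc n) x (common (Suc n) \<omega>))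
        (g2 (Suc n) (common (Suc n) \<omega>))"
      unfolding c_def .
  qed
  also have "measure_pmf.expectation (play G g1 g2 n) (partial_cost G n) + \<dots> =
    measure_pmf.expectation (play G g1 g2 n) (\<lambda>\<omega>. partial_cost G n \<omega> +
      stage G (Suc n) V (bel G \<mu> g1 n (common (Suc n) \<omega>)) (\<lambda>x. g1 (Suc n) x (common (Suc n) \<omega>))
        (g2 (Suc n) (common (Suc n) \<omega>)))"
    using n by (intro Bochner_Integration.integral_add[symmetric] integrable_measure_pmf_finite fin) auto
  finally show ?thesis .
qed

section \<open>Bounding the cost by telescoping over the stages\<close>

lemma game_cost_play:
  assumes "\<And>\<pi>. W \<pi> = 0"
  shows "game_cost G g1 g2 = measure_pmf.expectation (play G g1 g2 (horizon G)) (\<lambda>\<omega>.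
    partial_cost G (horizon G) \<omega> + W (bel G \<mu> g1 (horizon G) (common (Suc (horizon G)) \<omega>)))"
  by (simp add: game_cost_def play_def partial_cost_def assms total_cost_def[abs_def])

text \<open>The expected cost of \<open>n\<close> stages plus the value after them grows by at most
  \<open>e\<close> per stage. Exact selectors use \<open>e = 0\<close>, near optimal ones an error
  divided by the horizon.\<close>

lemma game_cost_le:
  fixes e :: real
  assumes V0: "\<And>\<pi>. V (Suc (horizon G)) \<pi> = 0"
    and V: "\<And>n c. n < horizon G \<Longrightarrow> c \<in> cinfos G (Suc n) \<Longrightarrow>
      stage G (Suc n) (V (Suc (Suc n))) (bel G \<mu> g1 n c) (\<lambda>x. g1 (Suc n) x c) (g2 (Suc n) c)
        \<le> V (Suc n) (bel G \<mu> g1 n c) + e"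
  shows "game_cost G g1 g2 \<le>
    measure_pmf.expectation (start G) (\<lambda>\<omega>. V 1 (\<mu> (common 1 \<omega>))) + horizon G * e"
proof -
  let ?E = "\<lambda>n. measure_pmf.expectation (play G g1 g2 n) (\<lambda>\<omega>.
    partial_cost G n \<omega> + V (Suc n) (bel G \<mu> g1 n (common (Suc n) \<omega>)))"
  have "?E n \<le> ?E 0 + n * e" if "n \<le> horizon G" for n
    using that
  proof (induction n)
    case (Suc n)
    have "?E (Suc n) \<le> measure_pmf.expectation (play G g1 g2 n) (\<lambda>\<omega>.
        (partial_cost G n \<omega> + V (Suc n) (bel G \<mu> g1 n (common (Suc n) \<omega>))) + e)"
    proof (subst expectation_play_stage, use Suc in simp, rule expectation_mono_finite)
      show "finite (set_pmf (play G g1 g2 n))" using play_finite[OF G g1 g2] Suc by simp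
      fix \<omega> assume "\<omega> \<in> set_pmf (play G g1 g2 n)"
      then have "common (Suc n) \<omega> \<in> cinfos G (Suc n)"
        using play_feasible[OF G g1 g2, of n] Suc by (auto intro: common_cinfos)
      from V[OF _ this] Suc show "partial_cost G n \<omega> +
          stage G (Suc n) (V (Suc (Suc n))) (bel G \<mu> g1 n (common (Suc n) \<omega>))
            (\<lambda>x. g1 (Suc n) x (common (Suc n) \<omega>)) (g2 (Suc n) (common (Suc n) \<omega>))
        \<le> (partial_cost G n \<omega> + V (Suc n) (bel G \<mu> g1 n (common (Suc n) \<omega>))) + e" by simp
    qed
    also have "\<dots> = ?E n + e"
      using play_finite[OF G g1 g2, of n] Suc
      by (subst Bochner_Integration.integral_add) (auto intro: integrable_measure_pmf_finite)
    finally show ?case using Suc by (simp add: algebra_simps)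
  qed simp
  from this[of "horizon G"] show ?thesis
    using game_cost_play[of "V (Suc (horizon G))", OF V0]
    by (simp add: play_zero partial_cost_def trunc_common)
qed

lemma game_cost_ge:
  assumes V0: "\<And>\<pi>. V (Suc (horizon G)) \<pi> = 0"
    and V: "\<And>n c. n < horizon G \<Longrightarrow> c \<in> cinfos G (Suc n) \<Longrightarrow>
      V (Suc n) (bel G \<mu> g1 n c)
        \<le> stage G (Suc n) (V (Suc (Suc n))) (bel G \<mu> g1 n c) (\<lambda>x. g1 (Suc n) x c) (g2 (Suc n) c)"
  shows "measure_pmf.expectation (start G) (\<lambda>\<omega>. V 1 (\<mu> (common 1 \<omega>))) \<le> game_cost G g1 g2"
proof -
  let ?E = "\<lambda>n. measure_pmf.expectation (play G g1 g2 n) (\<lambda>\<omega>.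
    partial_cost G n \<omega> + V (Suc n) (bel G \<mu> g1 n (common (Suc n) \<omega>)))"
  have "?E 0 \<le> ?E n" if "n \<le> horizon G" for n
    using that
  proof (induction n)
    case (Suc n)
    have "?E n \<le> ?E (Suc n)"
    proof (subst expectation_play_stage, use Suc in simp, rule expectation_mono_finite)
      show "finite (set_pmf (play G g1 g2 n))" using play_finite[OF G g1 g2] Suc by simp
      fix \<omega> assume "\<omega> \<in> set_pmf (play G g1 g2 n)"
      then have "common (Suc n) \<omega> \<in> cinfos G (Suc n)"
        using play_feasible[OF G g1 g2, of n] Suc by (auto intro: common_cinfos)
      from V[OF _ this] Suc show "partial_cost G n \<omega> + V (Suc n) (bel G \<mu> g1 n (common (Suc n) \<omega>))
        \<le> partial_cost G n \<omega> +
          stage G (Suc n) (V (Suc (Suc n))) (bel G \<mu> g1 n (common (Suc n) \<omega>))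
            (\<lambda>x. g1 (Suc n) x (common (Suc n) \<omega>)) (g2 (Suc n) (common (Suc n) \<omega>))" by simp
    qed
    with Suc show ?case by simp
  qed simp
  from this[of "horizon G"] show ?thesis
    using game_cost_play[of "V (Suc (horizon G))", OF V0]
    by (simp add: play_zero partial_cost_def trunc_common)
qed

text \<open>A crude bound, but uniform over the strategies, as \<open>value_if_eps_optimal\<close>
  asks. Summing over all triples avoids maxima over finite sets.\<close>

lemma abs_game_cost_le:
  "\<bar>game_cost G g1 g2\<bar> \<le>
     (\<Sum>t=1..horizon G. \<Sum>x\<in>states G t. \<Sum>a\<in>acts1 G t. \<Sum>b\<in>acts2 G t. \<bar>cost G t x a b\<bar>)" (is "_ \<le> ?C")
proof -
  note fin = play_finite[OF G g1 g2 order_refl]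
  have bound: "\<bar>total_cost G \<omega>\<bar> \<le> ?C" if "\<omega> \<in> set_pmf (play G g1 g2 (horizon G))" for \<omega>
  proof -
    have f: "feasible G (horizon G) \<omega>" using that play_feasible[OF G g1 g2 order_refl] by blast
    have "\<bar>cost G t (st \<omega> t) (ac1 \<omega> t) (ac2 \<omega> t)\<bar> \<le>
        (\<Sum>x\<in>states G t. \<Sum>a\<in>acts1 G t. \<Sum>b\<in>acts2 G t. \<bar>cost G t x a b\<bar>)" if t: "t \<in> {1..horizon G}" for t
    proof -
      have mem: "st \<omega> t \<in> states G t" "ac1 \<omega> t \<in> acts1 G t" "ac2 \<omega> t \<in> acts2 G t"
        using f t by (auto simp: feasible_def)
      have "\<bar>cost G t (st \<omega> t) (ac1 \<omega> t) (ac2 \<omega> t)\<bar> \<le> (\<Sum>b\<in>acts2 G t. \<bar>cost G t (st \<omega> t) (ac1 \<omega> t) b\<bar>)"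
        using mem finite_sets[OF G] t by (intro member_le_sum) auto
      also have "\<dots> \<le> (\<Sum>a\<in>acts1 G t. \<Sum>b\<in>acts2 G t. \<bar>cost G t (st \<omega> t) a b\<bar>)"
        using mem finite_sets[OF G] t
        by (intro member_le_sum[where f = "\<lambda>a. \<Sum>b\<in>acts2 G t. \<bar>cost G t (st \<omega> t) a b\<bar>"]) (auto intro: sum_nonneg)
      also have "\<dots> \<le> (\<Sum>x\<in>states G t. \<Sum>a\<in>acts1 G t. \<Sum>b\<in>acts2 G t. \<bar>cost G t x a b\<bar>)"
        using mem finite_sets[OF G] t
        by (intro member_le_sum[where f = "\<lambda>x. \<Sum>a\<in>acts1 G t. \<Sum>b\<in>acts2 G t. \<bar>cost G t x a b\<bar>"])
          (auto intro!: sum_nonneg)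
      finally show ?thesis .
    qed
    then show ?thesis unfolding total_cost_def by (intro order_trans[OF sum_abs] sum_mono)
  qed
  have cost: "game_cost G g1 g2 = measure_pmf.expectation (play G g1 g2 (horizon G)) (total_cost G)"
    by (simp add: game_cost_def play_def)
  have "game_cost G g1 g2 \<le> measure_pmf.expectation (play G g1 g2 (horizon G)) (\<lambda>_. ?C)"
    unfolding cost using bound by (intro expectation_mono_finite fin) (auto simp: abs_le_iff)
  moreover have "measure_pmf.expectation (play G g1 g2 (horizon G)) (\<lambda>_. - ?C) \<le> game_cost G g1 g2"
    unfolding cost using bound by (intro expectation_mono_finite fin) (force simp: abs_le_iff)
  ultimately show ?thesis by (simp add: abs_le_iff)
qed

end

section \<open>A strategy of player 2 from a guaranteed vector\<close>

text \<open>The counterpart of a belief for player 2: the vector it still promises after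
  \<open>n\<close> stages, updated by \<open>s\<close> from its own action and observation
  alone.\<close>

primrec track ::
  "(nat \<Rightarrow> ('x \<Rightarrow> real) \<Rightarrow> 'y \<Rightarrow> 'b \<Rightarrow> 'x \<Rightarrow> real) \<Rightarrow> (('b, 'y) cinfo \<Rightarrow> 'x \<Rightarrow> real)
   \<Rightarrow> nat \<Rightarrow> ('b, 'y) cinfo \<Rightarrow> 'x \<Rightarrow> real" where
  "track s \<alpha> 0 c = \<alpha> (trunc 1 c)"
| "track s \<alpha> (Suc n) c = s (Suc n) (track s \<alpha> n c) (fst c (Suc (Suc n))) (snd c (Suc n))"

lemma track_trunc: "track s \<alpha> n (trunc (Suc n) c) = track s \<alpha> n c"
proof (induction n arbitrary: c)
  case 0
  show ?case by (simp add: trunc_trunc)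
next
  case (Suc n)
  have "track s \<alpha> n (trunc (Suc (Suc n)) c) = track s \<alpha> n c"
    by (metis Suc trunc_trunc le_SucI order_refl)
  then show ?case by simp (simp add: trunc_def)
qed

lemma track_extend:
  "track s \<alpha> (Suc n) (extend_cinfo n c b y) = s (Suc n) (track s \<alpha> n c) y b"
proof -
  have "track s \<alpha> n (extend_cinfo n c b y) = track s \<alpha> n c"
    by (metis track_trunc trunc_extend_cinfo)
  then show ?thesis by simp (simp add: extend_cinfo_def)
qed

text \<open>Player 2 plays a \<gamma>2 that witnesses the current vector and passes to the matching
  \<open>\<beta> y b\<close>. A witness does at least as well as the vector at every state and
  action, so cost so far plus the promised entry at the true state does not decrease in mean,
  although player 2 is not told that state. After the horizon the promise is at most 0.\<close>

lemma guaranteed_strategy: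
  fixes G :: "('x, 'a, 'b, 'y, 's, 'o) game" and \<alpha> :: "('b, 'y) cinfo \<Rightarrow> 'x \<Rightarrow> real"
  assumes G: "valid_game G" and \<alpha>: "\<And>c. c \<in> cinfos G 1 \<Longrightarrow> \<alpha> c \<in> guaranteed G 1"
  obtains g2 where "g2 \<in> strat2 G"
    "\<And>g1. g1 \<in> strat1 G \<Longrightarrow>
      measure_pmf.expectation (start G) (\<lambda>\<omega>. \<alpha> (common 1 \<omega>) (st \<omega> 1)) \<le> game_cost G g1 g2"
proof -
  define ok where "ok t \<eta> p \<longleftrightarrow> fst p \<in> presc2 G t \<and>
       (\<forall>y\<in>obss G (t + 1). \<forall>b\<in>acts2 G t. snd p y b \<in> guaranteed G (t + 1)) \<and>
       (\<forall>x\<in>states G t. \<forall>a\<in>acts1 G t. \<eta> x \<le> backup G t (fst p) (snd p) x a)"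
    for t \<eta> and p :: "'b pmf \<times> ('y \<Rightarrow> 'b \<Rightarrow> 'x \<Rightarrow> real)"
  define ch where "ch t \<eta> = (SOME p. ok t \<eta> p)" for t \<eta>
  have ok_ch: "ok t \<eta> (ch t \<eta>)" if t: "t \<in> {1..horizon G}" and \<eta>: "\<eta> \<in> guaranteed G t" for t \<eta>
  proof -
    obtain \<gamma>2 \<beta> where "\<gamma>2 \<in> presc2 G t"
      "\<forall>y\<in>obss G (t + 1). \<forall>b\<in>acts2 G t. \<beta> y b \<in> guaranteed G (t + 1)"
      "\<forall>x\<in>states G t. \<forall>a\<in>acts1 G t. \<eta> x \<le> backup G t \<gamma>2 \<beta> x a"
      using \<eta> t by (simp add: guaranteed.simps[of G t]) blast
    then have "ok t \<eta> (\<gamma>2, \<beta>)" by (simp add: ok_def)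
    then show ?thesis unfolding ch_def by (rule someI)
  qed
  define A where "A = track (\<lambda>t \<eta>. snd (ch t \<eta>)) \<alpha>"
  \<comment> \<open>The shift by one: \<open>track\<close> counts completed stages, and at time
    \<open>t\<close> there are \<open>t - 1\<close> of them.\<close>
  define g2 where "g2 t c = fst (ch t (A (t - 1) c))" for t c
  have A: "A n c \<in> guaranteed G (Suc n)" if "n \<le> horizon G" "Suc n \<le> m" "c \<in> cinfos G m" for n m c
    using that
  proof (induction n)
    case 0
    then show ?case using \<alpha> trunc_cinfos[of c G m 1] by (simp add: A_def)
  next
    case (Suc n)
    have "fst c \<in> (\<Pi>\<^sub>E \<tau>\<in>{1..m}. obss G \<tau>)" "snd c \<in> (\<Pi>\<^sub>E \<tau>\<in>{1..<m}. acts2 G \<tau>)"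
      using Suc.prems by (auto simp: cinfos_def)
    then have "fst c (Suc (Suc n)) \<in> obss G (Suc (Suc n))" "snd c (Suc n) \<in> acts2 G (Suc n)"
      using Suc.prems by (auto simp: PiE_iff)
    moreover have "ok (Suc n) (A n c) (ch (Suc n) (A n c))"
      using Suc by (intro ok_ch) auto
    ultimately show ?case by (simp add: ok_def A_def)
  qed
  have ok: "ok (Suc n) (A n c) (ch (Suc n) (A n c))" if "n < horizon G" "c \<in> cinfos G (Suc n)" for n c
    using that A[of n "Suc n" c] by (intro ok_ch) auto
  have g2: "g2 \<in> strat2 G"
  proof -
    have "g2 t c \<in> presc2 G t" if t: "t \<in> {1..horizon G}" and c: "c \<in> cinfos G t" for t c
    proof -
      obtain n where "t = Suc n" using t by (cases t) auto
      then show ?thesis using ok[of n c] t c by (simp add: g2_def ok_def)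
    qed
    then show ?thesis by (simp add: strat2_def presc2_def)
  qed
  have "measure_pmf.expectation (start G) (\<lambda>\<omega>. \<alpha> (common 1 \<omega>) (st \<omega> 1)) \<le> game_cost G g1 g2"
    if g1: "g1 \<in> strat1 G" for g1
  proof -
    let ?E = "\<lambda>n. measure_pmf.expectation (play G g1 g2 n)
      (\<lambda>\<omega>. partial_cost G n \<omega> + A n (common (Suc n) \<omega>) (st \<omega> (Suc n)))"
    note feasible = play_feasible[OF G g1 g2]
    have "?E 0 \<le> ?E n" if "n \<le> horizon G" for n
      using that
    proof (induction n)
      case (Suc n)
      then have n: "n < horizon G" by simp
      have step: "?E (Suc n) = measure_pmf.expectation (play G g1 g2 n) (\<lambda>\<omega>. partial_cost G n \<omega> +
        (\<Sum>a\<in>acts1 G (Suc n). pmf (g1 (Suc n) (st \<omega> (Suc n)) (common (Suc n) \<omega>)) a *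
          backup G (Suc n) (g2 (Suc n) (common (Suc n) \<omega>))
            (snd (ch (Suc n) (A n (common (Suc n) \<omega>)))) (st \<omega> (Suc n)) a))"
        by (rule expectation_play_Suc_cost[OF G g1 g2 n, where \<beta> = "\<lambda>c. snd (ch (Suc n) (A n c))"])
          (simp add: partial_cost_extend common_extend A_def track_extend del: track.simps,
            simp add: extend_traj_def)
      have "?E n \<le> ?E (Suc n)"
        unfolding step
      proof (rule expectation_mono_finite)
        show "finite (set_pmf (play G g1 g2 n))" using feasible n by simp
        fix \<omega> assume "\<omega> \<in> set_pmf (play G g1 g2 n)"
        then have f: "feasible G n \<omega>" using feasible n by auto
        define c where "c = common (Suc n) \<omega>"
        define x where "x = st \<omega> (Suc n)"
        have c: "c \<in> cinfos G (Suc n)" using common_cinfos[OF f] by (simp add: c_def)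
        have x: "x \<in> states G (Suc n)" using f by (simp add: feasible_def x_def)
        have one: "sum (pmf (g1 (Suc n) x c)) (acts1 G (Suc n)) = 1"
          using strategies_simplex(1)[OF G g1 g2 n c x] finite_sets[OF G, of "Suc n"] n
          by (simp add: sum_pmf_simplex)
        \<comment> \<open>The guarantee holds for each action separately, hence for every mixture
          that player 1 may use at \<open>x\<close>.\<close>
        have "A n c x = (\<Sum>a\<in>acts1 G (Suc n). pmf (g1 (Suc n) x c) a * A n c x)"
          using one by (simp flip: sum_distrib_right)
        also have "\<dots> \<le> (\<Sum>a\<in>acts1 G (Suc n). pmf (g1 (Suc n) x c) a *
            backup G (Suc n) (g2 (Suc n) c) (snd (ch (Suc n) (A n c))) x a)"
          using ok[OF n c] x by (intro sum_mono mult_left_mono) (auto simp: ok_def g2_def)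
        finally show "partial_cost G n \<omega> + A n (common (Suc n) \<omega>) (st \<omega> (Suc n)) \<le> partial_cost G n \<omega> +
          (\<Sum>a\<in>acts1 G (Suc n). pmf (g1 (Suc n) (st \<omega> (Suc n)) (common (Suc n) \<omega>)) a *
            backup G (Suc n) (g2 (Suc n) (common (Suc n) \<omega>))
              (snd (ch (Suc n) (A n (common (Suc n) \<omega>)))) (st \<omega> (Suc n)) a)"
          unfolding c_def x_def by simp
      qed
      with Suc show ?case by simp
    qed simp
    then have "?E 0 \<le> ?E (horizon G)" by simp
    also have "\<dots> \<le> measure_pmf.expectation (play G g1 g2 (horizon G)) (total_cost G)"
    proof (rule expectation_mono_finite)
      show "finite (set_pmf (play G g1 g2 (horizon G)))" using feasible by simp
      fix \<omega> assume "\<omega> \<in> set_pmf (play G g1 g2 (horizon G))"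
      then have f: "feasible G (horizon G) \<omega>" using feasible by auto
      have "A (horizon G) (common (Suc (horizon G)) \<omega>) \<in> guaranteed G (Suc (horizon G))"
        by (rule A[OF order_refl order_refl common_cinfos[OF f]])
      moreover have "st \<omega> (Suc (horizon G)) \<in> states G (Suc (horizon G))"
        using f by (simp add: feasible_def)
      ultimately show "partial_cost G (horizon G) \<omega> +
          A (horizon G) (common (Suc (horizon G)) \<omega>) (st \<omega> (Suc (horizon G))) \<le> total_cost G \<omega>"
        by (simp add: guaranteed.simps partial_cost_def total_cost_def)
    qed
    also have "\<dots> = game_cost G g1 g2" by (simp add: game_cost_def play_def)
    finally show ?thesis by (simp add: A_def trunc_common partial_cost_def play_def)
  qed
  with g2 show thesis by (rule that)
qed

section \<open>From virtual strategies to behavioral strategies\<close>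

text \<open>Prescriptions depend on a trajectory only through \<open>ob\<close> and \<open>ac2\<close>, so the other fields are dummies.\<close>

definition cinfo_traj :: "('b, 'y) cinfo \<Rightarrow> ('x, 'a, 'b, 'y) traj" where
  "cinfo_traj c = \<lparr>st = \<lambda>_. undefined, ob = fst c, ac1 = \<lambda>_. undefined, ac2 = snd c\<rparr>"

text \<open>Prescriptions are functions of common information and earlier prescriptions, so with
  both virtual strategies fixed the recursion unrolls into functions of common information alone.
  This is why the opponent is an argument too.\<close>

definition behav1 ::
  "('x, 'a, 'b, 'y) vstrategy1 \<Rightarrow> ('x, 'a, 'b, 'y) vstrategy2 \<Rightarrow> nat \<Rightarrow> 'x \<Rightarrow> ('b, 'y) cinfo \<Rightarrow> 'a pmf" where
  "behav1 \<psi>1 \<psi>2 t x c = fst (played \<psi>1 \<psi>2 (cinfo_traj c) t t) x"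

definition behav2 ::
  "('x, 'a, 'b, 'y) vstrategy1 \<Rightarrow> ('x, 'a, 'b, 'y) vstrategy2 \<Rightarrow> nat \<Rightarrow> ('b, 'y) cinfo \<Rightarrow> 'b pmf" where
  "behav2 \<psi>1 \<psi>2 t c = snd (played \<psi>1 \<psi>2 (cinfo_traj c) t t)"

lemma common_cinfo_traj: "common n (cinfo_traj c) = trunc n c"
  by (simp add: common_def cinfo_traj_def)

lemma played_common:
  assumes "common n \<omega> = common n \<omega>'"
  shows "played \<psi>1 \<psi>2 \<omega> n = played \<psi>1 \<psi>2 \<omega>' n"
  using assms
proof (induction n)
  case (Suc n)
  have "common n \<omega> = common n \<omega>'" using Suc.prems by (metis trunc_common le_SucI order_refl)
  with Suc show ?case by simp
qed simp

lemma played_stable: "1 \<le> t \<Longrightarrow> t \<le> n \<Longrightarrow> played \<psi>1 \<psi>2 \<omega> n t = played \<psi>1 \<psi>2 \<omega> t t"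
  by (induction n) (auto simp: Let_def le_Suc_eq)

lemma played_cinfo_traj: "played \<psi>1 \<psi>2 (cinfo_traj (common n \<omega>)) n = played \<psi>1 \<psi>2 \<omega> n"
  by (rule played_common) (simp add: common_cinfo_traj trunc_common)

text \<open>Bounds on \<open>game_cost\<close> for all behavioral pairs carry over to the virtual
  game, since both costs are expectations under the same \<open>law\<close>.\<close>

lemma vgame_cost_behav: "vgame_cost G \<psi>1 \<psi>2 = game_cost G (behav1 \<psi>1 \<psi>2) (behav2 \<psi>1 \<psi>2)"
  by (simp add: vgame_cost_def game_cost_def behav1_def behav2_def played_cinfo_traj)

lemma played_presc_hists:
  assumes \<psi>: "\<psi>1 \<in> vstrat1 G" "\<psi>2 \<in> vstrat2 G" and "n \<le> horizon G" "c \<in> cinfos G m" "n \<le> m"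
  shows "played \<psi>1 \<psi>2 (cinfo_traj c) n \<in> presc_hists G (Suc n)"
  using assms(3-5)
proof (induction n)
  case 0
  then show ?case by (auto simp: presc_hists_def)
next
  case (Suc n)
  let ?\<gamma> = "played \<psi>1 \<psi>2 (cinfo_traj c) n"
  have "?\<gamma> \<in> presc_hists G (Suc n)" using Suc by simp
  moreover have "trunc (Suc n) c \<in> cinfos G (Suc n)"
    using trunc_cinfos[OF Suc.prems(2,3)] .
  ultimately have "(\<psi>1 (Suc n) (trunc (Suc n) c) ?\<gamma>, \<psi>2 (Suc n) (trunc (Suc n) c) ?\<gamma>)
      \<in> presc1 G (Suc n) \<times> presc2 G (Suc n)"
    using \<psi> Suc.prems by (auto simp: vstrat1_def vstrat2_def)
  moreover have "{1..<Suc (Suc n)} = insert (Suc n) {1..<Suc n}" by auto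
  ultimately show ?case
    using \<open>?\<gamma> \<in> presc_hists G (Suc n)\<close> unfolding presc_hists_def
    by (simp only: played.simps Let_def common_cinfo_traj) (intro PiE_fun_upd; simp)
qed

lemma played_presc:
  assumes \<psi>: "\<psi>1 \<in> vstrat1 G" "\<psi>2 \<in> vstrat2 G" and t: "t \<in> {1..horizon G}" and c: "c \<in> cinfos G t"
  shows "fst (played \<psi>1 \<psi>2 (cinfo_traj c) t t) \<in> presc1 G t"
    "snd (played \<psi>1 \<psi>2 (cinfo_traj c) t t) \<in> presc2 G t"
proof -
  have "played \<psi>1 \<psi>2 (cinfo_traj c) t \<in> presc_hists G (Suc t)"
    using played_presc_hists[OF \<psi> _ c order_refl] t by simp
  then have "\<forall>\<tau>\<in>{1..<Suc t}. played \<psi>1 \<psi>2 (cinfo_traj c) t \<tau> \<in> presc1 G \<tau> \<times> presc2 G \<tau>"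
    by (simp add: presc_hists_def PiE_iff)
  with t have "played \<psi>1 \<psi>2 (cinfo_traj c) t t \<in> presc1 G t \<times> presc2 G t" by simp
  then show "fst (played \<psi>1 \<psi>2 (cinfo_traj c) t t) \<in> presc1 G t"
    "snd (played \<psi>1 \<psi>2 (cinfo_traj c) t t) \<in> presc2 G t"
    by (simp_all add: mem_Times_iff)
qed

lemma behav_strat:
  assumes "\<psi>1 \<in> vstrat1 G" "\<psi>2 \<in> vstrat2 G"
  shows "behav1 \<psi>1 \<psi>2 \<in> strat1 G" "behav2 \<psi>1 \<psi>2 \<in> strat2 G"
proof -
  show "behav1 \<psi>1 \<psi>2 \<in> strat1 G"
    unfolding strat1_def behav1_def
    by (intro CollectI ballI presc1_simplex[OF played_presc(1)[OF assms]])
  show "behav2 \<psi>1 \<psi>2 \<in> strat2 G"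
    unfolding strat2_def behav2_def presc2_def[symmetric]
    by (intro CollectI ballI played_presc(2)[OF assms])
qed

text \<open>This brings \<open>chi1\<close> and \<open>chi2\<close> into reach of the telescoping
  bounds: the first \<open>t\<close> prescriptions see only \<open>trunc t c\<close>, so the visible
  history is the one from which \<open>bel\<close> is built.\<close>

lemma belief_played:
  "belief G \<mu> c (played \<psi>1 \<psi>2 (cinfo_traj c) n) (Suc n) = bel G \<mu> (behav1 \<psi>1 \<psi>2) n c"
proof (rule belief_eq_bel)
  fix t assume t: "1 \<le> t" "t \<le> n"
  have "played \<psi>1 \<psi>2 (cinfo_traj c) t = played \<psi>1 \<psi>2 (cinfo_traj (trunc t c)) t"
    by (rule played_common) (simp add: common_cinfo_traj trunc_trunc)
  then show "fst (played \<psi>1 \<psi>2 (cinfo_traj c) n t) = (\<lambda>x. behav1 \<psi>1 \<psi>2 t x (trunc t c))"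
    by (simp only: behav1_def played_stable[OF t])
qed

lemma behav_chi:
  assumes "c \<in> cinfos G (Suc n)"
  shows "behav1 (chi1 G \<mu> \<Xi>) \<psi>2 (Suc n) x c = \<Xi> (Suc n) (bel G \<mu> (behav1 (chi1 G \<mu> \<Xi>) \<psi>2) n c) x"
    "behav2 \<psi>1 (chi2 G \<mu> \<Theta>) (Suc n) c = \<Theta> (Suc n) (bel G \<mu> (behav1 \<psi>1 (chi2 G \<mu> \<Theta>)) n c)"
  unfolding behav1_def[of _ _ "Suc n"] behav2_def[of _ _ "Suc n"]
  by (simp_all only: played.simps Let_def fun_upd_same fst_conv snd_conv chi1_def chi2_def
    common_cinfo_traj trunc_id[OF assms] belief_played)

lemma belief_simplex_stage:
  assumes G: "valid_game G" and \<mu>: "is_init_belief G \<mu>"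
    and t: "t \<in> {1..horizon G}" and c: "c \<in> cinfos G t"
  shows "belief G \<mu> c \<gamma> t \<in> prob_simplex (states G t)"
proof -
  obtain n where "t = Suc n" using t by (cases t) auto
  with t c show ?thesis by (simp only:) (rule belief_simplex[OF G \<mu>], auto)
qed

lemma chi1_vstrat:
  assumes "valid_game G" "is_init_belief G \<mu>"
    and \<Xi>: "\<And>t \<pi>. t \<in> {1..horizon G} \<Longrightarrow> \<pi> \<in> prob_simplex (states G t) \<Longrightarrow> \<Xi> t \<pi> \<in> presc1 G t"
  shows "chi1 G \<mu> \<Xi> \<in> vstrat1 G"
  unfolding vstrat1_def chi1_def
  by (intro CollectI ballI \<Xi> belief_simplex_stage assms(1,2))

lemma chi2_vstrat:
  assumes "valid_game G" "is_init_belief G \<mu>"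
    and \<Theta>: "\<And>t \<pi>. t \<in> {1..horizon G} \<Longrightarrow> \<pi> \<in> prob_simplex (states G t) \<Longrightarrow> \<Theta> t \<pi> \<in> presc2 G t"
  shows "chi2 G \<mu> \<Theta> \<in> vstrat2 G"
  unfolding vstrat2_def chi2_def
  by (intro CollectI ballI \<Theta> belief_simplex_stage assms(1,2))

lemma embed_vstrat2: "g2 \<in> strat2 G \<Longrightarrow> (\<lambda>t c _. g2 t c) \<in> vstrat2 G"
  by (simp add: vstrat2_def strat2_def presc2_def)

text \<open>A player 2 who ignores the prescriptions. \<open>behav2\<close> gives back
  \<open>g2\<close> only on truncated common information, so the strategies themselves may differ;
  the laws of play agree because only truncated information occurs.\<close>

lemma vgame_cost_embed:
  fixes G :: "('x, 'a, 'b, 'y, 's, 'o) game"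
  shows "vgame_cost G \<psi>1 (\<lambda>t c _. g2 t c) = game_cost G (behav1 \<psi>1 (\<lambda>t c _. g2 t c)) g2"
proof -
  define g1 where "g1 = behav1 \<psi>1 (\<lambda>t c _. g2 t c)"
  define g2' where "g2' = behav2 \<psi>1 (\<lambda>t c _. g2 t c)"
  have g2': "g2' (Suc n) (common (Suc n) \<omega>) = g2 (Suc n) (common (Suc n) \<omega>)"
    for n and \<omega> :: "('x, 'a, 'b, 'y) traj"
    by (simp add: g2'_def behav2_def common_cinfo_traj trunc_common Let_def)
  have "play G g1 g2' n = play G g1 g2 n" for n
    by (induction n) (simp_all add: play_def g2')
  then show ?thesis
    unfolding vgame_cost_behav game_cost_def play_def[symmetric] g1_def g2'_def by simp
qed

section \<open>The value of the game\<close>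

lemma simplex_borel_space: "space (simplex_borel A) = prob_simplex A"
  by (simp add: simplex_borel_def)

context
  fixes G :: "('x, 'a, 'b, 'y, 's, 'o) game" and \<mu> :: "('b, 'y) cinfo \<Rightarrow> 'x pmf"
  assumes G: "valid_game G" and \<mu>: "is_init_belief G \<mu>"
begin

lemma start_cinfos: "\<omega> \<in> set_pmf (start G) \<Longrightarrow> common 1 \<omega> \<in> cinfos G 1"
  using common_cinfos[OF start_feasible[OF G]] by simp

lemma init_belief_simplex: "c \<in> cinfos G 1 \<Longrightarrow> \<mu> c \<in> prob_simplex (states G 1)"
  using \<mu> by (auto simp: is_init_belief_def)

lemma expectation_Vl_eq_Vu:
  "measure_pmf.expectation (start G) (\<lambda>\<omega>. Vl G 1 (\<mu> (common 1 \<omega>))) =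
   measure_pmf.expectation (start G) (\<lambda>\<omega>. Vu G 1 (\<mu> (common 1 \<omega>)))"
  by (intro expectation_cong_set Vl_eq_Vu[OF G] init_belief_simplex start_cinfos) auto

text \<open>The value of the game is stated without any selector, so near optimal prescriptions are
  taken from the definition of the infimum.\<close>

lemma eps_selector:
  assumes "e > 0"
  obtains \<Xi> where "\<And>t \<pi>. t \<in> {1..horizon G} \<Longrightarrow> \<pi> \<in> prob_simplex (states G t) \<Longrightarrow> \<Xi> t \<pi> \<in> presc1 G t"
    "\<And>t \<pi> \<gamma>2. t \<in> {1..horizon G} \<Longrightarrow> \<pi> \<in> prob_simplex (states G t) \<Longrightarrow> \<gamma>2 \<in> presc2 G t \<Longrightarrow>
      stage G t (Vu G (t + 1)) \<pi> (\<Xi> t \<pi>) \<gamma>2 \<le> Vu G t \<pi> + e"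
proof -
  define good where "good t \<pi> \<gamma>1 \<longleftrightarrow> \<gamma>1 \<in> presc1 G t \<and>
    (\<forall>\<gamma>2\<in>presc2 G t. stage G t (Vu G (t + 1)) \<pi> \<gamma>1 \<gamma>2 \<le> Vu G t \<pi> + e)" for t \<pi> \<gamma>1
  define \<Xi> where "\<Xi> t \<pi> = (SOME \<gamma>1. good t \<pi> \<gamma>1)" for t \<pi>
  have "good t \<pi> (\<Xi> t \<pi>)" if t: "t \<in> {1..horizon G}" and \<pi>: "\<pi> \<in> prob_simplex (states G t)" for t \<pi>
  proof -
    have "(INF \<gamma>1\<in>presc1 G t. SUP \<gamma>2\<in>presc2 G t. stage G t (Vu G (t + 1)) \<pi> \<gamma>1 \<gamma>2) < Vu G t \<pi> + e"
      using t \<open>e > 0\<close> by (simp add: Vu.simps[of G t])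
    from cInf_lessD[OF _ this] obtain \<gamma>1 where \<gamma>1: "\<gamma>1 \<in> presc1 G t"
      "(SUP \<gamma>2\<in>presc2 G t. stage G t (Vu G (t + 1)) \<pi> \<gamma>1 \<gamma>2) < Vu G t \<pi> + e"
      using presc_nonempty[OF G t] by blast
    have "stage G t (Vu G (t + 1)) \<pi> \<gamma>1 \<gamma>2 \<le> Vu G t \<pi> + e" if "\<gamma>2 \<in> presc2 G t" for \<gamma>2
      using cSUP_upper[OF that stage_bounded(1)[OF G t _ \<pi> \<gamma>1(1), of Vu]] \<gamma>1(2) by simp
    with \<gamma>1(1) have "\<exists>\<gamma>1. good t \<pi> \<gamma>1" by (auto simp: good_def)
    then show ?thesis unfolding \<Xi>_def by (rule someI_ex)
  qed
  then show thesis by (intro that[of \<Xi>]) (auto simp: good_def)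
qed

text \<open>The partner \<psi>2 that unrolls \<open>chi1\<close> and the opponent \<open>g2\<close>
  are independent: in the original game any \<psi>2 serves, in the virtual game \<open>g2\<close> is
  the unrolled \<psi>2 itself. This is possible since the belief is driven only by player 1's own
  prescriptions and the common information.\<close>

lemma game_cost_chi1_le:
  fixes e :: real
  assumes \<Xi>: "\<And>t \<pi>. t \<in> {1..horizon G} \<Longrightarrow> \<pi> \<in> prob_simplex (states G t) \<Longrightarrow> \<Xi> t \<pi> \<in> presc1 G t"
    "\<And>t \<pi> \<gamma>2. t \<in> {1..horizon G} \<Longrightarrow> \<pi> \<in> prob_simplex (states G t) \<Longrightarrow> \<gamma>2 \<in> presc2 G t \<Longrightarrow>
      stage G t (Vu G (t + 1)) \<pi> (\<Xi> t \<pi>) \<gamma>2 \<le> Vu G t \<pi> + e"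
    and \<psi>2: "\<psi>2 \<in> vstrat2 G" and g2: "g2 \<in> strat2 G"
  shows "game_cost G (behav1 (chi1 G \<mu> \<Xi>) \<psi>2) g2 \<le>
    measure_pmf.expectation (start G) (\<lambda>\<omega>. Vu G 1 (\<mu> (common 1 \<omega>))) + horizon G * e"
proof (rule game_cost_le[OF G \<mu> behav_strat(1)[OF chi1_vstrat[OF G \<mu> \<Xi>(1)] \<psi>2] g2, where V = "Vu G"])
  show "Vu G (Suc (horizon G)) \<pi> = 0" for \<pi> by (simp add: Vu.simps)
  fix n c assume n: "n < horizon G" and c: "c \<in> cinfos G (Suc n)"
  let ?g1 = "behav1 (chi1 G \<mu> \<Xi>) \<psi>2"
  have eq: "(\<lambda>x. ?g1 (Suc n) x c) = \<Xi> (Suc n) (bel G \<mu> ?g1 n c)"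
    by (rule ext) (rule behav_chi(1)[OF c])
  have "bel G \<mu> ?g1 n c \<in> prob_simplex (states G (Suc n))"
    using n by (intro bel_simplex[OF G \<mu> _ c]) simp
  moreover have "g2 (Suc n) c \<in> presc2 G (Suc n)"
    using g2 n c by (auto simp: strat2_def presc2_def)
  ultimately show "stage G (Suc n) (Vu G (Suc (Suc n))) (bel G \<mu> ?g1 n c) (\<lambda>x. ?g1 (Suc n) x c) (g2 (Suc n) c)
      \<le> Vu G (Suc n) (bel G \<mu> ?g1 n c) + e"
    unfolding eq using \<Xi>(2)[of "Suc n"] n by simp
qed simp_all

text \<open>Whatever \<psi>1 selects, the belief that \<open>chi2\<close> reads off the history is
  \<open>bel\<close> of the unrolled strategy, so the selector inequality applies stage by
  stage.\<close>

lemma vgame_cost_chi2_ge: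
  assumes \<Theta>: "\<And>t \<pi>. t \<in> {1..horizon G} \<Longrightarrow> \<pi> \<in> prob_simplex (states G t) \<Longrightarrow> \<Theta> t \<pi> \<in> presc2 G t"
    "\<And>t \<pi> \<gamma>1. t \<in> {1..horizon G} \<Longrightarrow> \<pi> \<in> prob_simplex (states G t) \<Longrightarrow> \<gamma>1 \<in> presc1 G t \<Longrightarrow>
      Vl G t \<pi> \<le> stage G t (Vl G (t + 1)) \<pi> \<gamma>1 (\<Theta> t \<pi>)"
    and \<psi>1: "\<psi>1 \<in> vstrat1 G"
  shows "measure_pmf.expectation (start G) (\<lambda>\<omega>. Vl G 1 (\<mu> (common 1 \<omega>))) \<le> vgame_cost G \<psi>1 (chi2 G \<mu> \<Theta>)"
proof -
  have \<psi>2: "chi2 G \<mu> \<Theta> \<in> vstrat2 G" by (rule chi2_vstrat[OF G \<mu> \<Theta>(1)])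
  show ?thesis
    unfolding vgame_cost_behav
  proof (rule game_cost_ge[OF G \<mu> behav_strat[OF \<psi>1 \<psi>2], where V = "Vl G"])
    show "Vl G (Suc (horizon G)) \<pi> = 0" for \<pi> by (simp add: Vl.simps)
    fix n c assume n: "n < horizon G" and c: "c \<in> cinfos G (Suc n)"
    let ?g1 = "behav1 \<psi>1 (chi2 G \<mu> \<Theta>)"
    have "bel G \<mu> ?g1 n c \<in> prob_simplex (states G (Suc n))"
      using n by (intro bel_simplex[OF G \<mu> _ c]) simp
    moreover have "(\<lambda>x. ?g1 (Suc n) x c) \<in> presc1 G (Suc n)"
      using played_presc(1)[OF \<psi>1 \<psi>2 _ c] n by (simp add: behav1_def del: played.simps)
    ultimately show "Vl G (Suc n) (bel G \<mu> ?g1 n c) \<le> stage G (Suc n) (Vl G (Suc (Suc n)))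
        (bel G \<mu> ?g1 n c) (\<lambda>x. ?g1 (Suc n) x c) (behav2 \<psi>1 (chi2 G \<mu> \<Theta>) (Suc n) c)"
      unfolding behav_chi(2)[OF c] using \<Theta>(2)[of "Suc n"] n by simp
  qed
qed

lemma upper_strategy:
  assumes "e > 0"
  obtains \<Xi> where "chi1 G \<mu> \<Xi> \<in> vstrat1 G"
    "\<And>\<psi>2 g2. \<psi>2 \<in> vstrat2 G \<Longrightarrow> g2 \<in> strat2 G \<Longrightarrow> game_cost G (behav1 (chi1 G \<mu> \<Xi>) \<psi>2) g2 \<le>
      measure_pmf.expectation (start G) (\<lambda>\<omega>. Vu G 1 (\<mu> (common 1 \<omega>))) + e"
proof -
  have T: "1 \<le> horizon G" using G by (simp add: valid_game_def)
  \<comment> \<open>\<open>game_cost_chi1_le\<close> loses the slack once per stage, so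
    \<open>e\<close> is shared equally among the stages.\<close>
  then have "e / horizon G > 0" using assms by simp
  then obtain \<Xi> where \<Xi>: "\<And>t \<pi>. t \<in> {1..horizon G} \<Longrightarrow> \<pi> \<in> prob_simplex (states G t) \<Longrightarrow> \<Xi> t \<pi> \<in> presc1 G t"
    "\<And>t \<pi> \<gamma>2. t \<in> {1..horizon G} \<Longrightarrow> \<pi> \<in> prob_simplex (states G t) \<Longrightarrow> \<gamma>2 \<in> presc2 G t \<Longrightarrow>
      stage G t (Vu G (t + 1)) \<pi> (\<Xi> t \<pi>) \<gamma>2 \<le> Vu G t \<pi> + e / horizon G"
    by (rule eps_selector) (rule that)
  show thesis
  proof (rule that[OF chi1_vstrat[OF G \<mu> \<Xi>(1)]])
    fix \<psi>2 g2 assume "\<psi>2 \<in> vstrat2 G" "g2 \<in> strat2 G"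
    from game_cost_chi1_le[OF \<Xi> this] T
    show "game_cost G (behav1 (chi1 G \<mu> \<Xi>) \<psi>2) g2 \<le>
      measure_pmf.expectation (start G) (\<lambda>\<omega>. Vu G 1 (\<mu> (common 1 \<omega>))) + e" by simp
  qed simp
qed

text \<open>Player 2 knows \<open>C\<^sub>1\<close> and may start from a different vector for each
  realization, nearly optimal at the belief there. \<open>expectation_start_belief\<close> then
  replaces the average over the belief by the entry at the true initial state.\<close>

lemma lower_strategy:
  assumes "e > 0"
  obtains g2 where "g2 \<in> strat2 G"
    "\<And>g1. g1 \<in> strat1 G \<Longrightarrow>
      measure_pmf.expectation (start G) (\<lambda>\<omega>. Vu G 1 (\<mu> (common 1 \<omega>))) - e \<le> game_cost G g1 g2"
proof -
  define good where "good c \<eta> \<longleftrightarrow> \<eta> \<in> guaranteed G 1 \<and>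
    Vu G 1 (\<mu> c) \<le> (\<Sum>x\<in>states G 1. pmf (\<mu> c) x * \<eta> x) + e" for c \<eta>
  define \<alpha> where "\<alpha> c = (SOME \<eta>. good c \<eta>)" for c
  have \<alpha>: "good c (\<alpha> c)" if "c \<in> cinfos G 1" for c
  proof -
    have "\<exists>\<eta>. good c \<eta>"
      using Vu_le_guaranteed[OF G _ _ init_belief_simplex[OF that] assms] by (auto simp: good_def)
    then show ?thesis unfolding \<alpha>_def by (rule someI_ex)
  qed
  obtain g2 where g2: "g2 \<in> strat2 G" "\<And>g1. g1 \<in> strat1 G \<Longrightarrow>
      measure_pmf.expectation (start G) (\<lambda>\<omega>. \<alpha> (common 1 \<omega>) (st \<omega> 1)) \<le> game_cost G g1 g2"
    using guaranteed_strategy[OF G, of \<alpha>] \<alpha> by (auto simp: good_def)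
  have "measure_pmf.expectation (start G) (\<lambda>\<omega>. Vu G 1 (\<mu> (common 1 \<omega>))) \<le>
    measure_pmf.expectation (start G)
      (\<lambda>\<omega>. (\<Sum>x\<in>states G 1. pmf (\<mu> (common 1 \<omega>)) x * \<alpha> (common 1 \<omega>) x) + e)"
    using \<alpha>[OF start_cinfos] by (intro expectation_mono_finite start_finite[OF G]) (auto simp: good_def)
  also have "\<dots> = measure_pmf.expectation (start G)
      (\<lambda>\<omega>. \<Sum>x\<in>states G 1. pmf (\<mu> (common 1 \<omega>)) x * \<alpha> (common 1 \<omega>) x) + e"
    using start_finite[OF G]
    by (subst Bochner_Integration.integral_add) (auto intro: integrable_measure_pmf_finite)
  also have "\<dots> = measure_pmf.expectation (start G) (\<lambda>\<omega>. \<alpha> (common 1 \<omega>) (st \<omega> 1)) + e"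
    using expectation_start_belief[OF G \<mu>, of "\<lambda>x c. \<alpha> c x"] by simp
  finally have le: "measure_pmf.expectation (start G) (\<lambda>\<omega>. Vu G 1 (\<mu> (common 1 \<omega>))) \<le> \<dots>" .
  show thesis
  proof (rule that[OF g2(1)])
    fix g1 assume "g1 \<in> strat1 G"
    from le g2(2)[OF this]
    show "measure_pmf.expectation (start G) (\<lambda>\<omega>. Vu G 1 (\<mu> (common 1 \<omega>))) - e \<le> game_cost G g1 g2"
      by linarith
  qed
qed

lemma strategies_nonempty: "vstrat1 G \<noteq> {}" "vstrat2 G \<noteq> {}"
proof -
  obtain \<Xi> where "chi1 G \<mu> \<Xi> \<in> vstrat1 G" by (rule upper_strategy[OF zero_less_one])
  then show "vstrat1 G \<noteq> {}" by blast
  obtain g2 where "g2 \<in> strat2 G" by (rule lower_strategy[OF zero_less_one])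
  then show "vstrat2 G \<noteq> {}" using embed_vstrat2 by blast
qed

lemma value_game:
  "is_value G (measure_pmf.expectation (start G) (\<lambda>\<omega>. Vu G 1 (\<mu> (common 1 \<omega>))))" (is "is_value G ?v")
proof -
  let ?C = "\<Sum>t=1..horizon G. \<Sum>x\<in>states G t. \<Sum>a\<in>acts1 G t. \<Sum>b\<in>acts2 G t. \<bar>cost G t x a b\<bar>"
  have bound: "\<bar>game_cost G g1 g2\<bar> \<le> ?C" if "g1 \<in> strat1 G" "g2 \<in> strat2 G" for g1 g2
    by (rule abs_game_cost_le[OF G \<mu> that])
  have upper: "\<exists>g1\<in>strat1 G. \<forall>g2\<in>strat2 G. game_cost G g1 g2 \<le> ?v + e" if e: "e > 0" for e
  proof -
    \<comment> \<open>Any virtual partner will do: it only serves to unroll \<open>chi1\<close> into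
      a behavioral strategy.\<close>
    obtain \<psi>2 where \<psi>2: "\<psi>2 \<in> vstrat2 G" using strategies_nonempty by blast
    obtain \<Xi> where \<Xi>: "chi1 G \<mu> \<Xi> \<in> vstrat1 G"
      "\<And>\<psi>2 g2. \<psi>2 \<in> vstrat2 G \<Longrightarrow> g2 \<in> strat2 G \<Longrightarrow> game_cost G (behav1 (chi1 G \<mu> \<Xi>) \<psi>2) g2 \<le> ?v + e"
      by (rule upper_strategy[OF e]) (rule that)
    show ?thesis
      using \<Xi>(2)[OF \<psi>2] by (intro bexI[OF _ behav_strat(1)[OF \<Xi>(1) \<psi>2]] ballI)
  qed
  have lower: "\<exists>g2\<in>strat2 G. \<forall>g1\<in>strat1 G. ?v - e \<le> game_cost G g1 g2" if e: "e > 0" for e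
    by (rule lower_strategy[OF e]) blast
  show ?thesis
    unfolding is_value_def
  proof
    show "(INF g1\<in>strat1 G. SUP g2\<in>strat2 G. game_cost G g1 g2) = ?v"
      by (rule value_if_eps_optimal(1)[where M = ?C and J = "game_cost G"]) (fact bound upper lower)+
    show "(SUP g2\<in>strat2 G. INF g1\<in>strat1 G. game_cost G g1 g2) = ?v"
      by (rule value_if_eps_optimal(2)[where M = ?C and J = "game_cost G"]) (fact bound upper lower)+
  qed
qed

lemma abs_vgame_cost_le:
  "\<psi>1 \<in> vstrat1 G \<Longrightarrow> \<psi>2 \<in> vstrat2 G \<Longrightarrow> \<bar>vgame_cost G \<psi>1 \<psi>2\<bar> \<le>
    (\<Sum>t=1..horizon G. \<Sum>x\<in>states G t. \<Sum>a\<in>acts1 G t. \<Sum>b\<in>acts2 G t. \<bar>cost G t x a b\<bar>)"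
  unfolding vgame_cost_behav by (intro abs_game_cost_le[OF G \<mu>] behav_strat)

text \<open>Showing the prescriptions to player 2 does not change the value: the belief strategy of
  player 1 holds against every \<psi>2, and the near optimal strategy of player 2 is embedded by
  ignoring the prescriptions.\<close>

lemma value_vgame:
  "(INF \<psi>1\<in>vstrat1 G. SUP \<psi>2\<in>vstrat2 G. vgame_cost G \<psi>1 \<psi>2) =
     measure_pmf.expectation (start G) (\<lambda>\<omega>. Vu G 1 (\<mu> (common 1 \<omega>)))" (is "_ = ?v")
  "(SUP \<psi>2\<in>vstrat2 G. INF \<psi>1\<in>vstrat1 G. vgame_cost G \<psi>1 \<psi>2) =
     measure_pmf.expectation (start G) (\<lambda>\<omega>. Vu G 1 (\<mu> (common 1 \<omega>)))"
proof -
  let ?C = "\<Sum>t=1..horizon G. \<Sum>x\<in>states G t. \<Sum>a\<in>acts1 G t. \<Sum>b\<in>acts2 G t. \<bar>cost G t x a b\<bar>"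
  have upper: "\<exists>\<psi>1\<in>vstrat1 G. \<forall>\<psi>2\<in>vstrat2 G. vgame_cost G \<psi>1 \<psi>2 \<le> ?v + e" if e: "e > 0" for e
  proof -
    obtain \<Xi> where \<Xi>: "chi1 G \<mu> \<Xi> \<in> vstrat1 G"
      "\<And>\<psi>2 g2. \<psi>2 \<in> vstrat2 G \<Longrightarrow> g2 \<in> strat2 G \<Longrightarrow> game_cost G (behav1 (chi1 G \<mu> \<Xi>) \<psi>2) g2 \<le> ?v + e"
      by (rule upper_strategy[OF e]) (rule that)
    show ?thesis
      unfolding vgame_cost_behav
      by (rule bexI[OF _ \<Xi>(1)], rule ballI, rule \<Xi>(2), assumption, rule behav_strat(2)[OF \<Xi>(1)])
  qed
  have lower: "\<exists>\<psi>2\<in>vstrat2 G. \<forall>\<psi>1\<in>vstrat1 G. ?v - e \<le> vgame_cost G \<psi>1 \<psi>2" if e: "e > 0" for e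
  proof -
    obtain g2 where g2: "g2 \<in> strat2 G" "\<And>g1. g1 \<in> strat1 G \<Longrightarrow> ?v - e \<le> game_cost G g1 g2"
      by (rule lower_strategy[OF e]) (rule that)
    have "?v - e \<le> vgame_cost G \<psi>1 (\<lambda>t c _. g2 t c)" if "\<psi>1 \<in> vstrat1 G" for \<psi>1
      unfolding vgame_cost_embed by (rule g2(2)[OF behav_strat(1)[OF that embed_vstrat2[OF g2(1)]]])
    then show ?thesis using embed_vstrat2[OF g2(1)] by blast
  qed
  show "(INF \<psi>1\<in>vstrat1 G. SUP \<psi>2\<in>vstrat2 G. vgame_cost G \<psi>1 \<psi>2) = ?v"
    by (rule value_if_eps_optimal(1)[where M = ?C and J = "vgame_cost G"])
      (erule (1) abs_vgame_cost_le, erule upper, erule lower)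
  show "(SUP \<psi>2\<in>vstrat2 G. INF \<psi>1\<in>vstrat1 G. vgame_cost G \<psi>1 \<psi>2) = ?v"
    by (rule value_if_eps_optimal(2)[where M = ?C and J = "vgame_cost G"])
      (erule (1) abs_vgame_cost_le, erule upper, erule lower)
qed

section \<open>Optimality of the strategies built from exact selectors\<close>

lemma vgame_cost_bdd:
  "\<psi>1 \<in> vstrat1 G \<Longrightarrow> bdd_above (vgame_cost G \<psi>1 ` vstrat2 G)"
  "\<psi>2 \<in> vstrat2 G \<Longrightarrow> bdd_below ((\<lambda>\<psi>1. vgame_cost G \<psi>1 \<psi>2) ` vstrat1 G)"
proof -
  obtain C where C: "\<And>\<psi>1 \<psi>2. \<psi>1 \<in> vstrat1 G \<Longrightarrow> \<psi>2 \<in> vstrat2 G \<Longrightarrow> \<bar>vgame_cost G \<psi>1 \<psi>2\<bar> \<le> C"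
    by (rule that, rule abs_vgame_cost_le)
  show "bdd_above (vgame_cost G \<psi>1 ` vstrat2 G)" if "\<psi>1 \<in> vstrat1 G"
    using C[OF that] by (intro bdd_aboveI[of _ C]) (auto simp: abs_le_iff)
  show "bdd_below ((\<lambda>\<psi>1. vgame_cost G \<psi>1 \<psi>2) ` vstrat1 G)" if "\<psi>2 \<in> vstrat2 G"
    using C[OF _ that] by (intro bdd_belowI[of _ "- C"]) (force simp: abs_le_iff)
qed

lemma chi1_minmax:
  assumes \<Xi>: "is_selector1 G \<Xi>"
  shows "is_minmax_strategy G (chi1 G \<mu> \<Xi>)"
proof -
  let ?v = "measure_pmf.expectation (start G) (\<lambda>\<omega>. Vu G 1 (\<mu> (common 1 \<omega>)))"
  have mem: "\<Xi> t \<pi> \<in> presc1 G t" if "t \<in> {1..horizon G}" "\<pi> \<in> prob_simplex (states G t)" for t \<pi>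
  proof -
    have "\<Xi> t \<in> simplex_borel (states G t) \<rightarrow>\<^sub>M (\<Pi>\<^sub>M x\<in>states G t. simplex_borel (acts1 G t))"
      using \<Xi> that by (auto simp: is_selector1_def)
    from measurable_space[OF this, of \<pi>] that show ?thesis
      by (simp add: simplex_borel_space space_PiM presc1_def)
  qed
  have opt: "stage G t (Vu G (t + 1)) \<pi> (\<Xi> t \<pi>) \<gamma>2 \<le> Vu G t \<pi> + 0"
    if "t \<in> {1..horizon G}" "\<pi> \<in> prob_simplex (states G t)" "\<gamma>2 \<in> presc2 G t" for t \<pi> \<gamma>2
    using \<Xi> that by (auto simp: is_selector1_def wu_def)
  have chi: "chi1 G \<mu> \<Xi> \<in> vstrat1 G" by (rule chi1_vstrat[OF G \<mu> mem])
  have "vgame_cost G (chi1 G \<mu> \<Xi>) \<psi>2 \<le> ?v" if "\<psi>2 \<in> vstrat2 G" for \<psi>2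
    unfolding vgame_cost_behav
    using game_cost_chi1_le[OF mem opt that behav_strat(2)[OF chi that]] by simp
  then have "(SUP \<psi>2\<in>vstrat2 G. vgame_cost G (chi1 G \<mu> \<Xi>) \<psi>2) \<le> ?v"
    using strategies_nonempty by (intro cSUP_least) auto
  \<comment> \<open>A near optimal \<open>g2\<close> of the original game, embedded in the virtual
    one, answers \<open>chi1\<close> as it answers every strategy of player 1, so the supremum
    cannot fall below \<open>?v\<close>.\<close>
  moreover have "?v \<le> (SUP \<psi>2\<in>vstrat2 G. vgame_cost G (chi1 G \<mu> \<Xi>) \<psi>2)"
  proof (rule field_le_epsilon)
    fix e :: real assume e: "e > 0"
    obtain g2 where g2: "g2 \<in> strat2 G" "\<And>g1. g1 \<in> strat1 G \<Longrightarrow> ?v - e \<le> game_cost G g1 g2"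
      by (rule lower_strategy[OF e]) (rule that)
    note emb = embed_vstrat2[OF g2(1)]
    have "?v - e \<le> vgame_cost G (chi1 G \<mu> \<Xi>) (\<lambda>t c _. g2 t c)"
      unfolding vgame_cost_embed by (rule g2(2)[OF behav_strat(1)[OF chi emb]])
    then show "?v \<le> (SUP \<psi>2\<in>vstrat2 G. vgame_cost G (chi1 G \<mu> \<Xi>) \<psi>2) + e"
      using cSUP_upper[OF emb vgame_cost_bdd(1)[OF chi]] by linarith
  qed
  ultimately show ?thesis
    unfolding is_minmax_strategy_def value_vgame using chi by auto
qed

lemma chi2_maxmin:
  assumes \<Theta>: "is_selector2 G \<Theta>"
  shows "is_maxmin_strategy G (chi2 G \<mu> \<Theta>)"
proof -
  let ?v = "measure_pmf.expectation (start G) (\<lambda>\<omega>. Vu G 1 (\<mu> (common 1 \<omega>)))"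
  have mem: "\<Theta> t \<pi> \<in> presc2 G t" if "t \<in> {1..horizon G}" "\<pi> \<in> prob_simplex (states G t)" for t \<pi>
  proof -
    have "\<Theta> t \<in> simplex_borel (states G t) \<rightarrow>\<^sub>M simplex_borel (acts2 G t)"
      using \<Theta> that by (auto simp: is_selector2_def)
    from measurable_space[OF this, of \<pi>] that show ?thesis
      by (simp add: simplex_borel_space presc2_def)
  qed
  have opt: "Vl G t \<pi> \<le> stage G t (Vl G (t + 1)) \<pi> \<gamma>1 (\<Theta> t \<pi>)"
    if "t \<in> {1..horizon G}" "\<pi> \<in> prob_simplex (states G t)" "\<gamma>1 \<in> presc1 G t" for t \<pi> \<gamma>1
    using \<Theta> that by (auto simp: is_selector2_def wl_def)
  have chi: "chi2 G \<mu> \<Theta> \<in> vstrat2 G" by (rule chi2_vstrat[OF G \<mu> mem])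
  have "?v \<le> vgame_cost G \<psi>1 (chi2 G \<mu> \<Theta>)" if "\<psi>1 \<in> vstrat1 G" for \<psi>1
    using vgame_cost_chi2_ge[OF mem opt that] unfolding expectation_Vl_eq_Vu .
  then have "?v \<le> (INF \<psi>1\<in>vstrat1 G. vgame_cost G \<psi>1 (chi2 G \<mu> \<Theta>))"
    using strategies_nonempty by (intro cINF_greatest) auto
  moreover have "(INF \<psi>1\<in>vstrat1 G. vgame_cost G \<psi>1 (chi2 G \<mu> \<Theta>)) \<le> ?v"
  proof (rule field_le_epsilon)
    fix e :: real assume e: "e > 0"
    obtain \<Xi> where \<Xi>: "chi1 G \<mu> \<Xi> \<in> vstrat1 G"
      "\<And>\<psi>2 g2. \<psi>2 \<in> vstrat2 G \<Longrightarrow> g2 \<in> strat2 G \<Longrightarrow> game_cost G (behav1 (chi1 G \<mu> \<Xi>) \<psi>2) g2 \<le> ?v + e"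
      by (rule upper_strategy[OF e]) (rule that)
    have "vgame_cost G (chi1 G \<mu> \<Xi>) (chi2 G \<mu> \<Theta>) \<le> ?v + e"
      unfolding vgame_cost_behav by (rule \<Xi>(2)[OF chi behav_strat(2)[OF \<Xi>(1) chi]])
    then show "(INF \<psi>1\<in>vstrat1 G. vgame_cost G \<psi>1 (chi2 G \<mu> \<Theta>)) \<le> ?v + e"
      using cINF_lower[OF vgame_cost_bdd(2)[OF chi] \<Xi>(1)] by linarith
  qed
  ultimately show ?thesis
    unfolding is_maxmin_strategy_def value_vgame using chi by auto
qed

end

theorem lemma8:
  fixes G :: "('x, 'a, 'b, 'y, 's, 'o) game"
    and b :: "('b, 'y) cinfo \<Rightarrow> 'x pmf"
  assumes "valid_game G"
    and "is_init_belief G b"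
  shows "is_value G (measure_pmf.expectation (start G) (\<lambda>\<omega>. Vu G 1 (b (common 1 \<omega>))))
    \<and> measure_pmf.expectation (start G) (\<lambda>\<omega>. Vu G 1 (b (common 1 \<omega>))) =
      measure_pmf.expectation (start G) (\<lambda>\<omega>. Vl G 1 (b (common 1 \<omega>)))
    \<and> (\<forall>\<Xi>1. is_selector1 G \<Xi>1 \<longrightarrow> is_minmax_strategy G (chi1 G b \<Xi>1))
    \<and> (\<forall>\<Xi>2. is_selector2 G \<Xi>2 \<longrightarrow> is_maxmin_strategy G (chi2 G b \<Xi>2))"
  using value_game[OF assms] expectation_Vl_eq_Vu[OF assms, symmetric]
    chi1_minmax[OF assms] chi2_maxmin[OF assms]
  by blast

end
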